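(* Assume $p>n+1$ and $\chi$ analytic. Then for every $w\in W$, the action of the pro-$p$ Iwahori group $G$ on $\mathrm{ind}_{P_w^+}^B(\chi^w)$ by $(h\cdot f)(g)=f(h^{-1}g)$ is globally analytic.
   Context: $p$ prime, $n\ge2$, $K$ a finite extension of $\mathbb{Q}_p$ (ramification index $e$, $v_p(p)=1$). $G\subset GL_n(\mathbb{Z}_p)$ is the pro-$p$ Iwahori subgroup (diagonal in $1+p\mathbb{Z}_p$, above diagonal in $p\mathbb{Z}_p$, below in $\mathbb{Z}_p$); $B$ the Iwahori subgroup of matrices lower triangular mod $p$; $U$ the lower unipotent matrices over $\mathbb{Z}_p$; $P^+$ the upper triangular matrices in $GL_n(\mathbb{Z}_p)$; $W$ the group of $n\times n$ permutation matrices; $P_w^+=B\cap wP^+w^{-1}$; $B=(wUw^{-1}\cap B)P_w^+$ uniquely. $\chi(\mathrm{diag}(t_i))=\prod\chi_i(t_i)$, $\chi_i(1+pu)=\exp(c_i\log(1+pu))$, $c_i\in K$; $\chi$ analytic means $v_p(c_i)>\frac e{p-1}-1$ for all $i$; $\chi^w(h)=\chi(w^{-1}hw)$, extended to $P_w^+$ trivially on the non-diagonal part. $\mathrm{ind}_{P_w^+}^B(\chi^w)$ denotes the globally analytic vectors of $\{f$ locally analytic on $B$: $f(gb)=\chi^w(b^{-1})f(g),\ b\in P_w^+\}$, i.e. the Tate algebra $\mathcal{A}(wUw^{-1}\cap B,K)$ of power series with coefficients tending to $0$ on $wUw^{-1}\cap B\cong\mathbb{Z}_p^{n(n-1)/2}$.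 For $p>n+1$, $G$ is rigid-analytically the ordered product of one-parameter subgroups $1+yE_{i,j}$ ($i>j$, $y\in\mathbb{Z}_p$), diagonal subgroups ($t\in1+p\mathbb{Z}_p$) and $1+yE_{i,j}$ ($i<j$, $y\in p\mathbb{Z}_p$); an action on a Banach space is globally analytic if every orbit map is a convergent power series in these coordinates with coefficients tending to $0$. *)

theory Defs
  imports
    "HOL-Analysis.Infinite_Sum"
    "HOL-Library.Extended_Real"
    "HOL-Combinatorics.Permutations"
    "HOL-Computational_Algebra.Primes"
    "Jordan_Normal_Form.Gauss_Jordan_Elimination"
begin

class nonarch_field = field_char_0 + complete_space +
  fixes vabs :: "'a \<Rightarrow> real"
  assumes dist_vabs: "dist x y = vabs (x - y)"
    and vabs_mult: "vabs (x * y) = vabs x * vabs y"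
    and vabs_ultrametric: "vabs (x + y) \<le> max (vabs x) (vabs y)"

instance nonarch_field < topological_ab_group_add
proof
  fix a b :: 'a
  have n0: "vabs (- x) = vabs x" for x :: 'a
    using dist_commute[of 0 x] by (simp add: dist_vabs)
  show "((\<lambda>x. fst x + snd x) \<longlongrightarrow> a + b) (nhds a \<times>\<^sub>F nhds b)"
  proof (rule tendstoI)
    fix e :: real assume e: "0 < e"
    have "\<forall>\<^sub>F x in nhds a \<times>\<^sub>F nhds b. dist (fst x) a < e \<and> dist (snd x) b < e"
      using e by (intro eventually_prodI tendstoD[OF filterlim_ident])
    then show "\<forall>\<^sub>F x in nhds a \<times>\<^sub>F nhds b. dist (fst x + snd x) (a + b) < e"
    proof eventually_elim
      case (elim x)
      have "vabs ((fst x - a) + (snd x - b)) < e"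
        using vabs_ultrametric[of "fst x - a" "snd x - b"] elim by (auto simp: dist_vabs)
      then show ?case by (simp add: dist_vabs algebra_simps)
    qed
  qed
  show "(uminus \<longlongrightarrow> - a) (nhds a)"
  proof (rule tendstoI)
    fix e :: real assume "0 < e"
    then have "\<forall>\<^sub>F x in nhds a. dist x a < e"
      by (intro tendstoD[OF filterlim_ident])
    then show "\<forall>\<^sub>F x in nhds a. dist (- x) (- a) < e"
      by eventually_elim (metis dist_vabs minus_diff_minus n0)
  qed
qed

instance nonarch_field < topological_semigroup_mult
proof
  fix a b :: 'a
  show "((\<lambda>x. fst x * snd x) \<longlongrightarrow> a * b) (nhds a \<times>\<^sub>F nhds b)"
  proof (rule tendstoI)
    fix e :: real assume e: "0 < e"
    have nn: "vabs x \<ge> 0" for x :: 'a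
      using zero_le_dist[of x 0] by (simp add: dist_vabs)
    define d where "d = min 1 (e / (1 + vabs a + vabs b))"
    have d: "0 < d" "d \<le> 1" "d * (1 + vabs a + vabs b) \<le> e"
      using e nn[of a] nn[of b] by (auto simp: d_def min_def field_simps add_pos_nonneg)
    have "\<forall>\<^sub>F x in nhds a \<times>\<^sub>F nhds b. dist (fst x) a < d \<and> dist (snd x) b < d"
      using d by (intro eventually_prodI tendstoD[OF filterlim_ident])
    then show "\<forall>\<^sub>F x in nhds a \<times>\<^sub>F nhds b. dist (fst x * snd x) (a * b) < e"
    proof eventually_elim
      case (elim x)
      define s t where "s = fst x - a" and "t = snd x - b"
      have st: "vabs s < d" "vabs t < d" using elim by (auto simp: s_def t_def dist_vabs)
      have pos: "0 < 1 + vabs a + vabs b" using nn[of a] nn[of b] by linarith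
      have bd: "u * v < e"
        if "0 \<le> u" "u < d" "0 \<le> v" "v \<le> 1 + vabs a + vabs b" for u v :: real
        using that pos d(3) mult_strict_right_mono[OF that(2) pos] mult_left_mono[OF that(4,1)]
        by linarith
      have "fst x * snd x - a * b = s * t + (s * b + t * a)"
        by (simp add: s_def t_def algebra_simps)
      moreover have "vabs (s * t + (s * b + t * a)) \<le>
          max (vabs s * vabs t) (max (vabs s * vabs b) (vabs t * vabs a))"
        using vabs_ultrametric[of "s * t" "s * b + t * a"] vabs_ultrametric[of "s * b" "t * a"]
        by (auto simp: vabs_mult)
      moreover have "vabs s * vabs t < e" "vabs s * vabs b < e" "vabs t * vabs a < e"
        using bd nn st d(2) nn[of a] nn[of b] by (smt (verit))+
      ultimately show ?case by (simp add: dist_vabs)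
    qed
  qed
qed


text \<open>
  A complete non-archimedean field is used as a model of a finite extension \<open>K\<close> of
  \<open>\<rat>\<^sub>p\<close>: once \<open>\<bar>p\<bar> = 1/p\<close>, the absolute value restricts to the \<open>p\<close>-adic one on \<open>\<rat>\<close>, so the closure
  of \<open>\<rat>\<close> in \<open>K\<close> is its \<open>p\<close>-adic completion.
\<close>

definition Qp :: "'k::nonarch_field set" where
  "Qp = closure \<rat>"

definition Zp :: "'k::nonarch_field set" where
  "Zp = {x \<in> Qp. vabs x \<le> 1}"

definition Zp_units :: "'k::nonarch_field set" where
  "Zp_units = {x \<in> Zp. \<exists>y\<in>Zp. x * y = 1}"

definition pZp :: "nat \<Rightarrow> 'k::nonarch_field set" where
  "pZp p = {of_nat p * x | x. x \<in> Zp}"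

definition finite_extension_Qp :: "nat \<Rightarrow> 'k::nonarch_field itself \<Rightarrow> bool" where
  "finite_extension_Qp p _ \<longleftrightarrow>
     vabs (of_nat p :: 'k) = 1 / real p \<and>
     (\<exists>S::'k set. finite S \<and>
       (\<forall>x. \<exists>a. (\<forall>s\<in>S. a s \<in> Qp) \<and> x = (\<Sum>s\<in>S. a s * s)))"

definition padic_val :: "nat \<Rightarrow> 'k::nonarch_field \<Rightarrow> ereal" where
  "padic_val p x = (if x = 0 then \<infinity> else ereal (- log (real p) (vabs x)))"

text \<open>The index of the value group of \<open>\<rat>\<^sub>p\<close> in that of \<open>K\<close>, as the number of cosets.\<close>

definition ramification_index :: "'k::nonarch_field itself \<Rightarrow> nat" where
  "ramification_index _ =
     card ((\<lambda>r. (\<lambda>s. r * s) ` vabs ` (Qp - {0::'k})) ` vabs ` (UNIV - {0::'k}))"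

definition padic_exp :: "'k::nonarch_field \<Rightarrow> 'k" where
  "padic_exp x = (\<Sum>k. x ^ k / fact k)"

definition padic_log :: "'k::nonarch_field \<Rightarrow> 'k" where
  "padic_log x = (\<Sum>k. (- 1) ^ k * (x - 1) ^ Suc k / of_nat (Suc k))"


abbreviation minv :: "'k::nonarch_field mat \<Rightarrow> 'k mat" where
  "minv A \<equiv> the (mat_inverse A)"

definition Mat_Zp :: "nat \<Rightarrow> 'k::nonarch_field mat set" where
  "Mat_Zp n = {g \<in> carrier_mat n n. \<forall>i<n. \<forall>j<n. g $$ (i,j) \<in> Zp}"

definition GL_Zp :: "nat \<Rightarrow> 'k::nonarch_field mat set" where
  "GL_Zp n = {g \<in> Mat_Zp n. \<exists>g'\<in>Mat_Zp n. g * g' = 1\<^sub>m n \<and> g' * g = 1\<^sub>m n}"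

definition Iwahori :: "nat \<Rightarrow> nat \<Rightarrow> 'k::nonarch_field mat set" where
  "Iwahori p n = {g \<in> GL_Zp n. \<forall>i j. i < j \<and> j < n \<longrightarrow> g $$ (i,j) \<in> pZp p}"

definition pro_p_Iwahori :: "nat \<Rightarrow> nat \<Rightarrow> 'k::nonarch_field mat set" where
  "pro_p_Iwahori p n = {g \<in> GL_Zp n.
     (\<forall>i<n. g $$ (i,i) - 1 \<in> pZp p) \<and>
     (\<forall>i j. i < j \<and> j < n \<longrightarrow> g $$ (i,j) \<in> pZp p)}"

definition lower_unipotent :: "nat \<Rightarrow> 'k::nonarch_field mat set" where
  "lower_unipotent n = {g \<in> Mat_Zp n.
     (\<forall>i<n. g $$ (i,i) = 1) \<and> (\<forall>i j. i < j \<and> j < n \<longrightarrow> g $$ (i,j) = 0)}"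

definition upper_borel :: "nat \<Rightarrow> 'k::nonarch_field mat set" where
  "upper_borel n = {g \<in> GL_Zp n. upper_triangular g}"

definition perm_matrices :: "nat \<Rightarrow> 'k::nonarch_field mat set" where
  "perm_matrices n =
     {mat n n (\<lambda>(i,j). if i = \<sigma> j then 1 else 0) | \<sigma>. \<sigma> permutes {..<n}}"

definition conj_set :: "'k::nonarch_field mat \<Rightarrow> 'k mat set \<Rightarrow> 'k mat set" where
  "conj_set w H = (\<lambda>h. w * h * minv w) ` H"

definition Pw :: "nat \<Rightarrow> nat \<Rightarrow> 'k::nonarch_field mat \<Rightarrow> 'k mat set" where
  "Pw p n w = Iwahori p n \<inter> conj_set w (upper_borel n)"

definition Uw :: "nat \<Rightarrow> nat \<Rightarrow> 'k::nonarch_field mat \<Rightarrow> 'k mat set" where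
  "Uw p n w = conj_set w (lower_unipotent n) \<inter> Iwahori p n"

text \<open>\<open>\<chi>\<close> is given by its components \<open>\<chi> 0, \<dots>, \<chi> (n - 1)\<close>; since \<open>w\<inverse> b w\<close> is upper triangular
  for \<open>b\<close> in \<^term>\<open>Pw p n w\<close>, this reads off its diagonal part.\<close>

definition char_w :: "nat \<Rightarrow> (nat \<Rightarrow> 'k \<Rightarrow> 'k) \<Rightarrow> 'k mat \<Rightarrow> 'k mat \<Rightarrow> 'k::nonarch_field" where
  "char_w n \<chi> w b = (\<Prod>i<n. \<chi> i ((minv w * b * w) $$ (i,i)))"

definition is_character :: "('k \<Rightarrow> 'k::nonarch_field) \<Rightarrow> bool" where
  "is_character \<psi> \<longleftrightarrow> (\<forall>s\<in>Zp_units. \<psi> s \<noteq> 0) \<and>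
     (\<forall>s\<in>Zp_units. \<forall>t\<in>Zp_units. \<psi> (s * t) = \<psi> s * \<psi> t)"


definition multi_indices :: "'i set \<Rightarrow> ('i \<Rightarrow> nat) set" where
  "multi_indices I = {\<alpha>. \<forall>i. i \<notin> I \<longrightarrow> \<alpha> i = 0}"

definition mpower :: "'i set \<Rightarrow> ('i \<Rightarrow> 'k::nonarch_field) \<Rightarrow> ('i \<Rightarrow> nat) \<Rightarrow> 'k" where
  "mpower I x \<alpha> = (\<Prod>i\<in>I. x i ^ \<alpha> i)"

definition tends_to_0 :: "'i set \<Rightarrow> (('i \<Rightarrow> nat) \<Rightarrow> real) \<Rightarrow> bool" where
  "tends_to_0 I r \<longleftrightarrow> (\<forall>\<epsilon>>0. finite {\<alpha> \<in> multi_indices I. \<bar>r \<alpha>\<bar> \<ge> \<epsilon>})"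

text \<open>The function \<open>f\<close> on \<open>X\<close> is the power series with coefficients \<open>a\<close>, tending to \<open>0\<close>, in the
  coordinates \<open>crd x i\<close> for \<open>i \<in> I\<close>.\<close>

definition tate_expansion ::
  "'i set \<Rightarrow> 'x set \<Rightarrow> ('x \<Rightarrow> 'i \<Rightarrow> 'k) \<Rightarrow> ('x \<Rightarrow> 'k) \<Rightarrow> (('i \<Rightarrow> nat) \<Rightarrow> 'k::nonarch_field) \<Rightarrow> bool" where
  "tate_expansion I X crd f a \<longleftrightarrow>
     (\<forall>\<alpha>. \<alpha> \<notin> multi_indices I \<longrightarrow> a \<alpha> = 0) \<and>
     tends_to_0 I (\<lambda>\<alpha>. vabs (a \<alpha>)) \<and>
     (\<forall>x\<in>X. ((\<lambda>\<alpha>. a \<alpha> * mpower I (crd x) \<alpha>) has_sum f x) (multi_indices I))"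

definition all_pos :: "nat \<Rightarrow> (nat \<times> nat) set" where
  "all_pos n = {..<n} \<times> {..<n}"

definition Zp_points :: "'i set \<Rightarrow> ('i \<Rightarrow> 'k::nonarch_field) set" where
  "Zp_points I = {z. \<forall>i\<in>I. z i \<in> Zp}"

definition locally_analytic_on_Iwahori ::
  "nat \<Rightarrow> nat \<Rightarrow> ('k::nonarch_field mat \<Rightarrow> 'k) \<Rightarrow> bool" where
  "locally_analytic_on_Iwahori p n f \<longleftrightarrow>
     (\<forall>g\<in>Iwahori p n. \<exists>m::nat.
        (let nbhd = (\<lambda>z. g + mat n n (\<lambda>ij. of_nat p ^ m * z ij)) in
         (\<forall>z\<in>Zp_points (all_pos n). nbhd z \<in> Iwahori p n) \<and>
         (\<exists>a. tate_expansion (all_pos n) (Zp_points (all_pos n)) (\<lambda>z. z) (\<lambda>z. f (nbhd z)) a)))"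

text \<open>The positions of the free entries of \<open>w U w\<inverse>\<close>: conjugation by \<open>w\<close> moves the entry \<open>(i, j)\<close> to
  \<open>(a, b)\<close> when \<open>w\<close> maps the standard basis vectors \<open>e\<^sub>i, e\<^sub>j\<close> to \<open>e\<^sub>a, e\<^sub>b\<close>. On \<^term>\<open>Uw p n w\<close>
  those above the diagonal run over \<open>p\<int>\<^sub>p\<close> and are divided by \<open>p\<close>, which identifies
  \<^term>\<open>Uw p n w\<close> with \<open>\<int>\<^sub>p\<close>-points.\<close>

definition Uw_pos :: "nat \<Rightarrow> 'k::nonarch_field mat \<Rightarrow> (nat \<times> nat) set" where
  "Uw_pos n w = {(a,b). a < n \<and> b < n \<and>
     (\<exists>i j. j < i \<and> i < n \<and> w $$ (a,i) = 1 \<and> w $$ (b,j) = 1)}"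

definition Uw_crd :: "nat \<Rightarrow> 'k::nonarch_field mat \<Rightarrow> nat \<times> nat \<Rightarrow> 'k" where
  "Uw_crd p u = (\<lambda>(a,b). if a < b then u $$ (a,b) / of_nat p else u $$ (a,b))"

definition Uw_expansion ::
  "nat \<Rightarrow> nat \<Rightarrow> 'k::nonarch_field mat \<Rightarrow> ('k mat \<Rightarrow> 'k) \<Rightarrow> (((nat \<times> nat) \<Rightarrow> nat) \<Rightarrow> 'k) \<Rightarrow> bool" where
  "Uw_expansion p n w f a \<longleftrightarrow> tate_expansion (Uw_pos n w) (Uw p n w) (Uw_crd p) f a"

text \<open>Functions on \<^term>\<open>Iwahori p n\<close> are extended by \<open>0\<close>.\<close>

definition ind ::
  "nat \<Rightarrow> nat \<Rightarrow> (nat \<Rightarrow> 'k \<Rightarrow> 'k) \<Rightarrow> 'k mat \<Rightarrow> ('k::nonarch_field mat \<Rightarrow> 'k) set" where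
  "ind p n \<chi> w = {f.
     (\<forall>g. g \<notin> Iwahori p n \<longrightarrow> f g = 0) \<and>
     locally_analytic_on_Iwahori p n f \<and>
     (\<forall>g\<in>Iwahori p n. \<forall>b\<in>Pw p n w. f (g * b) = char_w n \<chi> w (minv b) * f g) \<and>
     (\<exists>a. Uw_expansion p n w f a)}"

text \<open>The Banach norm of the Tate algebra: the supremum of the (unique) coefficients.\<close>

definition ind_norm ::
  "nat \<Rightarrow> nat \<Rightarrow> 'k::nonarch_field mat \<Rightarrow> ('k mat \<Rightarrow> 'k) \<Rightarrow> real" where
  "ind_norm p n w f = (SUP \<alpha>\<in>multi_indices (Uw_pos n w). vabs ((THE a. Uw_expansion p n w f a) \<alpha>))"

definition left_transl ::
  "nat \<Rightarrow> nat \<Rightarrow> 'k::nonarch_field mat \<Rightarrow> ('k mat \<Rightarrow> 'k) \<Rightarrow> 'k mat \<Rightarrow> 'k" where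
  "left_transl p n h f = (\<lambda>g. if g \<in> Iwahori p n then f (minv h * g) else 0)"


text \<open>\<open>addrow_mat n y i j\<close> is \<open>1 + y E\<^sub>i\<^sub>,\<^sub>j\<close> for \<open>i \<noteq> j\<close>.\<close>

definition elementary_product ::
  "nat \<Rightarrow> ((nat \<times> nat) \<Rightarrow> 'k::nonarch_field) \<Rightarrow> (nat \<times> nat) list \<Rightarrow> 'k mat" where
  "elementary_product n y ps = foldr (\<lambda>(i,j) M. addrow_mat n (y (i,j)) i j * M) ps (1\<^sub>m n)"

text \<open>The lists \<open>lo\<close> and \<open>up\<close> give the order of the factors below and above the diagonal. The
  coordinates are normalised to run over \<open>\<int>\<^sub>p\<close>: the diagonal ones are \<open>t = 1 + p z\<close> and those
  above the diagonal are \<open>y = p z\<close>.\<close>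

definition G_point ::
  "nat \<Rightarrow> nat \<Rightarrow> (nat \<times> nat) list \<Rightarrow> (nat \<times> nat) list \<Rightarrow> ((nat \<times> nat) \<Rightarrow> 'k) \<Rightarrow> 'k::nonarch_field mat" where
  "G_point p n lo up z =
     elementary_product n z lo *
     mat_diag n (\<lambda>i. 1 + of_nat p * z (i,i)) *
     elementary_product n (\<lambda>ij. of_nat p * z ij) up"

text \<open>\<open>V\<close> is a space of functions with norm \<open>N\<close>, and \<open>act\<close> an action on it. The orbit map of
  \<open>f\<close> is the power series with coefficients \<open>F \<alpha> \<in> V\<close>, convergent in the norm \<open>N\<close>. The
  matrices \<^term>\<open>G_point p n lo up z\<close> with \<open>z\<close> over \<open>\<int>\<^sub>p\<close> are exactly the elements of
  \<^term>\<open>pro_p_Iwahori p n\<close>, for each choice of orders \<open>lo\<close>, \<open>up\<close>.\<close>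

definition globally_analytic_action ::
  "nat \<Rightarrow> nat \<Rightarrow> ('x \<Rightarrow> 'k) set \<Rightarrow> (('x \<Rightarrow> 'k) \<Rightarrow> real) \<Rightarrow>
   ('k mat \<Rightarrow> ('x \<Rightarrow> 'k) \<Rightarrow> 'x \<Rightarrow> 'k::nonarch_field) \<Rightarrow> bool" where
  "globally_analytic_action p n V N act \<longleftrightarrow>
     (\<forall>h\<in>pro_p_Iwahori p n. \<forall>f\<in>V. act h f \<in> V) \<and>
     (\<forall>lo up. distinct lo \<and> set lo = {(i,j). j < i \<and> i < n} \<and>
              distinct up \<and> set up = {(i,j). i < j \<and> j < n} \<longrightarrow>
       (\<forall>f\<in>V. \<exists>F.
          (\<forall>\<alpha>\<in>multi_indices (all_pos n). F \<alpha> \<in> V) \<and>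
          tends_to_0 (all_pos n) (\<lambda>\<alpha>. N (F \<alpha>)) \<and>
          (\<forall>z\<in>Zp_points (all_pos n).
             ((\<lambda>S. N (\<lambda>x. act (G_point p n lo up z) f x -
                            (\<Sum>\<alpha>\<in>S. mpower (all_pos n) z \<alpha> * F \<alpha> x)))
               \<longlongrightarrow> 0) (finite_subsets_at_top (multi_indices (all_pos n))))))"

end

theory Submission
  imports Defs
    "HOL-Analysis.Elementary_Metric_Spaces"
    "Jordan_Normal_Form.Determinant"
begin

text \<open>
  Let \<open>A\<close> be the ring of \<open>\<int>\<^sub>p\<close>-valued functions given by power series whose coefficients tend to \<open>0\<close>
  and have absolute value at most \<open>1\<close>, and call a matrix over \<open>A\<close> pro-\<open>p\<close> if its entries lie in \<open>p A\<close>
  above, in \<open>1 + p A\<close> on, and in \<open>A\<close> below the diagonal. Such matrices are closed under products,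
  inverses, and under Gaussian elimination with diagonal pivots in any order, because all
  pivots stay in \<open>1 + p A\<close>. Eliminating in the order given by \<open>w\<close> writes a pro-\<open>p\<close> matrix \<open>g\<close> over \<open>A\<close>
  as \<open>g = u b\<close> with \<open>u\<close> in \<open>w U w\<inverse> \<inter> B\<close>, \<open>b\<close> in \<open>P\<^sub>w\<^sup>+\<close>, both again pro-\<open>p\<close> over \<open>A\<close>. Hence
  \<open>f(g) = \<chi>\<^sup>w(b\<inverse>) f(u)\<close> is a convergent power series for every \<open>f\<close> in the induced representation: the
  second factor by substitution, the first because \<open>exp(c log(1 + p r))\<close> is a power series in \<open>r\<close>
  with coefficients tending to \<open>0\<close> when \<open>\<bar>c p\<bar> < p\<^bsup>-1/(p-1)\<^esup>\<close>.

  Apply this to \<open>g = h\<inverse> u\<close>, with \<open>h\<close> the generic element of \<open>G\<close> and \<open>u\<close> the generic element of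
  \<open>w U w\<inverse> \<inter> B\<close>, in both sets of coordinates at once. The coefficients with respect to the
  coordinates of \<open>h\<close> are the coefficients of the orbit map; they are equivariant because the
  coefficients of a convergent power series are determined by its values on \<open>\<int>\<^sub>p\<close>-points.
\<close>

section \<open>Null families in non-archimedean fields\<close>

text \<open>The delicate point is uniformity. For a single g the function sending h to f(h^-1 g) is
  a power series, but this controls the orbit map at one point only, whereas convergence is demanded
  in the norm of the Tate algebra. A joint expansion in h and u yields one null family A(\<alpha>,
  \<beta>), and all but finitely many rows \<alpha> are then small uniformly in \<beta>. That
  expansion only sees u in U_w, while a coefficient of the orbit map has to be a function on all of
  B. So every g in B is also expanded separately, and uniqueness glues the two descriptions
  together. An element of B need not be pro-p, as its diagonal consists of arbitrary units;
  splitting off its diagonal part, which lies in P_w^+, repairs this at the cost of a constant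
  factor. Values in Z_p are demanded on top of membership in the unit ball over K because the groups
  and the formula for \<chi> live over Z_p. The bound p^(-1/(p-1)) is the radius of convergence of
  exp; the hypothesis on c_i puts |c_i p| below it because e \<ge> 1.\<close>

lemma vabs_zero [simp]: "vabs (0::'k::nonarch_field) = 0"
  using dist_vabs[of "0::'k" 0] by simp

lemma vabs_nonneg [simp]: "vabs (x::'k::nonarch_field) \<ge> 0"
  using zero_le_dist[of x 0] by (simp add: dist_vabs)

lemma vabs_eq_0_iff [simp]: "vabs (x::'k::nonarch_field) = 0 \<longleftrightarrow> x = 0"
  using dist_eq_0_iff[of x 0] by (simp add: dist_vabs)

lemma vabs_pos_iff [simp]: "vabs (x::'k::nonarch_field) > 0 \<longleftrightarrow> x \<noteq> 0"
  by (metis less_eq_real_def not_less_iff_gr_or_eq vabs_eq_0_iff vabs_nonneg)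

lemma vabs_one [simp]: "vabs (1::'k::nonarch_field) = 1"
  using vabs_mult[of "1::'k" 1] by simp

lemma vabs_minus [simp]: "vabs (- x) = vabs (x::'k::nonarch_field)"
  using dist_commute[of 0 x] by (simp add: dist_vabs)

lemma vabs_diff_le: "vabs (x - y) \<le> max (vabs x) (vabs (y::'k::nonarch_field))"
  using vabs_ultrametric[of x "- y"] by simp

lemma vabs_power: "vabs (x ^ k) = vabs (x::'k::nonarch_field) ^ k"
  by (induction k) (auto simp: vabs_mult)

lemma vabs_divide: "vabs (x / y) = vabs x / vabs (y::'k::nonarch_field)"
proof (cases "y = 0")
  case False
  then have "vabs x = vabs (x / y) * vabs y" by (simp flip: vabs_mult)
  then show ?thesis using False by (simp add: field_simps)
qed auto

lemma vabs_prod: "vabs (\<Prod>i\<in>S. f i) = (\<Prod>i\<in>S. vabs (f i :: 'k::nonarch_field))"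
  by (induction S rule: infinite_finite_induct) (auto simp: vabs_mult)

lemma vabs_sum_le:
  "C \<ge> 0 \<Longrightarrow> (\<And>i. i \<in> S \<Longrightarrow> vabs (f i :: 'k::nonarch_field) \<le> C) \<Longrightarrow> vabs (\<Sum>i\<in>S. f i) \<le> C"
proof (induction S rule: infinite_finite_induct)
  case (insert x F)
  then show ?case using vabs_ultrametric[of "f x" "sum f F"] by fastforce
qed auto

lemma vabs_sum_less:
  "C > 0 \<Longrightarrow> (\<And>i. i \<in> S \<Longrightarrow> vabs (f i :: 'k::nonarch_field) < C) \<Longrightarrow> vabs (\<Sum>i\<in>S. f i) < C"
proof (induction S rule: infinite_finite_induct)
  case (insert x F)
  then show ?case using vabs_ultrametric[of "f x" "sum f F"] by fastforce
qed auto

lemma vabs_of_nat_le_1: "vabs (of_nat m :: 'k::nonarch_field) \<le> 1"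
proof (induction m)
  case (Suc m)
  then show ?case using vabs_ultrametric[of "of_nat m :: 'k" 1] by (simp add: add.commute)
qed auto

text \<open>The isosceles principle: neither of |x|, |y| can exceed the maximum of the other one and
  |x - y|. So absolute values are locally constant away from 0.\<close>

lemma vabs_eq_if_close: "vabs (x - y) < vabs (y::'k::nonarch_field) \<Longrightarrow> vabs x = vabs y"
  using vabs_ultrametric[of "x - y" y] vabs_diff_le[of x "x - y"] by (auto simp: max_def split: if_splits)

text \<open>If |s| exceeded C, a partial sum close enough to s would have absolute value |s|,
  against the ultrametric bound C on all partial sums.\<close>

lemma has_sum_vabs_le:
  fixes a :: "'i \<Rightarrow> 'k::nonarch_field"
  assumes s: "(a has_sum s) A" and C: "C \<ge> 0" "\<And>i. i \<in> A \<Longrightarrow> vabs (a i) \<le> C"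
  shows "vabs s \<le> C"
proof (rule ccontr)
  assume "\<not> vabs s \<le> C"
  then have less: "C < vabs s" by simp
  then have "vabs s > 0" using C by linarith
  with s have "\<forall>\<^sub>F F in finite_subsets_at_top A. dist (sum a F) s < vabs s"
    unfolding has_sum_def by (rule tendstoD)
  then obtain F where F: "F \<subseteq> A" "dist (sum a F) s < vabs s"
    unfolding eventually_finite_subsets_at_top by blast
  then have "vabs (sum a F) = vabs s" by (intro vabs_eq_if_close) (simp add: dist_vabs)
  moreover have "vabs (sum a F) \<le> C" using F C by (intro vabs_sum_le) auto
  ultimately show False using less by simp
qed

text \<open>Convergence to 0 along the cofinite filter on \<open>A\<close>. Over a complete
  ultrametric field this alone gives unconditional summability, so such sums can be rearranged
  freely.\<close>

definition null_family :: "'i set \<Rightarrow> ('i \<Rightarrow> 'k::nonarch_field) \<Rightarrow> bool" where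
  "null_family A a \<longleftrightarrow> (\<forall>\<epsilon>>0. finite {i \<in> A. vabs (a i) \<ge> \<epsilon>})"

lemma null_familyD: "null_family A a \<Longrightarrow> \<epsilon> > 0 \<Longrightarrow> finite {i \<in> A. vabs (a i) \<ge> \<epsilon>}"
  by (auto simp: null_family_def)

lemma tends_to_0_vabs: "tends_to_0 I (\<lambda>\<alpha>. vabs (a \<alpha>)) \<longleftrightarrow> null_family (multi_indices I) a"
  by (simp add: tends_to_0_def null_family_def)

lemma null_family_le:
  assumes "null_family A a" "\<And>i. i \<in> A \<Longrightarrow> vabs (b i) \<le> vabs (a i)"
  shows "null_family A b"
  unfolding null_family_def
proof (intro allI impI)
  fix \<epsilon> :: real assume "\<epsilon> > 0"
  then show "finite {i \<in> A. \<epsilon> \<le> vabs (b i)}"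
    by (intro finite_subset[OF _ null_familyD[OF assms(1) \<open>\<epsilon> > 0\<close>]]) (use assms(2) in force)
qed

lemma null_family_subset: "null_family A a \<Longrightarrow> B \<subseteq> A \<Longrightarrow> null_family B a"
  unfolding null_family_def
proof (intro allI impI)
  fix \<epsilon> :: real assume "\<forall>\<epsilon>>0. finite {i \<in> A. \<epsilon> \<le> vabs (a i)}" "B \<subseteq> A" "\<epsilon> > 0"
  then show "finite {i \<in> B. \<epsilon> \<le> vabs (a i)}"
    by (rule_tac finite_subset[of _ "{i \<in> A. \<epsilon> \<le> vabs (a i)}"]) auto
qed

lemma null_family_finite: "finite A \<Longrightarrow> null_family A a"
  by (simp add: null_family_def)

lemma null_family_bounded:
  assumes "null_family A a"
  obtains C where "C > 0" "\<And>i. i \<in> A \<Longrightarrow> vabs (a i) \<le> C"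
proof -
  let ?S = "{i \<in> A. vabs (a i) \<ge> 1}"
  have fin: "finite ?S" using null_familyD[OF assms, of 1] by simp
  let ?C = "Max (insert 1 ((\<lambda>i. vabs (a i)) ` ?S))"
  have C1: "?C \<ge> 1" using fin by (intro Max_ge) auto
  have "vabs (a i) \<le> ?C" if "i \<in> A" for i
  proof (cases "vabs (a i) \<ge> 1")
    case True
    then show ?thesis using fin that by (intro Max_ge) auto
  qed (use C1 in linarith)
  then show thesis using C1 by (intro that[of ?C]) auto
qed

text \<open>\<open>S n\<close> collects the finitely many terms of absolute value at least 1/(n+1).
  A finite sum is no larger than its largest term, so enlarging \<open>S n\<close> changes the sum
  by less than 1/(n+1), and the sums over the \<open>S n\<close> are Cauchy.\<close>

lemma null_family_has_sum:
  fixes a :: "'i \<Rightarrow> 'k::nonarch_field"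
  assumes "null_family A a"
  shows "(a has_sum infsum a A) A"
proof -
  define S where "S n = {i \<in> A. vabs (a i) \<ge> inverse (real (Suc n))}" for n
  have finS: "finite (S n)" for n unfolding S_def by (rule null_familyD[OF assms]) simp
  have diff: "dist (sum a F) (sum a (S n)) < inverse (real (Suc n))"
    if "finite F" "S n \<subseteq> F" "F \<subseteq> A" for F n
  proof -
    have "sum a F - sum a (S n) = sum a (F - S n)" using that by (simp add: sum_diff)
    moreover have "vabs (sum a (F - S n)) < inverse (real (Suc n))"
      using that by (intro vabs_sum_less) (auto simp: S_def not_le)
    ultimately show ?thesis by (simp add: dist_vabs)
  qed
  have mono: "S m \<subseteq> S n" if "m \<le> n" for m n
  proof -
    have "inverse (real (Suc n)) \<le> inverse (real (Suc m))" using that by (simp add: field_simps)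
    then show ?thesis unfolding S_def using order_trans by blast
  qed
  have "Cauchy (\<lambda>n. sum a (S n))"
  proof (rule CauchyI')
    fix e :: real assume "e > 0"
    then obtain M where M: "inverse (real (Suc M)) < e" using reals_Archimedean by blast
    have "dist (sum a (S m)) (sum a (S n)) < e" if "m \<ge> M" "n > m" for m n
    proof -
      have "dist (sum a (S n)) (sum a (S m)) < inverse (real (Suc m))"
        using that by (intro diff finS mono) (auto simp: S_def)
      moreover have "inverse (real (Suc m)) \<le> inverse (real (Suc M))"
        using that by (simp add: field_simps)
      ultimately have "dist (sum a (S n)) (sum a (S m)) < e" using M by linarith
      then show ?thesis by (simp add: dist_commute)
    qed
    then show "\<exists>M. \<forall>m\<ge>M. \<forall>n>m. dist (sum a (S m)) (sum a (S n)) < e" by blast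
  qed
  then obtain s where s: "(\<lambda>n. sum a (S n)) \<longlonglongrightarrow> s"
    using Cauchy_convergent_iff convergent_def by blast
  have "(a has_sum s) A"
    unfolding has_sum_def
  proof (rule tendstoI)
    fix e :: real assume e: "e > 0"
    then obtain M where M: "inverse (real (Suc M)) < e / 2" using reals_Archimedean half_gt_zero by blast
    obtain N where N: "dist (sum a (S n)) s < e / 2" if "n \<ge> N" for n
      using tendstoD[OF s, of "e/2"] e unfolding eventually_sequentially by auto
    define n where "n = max M N"
    have n: "inverse (real (Suc n)) \<le> inverse (real (Suc M))" by (simp add: field_simps n_def)
    have "dist (sum a F) s < e" if "finite F" "S n \<subseteq> F" "F \<subseteq> A" for F
    proof -
      have "dist (sum a (S n)) s < e / 2" by (rule N) (simp add: n_def)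
      then show ?thesis
        using dist_triangle[of "sum a F" s "sum a (S n)"] diff[OF that] n M by linarith
    qed
    moreover have "S n \<subseteq> A" by (auto simp: S_def)
    ultimately show "\<forall>\<^sub>F F in finite_subsets_at_top A. dist (sum a F) s < e"
      unfolding eventually_finite_subsets_at_top using finS by blast
  qed
  then show ?thesis by (simp add: infsumI)
qed

lemma null_family_fiber: "null_family (A \<times> B) a \<Longrightarrow> k \<in> A \<Longrightarrow> null_family B (\<lambda>j. a (k, j))"
  unfolding null_family_def
proof (intro allI impI)
  fix \<epsilon> :: real assume *: "\<forall>\<epsilon>>0. finite {i \<in> A \<times> B. \<epsilon> \<le> vabs (a i)}" "k \<in> A" "\<epsilon> > 0"
  have "{j \<in> B. \<epsilon> \<le> vabs (a (k, j))} \<subseteq> snd ` {i \<in> A \<times> B. \<epsilon> \<le> vabs (a i)}"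
    using * by (force simp: image_iff)
  then show "finite {j \<in> B. \<epsilon> \<le> vabs (a (k, j))}" using * by (meson finite_imageI finite_subset)
qed

lemma null_family_swap:
  assumes "null_family (A \<times> B) a"
  shows "null_family (B \<times> A) (\<lambda>(j, k). a (k, j))"
  unfolding null_family_def
proof (intro allI impI)
  fix \<epsilon> :: real assume "\<epsilon> > 0"
  have "{i \<in> B \<times> A. \<epsilon> \<le> vabs (case i of (j, k) \<Rightarrow> a (k, j))}
      \<subseteq> prod.swap ` {i \<in> A \<times> B. \<epsilon> \<le> vabs (a i)}"
    by (force simp: image_iff)
  then show "finite {i \<in> B \<times> A. \<epsilon> \<le> vabs (case i of (j, k) \<Rightarrow> a (k, j))}"
    using null_familyD[OF assms \<open>\<epsilon> > 0\<close>] by (meson finite_imageI finite_subset)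
qed

lemma null_family_infsum:
  assumes a: "null_family (A \<times> B) a"
  shows "null_family A (\<lambda>k. infsum (\<lambda>j. a (k, j)) B)"
  unfolding null_family_def
proof (intro allI impI)
  fix \<epsilon> :: real assume e: "\<epsilon> > 0"
  \<comment> \<open>Half of \<epsilon> leaves room: terms below a bound only make the sum at most
    that bound.\<close>
  have "k \<in> fst ` {i \<in> A \<times> B. \<epsilon> / 2 \<le> vabs (a i)}"
    if k: "k \<in> A" "\<epsilon> \<le> vabs (infsum (\<lambda>j. a (k, j)) B)" for k
  proof (rule ccontr)
    assume "k \<notin> fst ` {i \<in> A \<times> B. \<epsilon> / 2 \<le> vabs (a i)}"
    then have "vabs (a (k, j)) \<le> \<epsilon> / 2" if "j \<in> B" for j
      using k that by (force simp: image_iff)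
    then have "vabs (infsum (\<lambda>j. a (k, j)) B) \<le> \<epsilon> / 2"
      using e by (intro has_sum_vabs_le[OF null_family_has_sum[OF null_family_fiber[OF a k(1)]]]) auto
    then show False using k e by simp
  qed
  then have "{k \<in> A. \<epsilon> \<le> vabs (infsum (\<lambda>j. a (k, j)) B)} \<subseteq> fst ` {i \<in> A \<times> B. \<epsilon> / 2 \<le> vabs (a i)}"
    by blast
  then show "finite {k \<in> A. \<epsilon> \<le> vabs (infsum (\<lambda>j. a (k, j)) B)}"
    using null_familyD[OF a, of "\<epsilon> / 2"] e by (meson finite_imageI finite_subset half_gt_zero)
qed

lemma null_family_fubini:
  assumes a: "null_family (A \<times> B) a"
  shows "((\<lambda>k. infsum (\<lambda>j. a (k, j)) B) has_sum infsum a (A \<times> B)) A"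
  by (rule has_sum_SigmaD[OF null_family_has_sum[OF a]])
     (auto intro: null_family_has_sum null_family_fiber[OF a])

lemma null_family_fubini_swap:
  assumes a: "null_family (A \<times> B) a"
  shows "((\<lambda>j. infsum (\<lambda>k. a (k, j)) A) has_sum infsum a (A \<times> B)) B"
proof -
  have "(a has_sum infsum a (A \<times> B)) (A \<times> B)" by (rule null_family_has_sum[OF a])
  then have "((\<lambda>(j, k). a (k, j)) has_sum infsum a (A \<times> B)) (B \<times> A)"
    by (subst has_sum_reindex_bij_witness[where i = prod.swap and j = prod.swap and T = "A \<times> B" and h = a])
       auto
  then show ?thesis
    by (rule has_sum_SigmaD)
       (use null_family_fiber[OF null_family_swap[OF a]] null_family_has_sum in fastforce)
qed

text \<open>The \<open>a k\<close> may tend to 0 at rates depending on \<open>k\<close>: since they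
  are bounded by 1, only the finitely many \<open>k\<close> with |c k| \<ge> \<epsilon> matter, and
  each of them has finitely many large \<open>j\<close>.\<close>

lemma null_family_mult:
  assumes c: "null_family A c" and a: "\<And>k. k \<in> A \<Longrightarrow> null_family B (a k)"
    and bd: "\<And>k j. k \<in> A \<Longrightarrow> j \<in> B \<Longrightarrow> vabs (a k j) \<le> 1"
  shows "null_family (A \<times> B) (\<lambda>(k, j). c k * a k j)"
  unfolding null_family_def
proof (intro allI impI)
  fix \<epsilon> :: real assume e: "\<epsilon> > 0"
  obtain C where C: "C > 0" "\<And>i. i \<in> A \<Longrightarrow> vabs (c i) \<le> C" using null_family_bounded[OF c] by blast
  let ?S = "{k \<in> A. \<epsilon> \<le> vabs (c k)}"
  have "{i \<in> A \<times> B. \<epsilon> \<le> vabs (case i of (k, j) \<Rightarrow> c k * a k j)}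
      \<subseteq> Sigma ?S (\<lambda>k. {j \<in> B. \<epsilon> / C \<le> vabs (a k j)})"
  proof
    fix i assume i: "i \<in> {i \<in> A \<times> B. \<epsilon> \<le> vabs (case i of (k, j) \<Rightarrow> c k * a k j)}"
    obtain k j where ikj: "i = (k, j)" by fastforce
    with i have kj: "k \<in> A" "j \<in> B" "\<epsilon> \<le> vabs (c k * a k j)" by auto
    have "vabs (c k) * vabs (a k j) \<le> vabs (c k)" using bd[OF kj(1,2)] by (simp add: mult_left_le)
    moreover have "vabs (c k) * vabs (a k j) \<le> C * vabs (a k j)"
      using C kj by (intro mult_right_mono) auto
    ultimately show "i \<in> Sigma ?S (\<lambda>k. {j \<in> B. \<epsilon> / C \<le> vabs (a k j)})"
      using kj C by (auto simp: ikj vabs_mult field_simps)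
  qed
  moreover have "finite (Sigma ?S (\<lambda>k. {j \<in> B. \<epsilon> / C \<le> vabs (a k j)}))"
    using null_familyD[OF c e] null_familyD[OF a] e C by (intro finite_SigmaI) auto
  ultimately show "finite {i \<in> A \<times> B. \<epsilon> \<le> vabs (case i of (k, j) \<Rightarrow> c k * a k j)}"
    by (rule finite_subset)
qed

lemma null_family_of_tendsto:
  fixes a :: "nat \<Rightarrow> 'k::nonarch_field"
  assumes "(\<lambda>k. vabs (a k)) \<longlonglongrightarrow> 0"
  shows "null_family UNIV a"
  unfolding null_family_def
proof (intro allI impI)
  fix \<epsilon> :: real assume "\<epsilon> > 0"
  then obtain N where N: "vabs (a k) < \<epsilon>" if "k \<ge> N" for k
    using order_tendstoD(2)[OF assms, of \<epsilon>] unfolding eventually_sequentially by auto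
  have "{i \<in> UNIV. \<epsilon> \<le> vabs (a i)} \<subseteq> {..<N}"
  proof
    fix i assume i: "i \<in> {i \<in> UNIV. \<epsilon> \<le> vabs (a i)}"
    show "i \<in> {..<N}" using N[of i] i by (cases "i < N") auto
  qed
  then show "finite {i \<in> UNIV. \<epsilon> \<le> vabs (a i)}" by (rule finite_subset) simp
qed

section \<open>The p-adic numbers inside K\<close>

lemma Qp_iff_sequence: "x \<in> Qp \<longleftrightarrow> (\<exists>s. (\<forall>n. s n \<in> \<rat>) \<and> s \<longlonglongrightarrow> x)"
  unfolding Qp_def by (rule closure_sequential)

lemma Rats_subset_Qp: "\<rat> \<subseteq> Qp"
  unfolding Qp_def by (rule closure_subset)

lemma Qp_add: "x \<in> Qp \<Longrightarrow> y \<in> Qp \<Longrightarrow> x + y \<in> Qp"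
  unfolding Qp_iff_sequence
  by (elim exE conjE, rule_tac x = "\<lambda>n. s n + sa n" in exI) (auto intro: tendsto_add)

lemma Qp_mult: "x \<in> Qp \<Longrightarrow> y \<in> Qp \<Longrightarrow> x * y \<in> Qp"
  unfolding Qp_iff_sequence
  by (elim exE conjE, rule_tac x = "\<lambda>n. s n * sa n" in exI) (auto intro: tendsto_mult)

lemma Qp_uminus: "x \<in> Qp \<Longrightarrow> - x \<in> Qp"
  unfolding Qp_iff_sequence
  by (elim exE conjE, rule_tac x = "\<lambda>n. - s n" in exI) (auto intro: tendsto_minus)

text \<open>Rational approximations close to a nonzero x have absolute value |x|, so the difference
  of the inverses has absolute value |s n - x| / |x|^2.\<close>

lemma Qp_inverse:
  assumes "x \<in> Qp" shows "inverse x \<in> Qp"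
proof (cases "x = 0")
  case True
  then show ?thesis using Rats_subset_Qp by auto
next
  case False
  obtain s where s: "\<And>n. s n \<in> \<rat>" "s \<longlonglongrightarrow> x"
    using assms unfolding Qp_iff_sequence by blast
  have "(\<lambda>n. inverse (s n)) \<longlonglongrightarrow> inverse x"
  proof (rule tendstoI)
    fix e :: real assume e: "e > 0"
    have "min (vabs x) (e * vabs x * vabs x) > 0" using False e by simp
    from tendstoD[OF s(2) this]
    show "\<forall>\<^sub>F n in sequentially. dist (inverse (s n)) (inverse x) < e"
    proof eventually_elim
      case (elim n)
      then have close: "vabs (s n - x) < vabs x" "vabs (s n - x) < e * vabs x * vabs x"
        by (auto simp: dist_vabs)
      have eq: "vabs (s n) = vabs x" using close(1) by (rule vabs_eq_if_close)
      then have nz: "s n \<noteq> 0" using False by (metis vabs_eq_0_iff)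
      have "inverse (s n) - inverse x = - (s n - x) / (s n * x)"
        using nz False by (simp add: field_simps)
      then have "vabs (inverse (s n) - inverse x) = vabs (s n - x) / (vabs x * vabs x)"
        by (simp add: vabs_divide vabs_mult eq del: minus_diff_eq)
      also have "\<dots> < e" using close(2) False by (simp add: divide_simps mult_ac)
      finally show ?case by (simp add: dist_vabs)
    qed
  qed
  then show ?thesis unfolding Qp_iff_sequence using s(1)
    by (intro exI[of _ "\<lambda>n. inverse (s n)"]) auto
qed

lemma Qp_divide: "x \<in> Qp \<Longrightarrow> y \<in> Qp \<Longrightarrow> x / y \<in> Qp"
  by (simp add: divide_inverse Qp_mult Qp_inverse)

lemma Qp_sum: "(\<And>i. i \<in> S \<Longrightarrow> f i \<in> Qp) \<Longrightarrow> (\<Sum>i\<in>S. f i) \<in> Qp"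
  using Rats_subset_Qp by (induction S rule: infinite_finite_induct) (auto intro: Qp_add)

lemma Zp_add: "x \<in> Zp \<Longrightarrow> y \<in> Zp \<Longrightarrow> x + y \<in> Zp"
  unfolding Zp_def using vabs_ultrametric[of x y] by (auto intro: Qp_add)

lemma Zp_mult: "x \<in> Zp \<Longrightarrow> y \<in> Zp \<Longrightarrow> x * y \<in> Zp"
  unfolding Zp_def by (auto intro: Qp_mult simp: vabs_mult mult_le_one)

lemma Zp_uminus: "x \<in> Zp \<Longrightarrow> - x \<in> Zp"
  unfolding Zp_def by (auto intro: Qp_uminus)

lemma Zp_0 [simp]: "0 \<in> Zp" and Zp_1 [simp]: "1 \<in> Zp"
  unfolding Zp_def using Rats_subset_Qp by auto

lemma Zp_of_nat [simp]: "of_nat m \<in> Zp"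
  by (induction m) (auto intro: Zp_add)

lemma Zp_power: "x \<in> Zp \<Longrightarrow> x ^ k \<in> Zp"
  by (induction k) (auto intro: Zp_mult)

lemma Zp_divide: "x \<in> Zp \<Longrightarrow> y \<in> Zp \<Longrightarrow> vabs y = 1 \<Longrightarrow> x / y \<in> Zp"
  unfolding Zp_def by (auto intro: Qp_divide simp: vabs_divide)

lemma Zp_sum: "(\<And>i. i \<in> S \<Longrightarrow> f i \<in> Zp) \<Longrightarrow> (\<Sum>i\<in>S. f i) \<in> Zp"
  by (induction S rule: infinite_finite_induct) (auto intro: Zp_add)

lemma vabs_Zp: "x \<in> Zp \<Longrightarrow> vabs x \<le> 1"
  by (simp add: Zp_def)

lemma vabs_of_int_le_1: "vabs (of_int m :: 'k::nonarch_field) \<le> 1"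
  using vabs_of_nat_le_1[where 'k = 'k] by (cases m rule: int_cases2) auto

section \<open>Absolute values of integers and factorials, and the radius of the exponential\<close>

locale padic_base =
  fixes p :: nat and ty :: "'k::nonarch_field itself"
  assumes prime_p: "prime p" and vabs_p: "vabs (of_nat p :: 'k) = 1 / real p"
begin

lemma p_ge_2: "p \<ge> 2"
  using prime_p by (rule prime_ge_2_nat)

lemma p_neq_0 [simp]: "p \<noteq> 0"
  using p_ge_2 by simp

lemma pZp_iff: "(x::'k) \<in> pZp p \<longleftrightarrow> x / of_nat p \<in> Zp"
proof
  assume "x / of_nat p \<in> Zp"
  then show "x \<in> pZp p" unfolding pZp_def using p_ge_2
    by (intro CollectI exI[of _ "x / of_nat p"]) auto
qed (use p_ge_2 in \<open>auto simp: pZp_def\<close>)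

text \<open>By Bezout 1 = u p + v m, and |u p| < 1 forces |v m| to be at least 1.\<close>

lemma vabs_of_nat_coprime:
  assumes "\<not> p dvd m" shows "vabs (of_nat m :: 'k) = 1"
proof (rule antisym[OF vabs_of_nat_le_1])
  have "coprime p m" using assms prime_p by (simp add: prime_imp_coprime)
  then have "gcd (int p) (int m) = 1" by (simp add: gcd_int_def)
  then obtain u v where uv: "u * int p + v * int m = 1" using bezout_int[of "int p" "int m"] by auto
  have "(1::'k) = of_int (u * int p + v * int m)" by (simp add: uv)
  also have "\<dots> = of_int u * of_nat p + of_int v * of_nat m" by simp
  finally have "1 \<le> max (vabs (of_int u * of_nat p :: 'k)) (vabs (of_int v * of_nat m :: 'k))"
    using vabs_ultrametric[of "of_int u * of_nat p :: 'k" "of_int v * of_nat m"] by (metis vabs_one)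
  moreover have "vabs (of_int u * of_nat p :: 'k) < 1"
  proof -
    have "vabs (of_int u * of_nat p :: 'k) \<le> 1 / real p"
      using vabs_of_int_le_1[of u, where 'k = 'k] p_ge_2
      by (simp add: vabs_mult vabs_p mult_left_le_one_le divide_right_mono)
    also have "\<dots> < 1" using p_ge_2 by simp
    finally show ?thesis .
  qed
  ultimately have "1 \<le> vabs (of_int v :: 'k) * vabs (of_nat m :: 'k)" by (simp add: vabs_mult)
  also have "\<dots> \<le> vabs (of_nat m :: 'k)"
    using vabs_of_int_le_1[of v, where 'k = 'k] by (intro mult_left_le_one_le) auto
  finally show "1 \<le> vabs (of_nat m :: 'k)" .
qed

text \<open>If p^v is the exact power of p in k, then |k| = p^(-v), and p^v is at most k. The
  induction strips off one factor p at a time.\<close>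

lemma vabs_of_nat_ge: "k > 0 \<Longrightarrow> vabs (of_nat k :: 'k) \<ge> 1 / real k"
proof (induction k rule: less_induct)
  case (less k)
  show ?case
  proof (cases "p dvd k")
    case True
    then obtain m where m: "k = p * m" by blast
    have "m > 0" "m < k" using less.prems m p_ge_2 by auto
    then have "1 / real m \<le> vabs (of_nat m :: 'k)" by (intro less.IH)
    then show ?thesis
      using p_ge_2 \<open>m > 0\<close> by (simp add: m vabs_mult vabs_p field_simps)
  next
    case False
    then show ?thesis using less.prems by (simp add: vabs_of_nat_coprime)
  qed
qed

text \<open>Only the multiples of p among 1, ..., k contribute, and these are p times 1, ...,
  \<open>k div p\<close>. This is Legendre's recursion.\<close>

lemma vabs_fact_div: "vabs (fact k :: 'k) = (1 / real p) ^ (k div p) * vabs (fact (k div p) :: 'k)"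
proof (induction k)
  case (Suc k)
  have f: "vabs (fact (Suc k) :: 'k) = vabs (of_nat (Suc k) :: 'k) * vabs (fact k :: 'k)" for k
    by (simp only: fact_Suc vabs_mult of_nat_id)
  show ?case
  proof (cases "p dvd Suc k")
    case True
    then have d: "Suc k div p = Suc (k div p)" by (simp add: div_Suc mod_eq_0_iff_dvd)
    have "Suc k = p * Suc (k div p)" using True d by (metis dvd_mult_div_cancel)
    then have "vabs (of_nat (Suc k) :: 'k) = 1 / real p * vabs (of_nat (Suc (k div p)) :: 'k)"
      by (metis of_nat_mult vabs_mult vabs_p)
    then show ?thesis unfolding d f Suc.IH by simp
  next
    case False
    then have d: "Suc k div p = k div p" by (simp add: div_Suc mod_eq_0_iff_dvd)
    show ?thesis unfolding d f Suc.IH by (simp add: vabs_of_nat_coprime[OF False] del: of_nat_Suc)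
  qed
qed auto

text \<open>The radius of convergence of the exponential series.\<close>

definition exp_radius :: real where "exp_radius = real p powr (- 1 / (real p - 1))"

lemma exp_radius: "0 < exp_radius" "exp_radius \<le> 1" "exp_radius ^ (p - 1) = 1 / real p"
proof -
  have p: "real p \<ge> 2" using p_ge_2 by simp
  show "0 < exp_radius" unfolding exp_radius_def using p by simp
  have "exp_radius \<le> real p powr 0" unfolding exp_radius_def using p by (intro powr_mono) auto
  then show "exp_radius \<le> 1" using p by simp
  have "exp_radius ^ (p - 1) = real p powr (- 1 / (real p - 1) * real (p - 1))"
    unfolding exp_radius_def using p by (subst powr_power) auto
  also have "- 1 / (real p - 1) * real (p - 1) = - 1" using p p_ge_2 by (simp add: of_nat_diff)
  finally show "exp_radius ^ (p - 1) = 1 / real p" using p by (simp add: powr_minus_divide)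
qed

text \<open>Put m = \<open>k div p\<close>. Then k \<ge> p m = (p - 1) m + m, and
  \<open>exp_radius ^ (p - 1)\<close> = 1/p turns the factor (1/p)^m of Legendre's recursion into a
  power of \<open>exp_radius\<close>.\<close>

lemma vabs_fact_ge: "vabs (fact k :: 'k) \<ge> exp_radius ^ k"
proof (induction k rule: less_induct)
  case (less k)
  show ?case
  proof (cases "k = 0")
    case False
    let ?m = "k div p"
    have "?m < k" using False p_ge_2 by simp
    then have IH: "exp_radius ^ ?m \<le> vabs (fact ?m :: 'k)" by (rule less.IH)
    have "p * ?m \<le> k" by simp
    then have "exp_radius ^ k \<le> exp_radius ^ (p * ?m)"
      using exp_radius by (intro power_decreasing) auto
    also have "p * ?m = (p - 1) * ?m + ?m" using p_ge_2 by (cases p) auto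
    also have "exp_radius ^ \<dots> = (1 / real p) ^ ?m * exp_radius ^ ?m"
      by (simp only: power_add power_mult exp_radius(3))
    also have "\<dots> \<le> (1 / real p) ^ ?m * vabs (fact ?m :: 'k)"
      using IH by (intro mult_left_mono) auto
    finally show ?thesis by (subst vabs_fact_div)
  qed auto
qed

text \<open>Since e \<ge> 1, the hypothesis gives v_p(c) > 1/(p-1) - 1, and adding v_p(p) = 1 gives
  v_p(c p) > 1/(p-1).\<close>

lemma vabs_mult_p_less_exp_radius:
  assumes "padic_val p (c::'k) > ereal (real e / (real p - 1) - 1)" "e \<ge> 1"
  shows "vabs (c * of_nat p) < exp_radius"
proof (cases "c = 0")
  case True
  then show ?thesis using exp_radius by simp
next
  case False
  have p: "real p \<ge> 2" using p_ge_2 by simp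
  have "real e / (real p - 1) - 1 < - log (real p) (vabs c)"
    using assms(1) False by (simp add: padic_val_def)
  moreover have "1 / (real p - 1) \<le> real e / (real p - 1)"
    using assms(2) p by (intro divide_right_mono) auto
  ultimately have "log (real p) (vabs c) < 1 + - 1 / (real p - 1)" by simp
  then have "vabs c < real p powr (1 + - 1 / (real p - 1))"
    using p False by (simp add: log_less_iff)
  also have "\<dots> = real p * exp_radius"
    unfolding exp_radius_def using p by (subst powr_add) simp
  finally show ?thesis using p by (simp add: vabs_mult vabs_p field_simps)
qed

end

section \<open>Finiteness of the ramification index\<close>

lemma homogeneous_system_Qp:
  fixes a :: "'x \<Rightarrow> 's \<Rightarrow> 'k::nonarch_field"
  assumes "finite S" "finite X" "card X > card S" "\<And>x s. x \<in> X \<Longrightarrow> s \<in> S \<Longrightarrow> a x s \<in> Qp"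
  shows "\<exists>b. (\<forall>x\<in>X. b x \<in> Qp) \<and> (\<exists>x\<in>X. b x \<noteq> 0) \<and> (\<forall>s\<in>S. (\<Sum>x\<in>X. b x * a x s) = 0)"
  using assms
proof (induction S arbitrary: X a rule: finite_induct)
  case empty
  then have "X \<noteq> {}" by auto
  then show ?case using Rats_subset_Qp by (intro exI[of _ "\<lambda>_. 1"]) auto
next
  case (insert s S)
  show ?case
  proof (cases "\<forall>x\<in>X. a x s = 0")
    case True
    have "card S < card X" using insert.prems insert.hyps by simp
    then obtain b where "\<forall>x\<in>X. b x \<in> Qp" "\<exists>x\<in>X. b x \<noteq> 0" "\<forall>t\<in>S. (\<Sum>x\<in>X. b x * a x t) = 0"
      using insert.IH[of X a] insert.prems by blast
    then show ?thesis using True by (intro exI[of _ b]) auto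
  next
    case False
    then obtain x0 where x0: "x0 \<in> X" "a x0 s \<noteq> 0" by blast
    define X' where "X' = X - {x0}"
    \<comment> \<open>Equation \<open>s\<close> is solved for the unknown belonging to
      \<open>x0\<close> and substituted into the other equations; \<open>b0\<close> below is the
      value that this forces on that unknown.\<close>
    define a' where "a' x t = a x t - a x s / a x0 s * a x0 t" for x t
    have "card X' > card S" "finite X'" using insert.prems insert.hyps x0 by (auto simp: X'_def)
    moreover have "a' x t \<in> Qp" if "x \<in> X'" "t \<in> S" for x t
      unfolding a'_def diff_conv_add_uminus using that insert.prems(3) x0
      by (intro Qp_add Qp_uminus Qp_mult Qp_divide) (auto simp: X'_def)
    ultimately obtain b' where b': "\<forall>x\<in>X'. b' x \<in> Qp" "\<exists>x\<in>X'. b' x \<noteq> 0"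
        "\<forall>t\<in>S. (\<Sum>x\<in>X'. b' x * a' x t) = 0"
      using insert.IH[of X' a'] by blast
    define b0 where "b0 = - (\<Sum>x\<in>X'. b' x * (a x s / a x0 s))"
    define b where "b x = (if x = x0 then b0 else b' x)" for x
    have X: "X = insert x0 X'" "x0 \<notin> X'" using x0 by (auto simp: X'_def)
    have split: "(\<Sum>x\<in>X. b x * a x t) = b0 * a x0 t + (\<Sum>x\<in>X'. b' x * a x t)" for t
    proof -
      have "(\<Sum>x\<in>X'. b x * a x t) = (\<Sum>x\<in>X'. b' x * a x t)"
        using X(2) by (intro sum.cong) (auto simp: b_def)
      then show ?thesis unfolding X(1) using X(2) \<open>finite X'\<close> by (simp add: b_def)
    qed
    have "(\<Sum>x\<in>X. b x * a x t) = 0" if t: "t \<in> insert s S" for t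
    proof (cases "t = s")
      case True
      then show ?thesis unfolding split b0_def using x0 by (simp add: sum_distrib_right)
    next
      case False
      then have "0 = (\<Sum>x\<in>X'. b' x * a' x t)" using t b' by auto
      also have "\<dots> = (\<Sum>x\<in>X'. b' x * a x t) + b0 * a x0 t"
        unfolding a'_def b0_def
        by (simp add: sum_distrib_right right_diff_distrib sum_subtractf mult.assoc)
      finally show ?thesis unfolding split by (simp add: add.commute)
    qed
    moreover have "b x \<in> Qp" if "x \<in> X" for x
    proof (cases "x = x0")
      case True
      then show ?thesis unfolding b_def b0_def using b'(1) insert.prems(3) x0
        by (auto intro!: Qp_uminus Qp_sum Qp_mult Qp_divide simp: X'_def)
    qed (use b'(1) that in \<open>auto simp: b_def X'_def\<close>)
    moreover have "\<exists>x\<in>X. b x \<noteq> 0" using b'(2) X by (auto simp: b_def)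
    ultimately show ?thesis by (intro exI[of _ b]) auto
  qed
qed

text \<open>The term of largest absolute value is unique, so the others cannot cancel it.\<close>

lemma vabs_sum_distinct:
  fixes f :: "'x \<Rightarrow> 'k::nonarch_field"
  assumes "finite S" "S \<noteq> {}" "inj_on (\<lambda>x. vabs (f x)) S" "\<And>x. x \<in> S \<Longrightarrow> f x \<noteq> 0"
  shows "(\<Sum>x\<in>S. f x) \<noteq> 0"
proof -
  let ?V = "(\<lambda>x. vabs (f x)) ` S"
  obtain m where m: "m \<in> S" "vabs (f m) = Max ?V"
    using Max_in[of ?V] assms(1,2) by (metis (no_types, lifting) finite_imageI image_iff image_is_empty)
  have less: "vabs (f x) < vabs (f m)" if "x \<in> S - {m}" for x
  proof -
    have "vabs (f x) \<le> vabs (f m)" unfolding m(2) using that assms(1) by auto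
    moreover have "vabs (f x) \<noteq> vabs (f m)" using inj_onD[OF assms(3), of x m] that m by auto
    ultimately show ?thesis by simp
  qed
  have "(\<Sum>x\<in>S. f x) = f m + (\<Sum>x\<in>S - {m}. f x)" using assms(1) m by (simp add: sum.remove)
  moreover have "vabs (\<Sum>x\<in>S - {m}. f x) < vabs (f m)"
    using assms(4)[OF m(1)] less by (intro vabs_sum_less) auto
  ultimately show ?thesis
    by (metis add_eq_0_iff less_irrefl vabs_minus)
qed

text \<open>An infinite set has \<open>card\<close> 0, so positivity means that there are finitely
  many cosets. Nonzero elements of K whose absolute values lie in different cosets of the value
  group of Qp are linearly independent over Qp, so there are at most \<open>card S\<close>
  cosets.\<close>

lemma ramification_index_pos:
  assumes "finite_extension_Qp p TYPE('k::nonarch_field)"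
  shows "ramification_index TYPE('k) \<ge> 1"
proof -
  define cl where "cl x = (\<lambda>s. vabs x * s) ` vabs ` (Qp - {0::'k})" for x :: 'k
  define Q where "Q = cl ` (UNIV - {0})"
  obtain S :: "'k set" where S: "finite S"
      "\<And>x. \<exists>a. (\<forall>s\<in>S. a s \<in> Qp) \<and> x = (\<Sum>s\<in>S. a s * s)"
    using assms unfolding finite_extension_Qp_def by blast
  obtain co where co: "\<And>x s. s \<in> S \<Longrightarrow> co x s \<in> Qp" "\<And>x. x = (\<Sum>s\<in>S. co x s * s)"
    using S(2) by metis
  have "finite Q"
  proof (rule ccontr)
    assume "infinite Q"
    then obtain T where T: "finite T" "card T = Suc (card S)" "T \<subseteq> Q"
      using infinite_arbitrarily_large by blast
    then have "\<forall>t\<in>T. \<exists>x. x \<noteq> 0 \<and> cl x = t" by (auto simp: Q_def)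
    then obtain r where r: "\<And>t. t \<in> T \<Longrightarrow> r t \<noteq> 0 \<and> cl (r t) = t" by metis
    have "card S < card T" using T by simp
    then obtain b where b: "\<forall>t\<in>T. b t \<in> Qp" "\<exists>t\<in>T. b t \<noteq> 0"
        "\<forall>s\<in>S. (\<Sum>t\<in>T. b t * co (r t) s) = 0"
      using homogeneous_system_Qp[OF S(1) T(1), of "\<lambda>t. co (r t)"] co(1) by blast
    define T' where "T' = {t \<in> T. b t \<noteq> 0}"
    have "(\<Sum>t\<in>T'. b t * r t) = (\<Sum>t\<in>T. b t * r t)"
      using T(1) by (intro sum.mono_neutral_left) (auto simp: T'_def)
    also have "\<dots> = (\<Sum>t\<in>T. b t * (\<Sum>s\<in>S. co (r t) s * s))" using co(2) by metis
    also have "\<dots> = (\<Sum>s\<in>S. (\<Sum>t\<in>T. b t * co (r t) s) * s)"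
      by (simp add: sum_distrib_left sum_distrib_right mult.assoc) (rule sum.swap)
    also have "\<dots> = 0" using b(3) by simp
    finally have zero: "(\<Sum>t\<in>T'. b t * r t) = 0" .
    \<comment> \<open>If the two terms have equal absolute value, then |r t| and |r t'| differ by
      the absolute value of the element \<open>b t' / b t\<close> of Qp, so they define the same
      coset.\<close>
    have mem: "vabs (r t) * vabs y \<in> cl (r t')"
      if t: "t \<in> T'" "t' \<in> T'" "vabs (b t * r t) = vabs (b t' * r t')" and y: "y \<in> Qp - {0}"
      for t t' and y :: 'k
    proof -
      have nz: "b t \<noteq> 0" "b t' \<noteq> 0" "b t \<in> Qp" "b t' \<in> Qp" using t b by (auto simp: T'_def)
      let ?z = "b t' / b t * y"
      have "vabs (r t) * vabs y = vabs (r t') * vabs ?z"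
        using t(3) nz by (simp add: vabs_mult vabs_divide field_simps)
      moreover have "?z \<in> Qp - {0}" using nz y by (auto intro: Qp_mult Qp_divide)
      ultimately show ?thesis unfolding cl_def by blast
    qed
    have "inj_on (\<lambda>t. vabs (b t * r t)) T'"
    proof (rule inj_onI)
      fix t t' assume *: "t \<in> T'" "t' \<in> T'" "vabs (b t * r t) = vabs (b t' * r t')"
      have "cl (r t) = cl (r t')"
        using mem[OF *] mem[OF *(2,1) *(3)[symmetric]] by (auto simp: cl_def)
      then show "t = t'" using r * by (auto simp: T'_def)
    qed
    then have "(\<Sum>t\<in>T'. b t * r t) \<noteq> 0"
      using T(1) b(2) r by (intro vabs_sum_distinct) (auto simp: T'_def)
    with zero show False by simp
  qed
  moreover have "cl 1 \<in> Q" unfolding Q_def by (rule imageI) simp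
  moreover have "ramification_index TYPE('k) = card Q"
    unfolding ramification_index_def Q_def cl_def by (simp add: image_image)
  ultimately show ?thesis by (auto simp: Suc_le_eq card_gt_0_iff)
qed

section \<open>Tate algebras\<close>

lemma mpower_cong: "(\<And>i. i \<in> I \<Longrightarrow> x i = y i) \<Longrightarrow> mpower I x \<alpha> = mpower I y \<alpha>"
  unfolding mpower_def by (rule prod.cong) auto

lemma vabs_mpower_le: "(\<And>i. i \<in> I \<Longrightarrow> vabs (x i) \<le> 1) \<Longrightarrow> vabs (mpower I x \<alpha>) \<le> 1"
  unfolding mpower_def vabs_prod vabs_power by (intro prod_le_1) (auto simp: power_le_one)

lemma mpower_add: "mpower I x (\<lambda>i. \<alpha> i + \<beta> i) = mpower I x \<alpha> * mpower I x \<beta>"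
  unfolding mpower_def by (simp add: power_add prod.distrib)

lemma mpower_zero [simp]: "mpower I x (\<lambda>_. 0) = 1"
  unfolding mpower_def by simp

lemma zero_multi_index [simp]: "(\<lambda>_. 0) \<in> multi_indices I"
  unfolding multi_indices_def by simp

lemma null_family_diff:
  assumes "null_family A a" "null_family A b"
  shows "null_family A (\<lambda>i. a i - b i)"
  unfolding null_family_def
proof (intro allI impI)
  fix \<epsilon> :: real assume e: "\<epsilon> > 0"
  have "{i \<in> A. \<epsilon> \<le> vabs (a i - b i)} \<subseteq> {i \<in> A. \<epsilon> \<le> vabs (a i)} \<union> {i \<in> A. \<epsilon> \<le> vabs (b i)}"
  proof
    fix i assume "i \<in> {i \<in> A. \<epsilon> \<le> vabs (a i - b i)}"
    then show "i \<in> {i \<in> A. \<epsilon> \<le> vabs (a i)} \<union> {i \<in> A. \<epsilon> \<le> vabs (b i)}"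
      using vabs_diff_le[of "a i" "b i"] by (auto simp: max_def split: if_splits)
  qed
  then show "finite {i \<in> A. \<epsilon> \<le> vabs (a i - b i)}"
    by (rule finite_subset) (use assms e in \<open>auto simp: null_family_def\<close>)
qed

section \<open>Uniqueness of power series coefficients\<close>

context padic_base
begin

text \<open>At t = p^N the first nonzero term, of size |g m| |t|^m, has to be cancelled by later
  terms, all of size at most C |t|^(m+1). Hence |g m| \<le> C p^(-N) for every N.\<close>

lemma power_series_zero:
  fixes g :: "nat \<Rightarrow> 'k"
  assumes g: "null_family UNIV g"
    and zero: "\<And>t. t \<in> Zp \<Longrightarrow> ((\<lambda>k. g k * t ^ k) has_sum 0) UNIV"
  shows "g k = 0"
proof (rule ccontr)
  assume "g k \<noteq> 0"
  define m where "m = (LEAST k. g k \<noteq> 0)"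
  have gm: "g m \<noteq> 0" unfolding m_def using \<open>g k \<noteq> 0\<close> by (rule LeastI)
  have below: "g j = 0" if "j < m" for j using not_less_Least that unfolding m_def by blast
  obtain C where C: "C > 0" "\<And>k. vabs (g k) \<le> C" using null_family_bounded[OF g] by auto
  have bound: "vabs (g m) \<le> C * (1 / real p) ^ N" for N
  proof -
    define t :: 'k where "t = of_nat p ^ N"
    have vt: "vabs t = (1 / real p) ^ N" "vabs t \<le> 1" "t \<noteq> 0"
      using p_ge_2 by (auto simp: t_def vabs_power vabs_p power_le_one)
    have "t \<in> Zp" by (simp add: t_def Zp_power)
    from zero[OF this] have 1: "((\<lambda>k. g k * t ^ k) has_sum 0) UNIV" .
    \<comment> \<open>Adding this one-term series removes the leading term: what remains has sum - g
      m t^m and only terms of degree above m.\<close>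
    have 2: "((\<lambda>k. if k = m then - (g m * t ^ m) else 0) has_sum - (g m * t ^ m)) UNIV"
      by (subst has_sum_cong_neutral[where T = "{m}" and g = "\<lambda>_. - (g m * t ^ m)"])
         (auto simp: has_sum_finite_iff)
    have "vabs (0 + - (g m * t ^ m)) \<le> C * vabs t ^ Suc m"
    proof (rule has_sum_vabs_le[OF has_sum_add[OF 1 2]])
      show "0 \<le> C * vabs t ^ Suc m" using C by simp
      fix j
      show "vabs (g j * t ^ j + (if j = m then - (g m * t ^ m) else 0)) \<le> C * vabs t ^ Suc m"
      proof (cases "j \<le> m")
        case True
        then show ?thesis using below[of j] C by (cases "j = m") auto
      next
        case False
        then have "vabs t ^ j \<le> vabs t ^ Suc m" using vt by (intro power_decreasing) auto
        then show ?thesis using False C by (auto simp: vabs_mult vabs_power intro!: mult_mono)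
      qed
    qed
    then have "vabs (g m) * vabs t ^ m \<le> (C * vabs t) * vabs t ^ m"
      by (simp add: vabs_mult vabs_power mult_ac)
    moreover have "vabs t ^ m > 0" using vt(3) by simp
    ultimately have "vabs (g m) \<le> C * vabs t" by (rule mult_right_le_imp_le)
    then show ?thesis by (simp add: vt)
  qed
  have "(\<lambda>N. C * (1 / real p) ^ N) \<longlonglongrightarrow> C * 0"
    using p_ge_2 by (intro tendsto_mult tendsto_const LIMSEQ_power_zero) auto
  then have "vabs (g m) \<le> C * 0"
    by (rule LIMSEQ_le_const) (use bound in auto)
  then show False using iffD2[OF vabs_pos_iff gm] by simp
qed

text \<open>Induction on the number of variables. With the other variables fixed, the series is a
  one-variable series in the variable \<open>i\<close>, so each of its coefficients vanishes. These
  coefficients are series in the remaining variables, to which the induction hypothesis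
  applies.\<close>

lemma multi_power_series_zero:
  fixes a :: "('j \<Rightarrow> nat) \<Rightarrow> 'k"
  assumes "finite J" "null_family (multi_indices J) a"
    and "\<And>z. z \<in> Zp_points J \<Longrightarrow> ((\<lambda>\<alpha>. a \<alpha> * mpower J z \<alpha>) has_sum 0) (multi_indices J)"
    and "\<alpha> \<in> multi_indices J"
  shows "a \<alpha> = 0"
  using assms
proof (induction J arbitrary: a \<alpha> rule: finite_induct)
  case empty
  have M: "multi_indices {} = {\<lambda>_::'j. 0::nat}" by (auto simp: multi_indices_def)
  have "((\<lambda>\<alpha>. a \<alpha> * mpower {} (\<lambda>_. 0) \<alpha>) has_sum 0) (multi_indices {})"
    by (rule empty.prems(2)) (simp add: Zp_points_def)
  then show ?case using empty.prems(3) unfolding M by (simp add: has_sum_finite_iff mpower_def)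
next
  case (insert i J)
  define h where "h = (\<lambda>(k, \<beta>). \<beta>(i := k) :: 'j \<Rightarrow> nat)"
  define a' where "a' = (\<lambda>x. a (h x))"
  let ?M = "multi_indices J"
  have bij: "bij_betw h (UNIV \<times> ?M) (multi_indices (insert i J))"
  proof (rule bij_betw_byWitness[where f' = "\<lambda>\<alpha>. (\<alpha> i, \<alpha>(i := 0))"])
    show "\<forall>x\<in>UNIV \<times> ?M. (\<lambda>\<alpha>. (\<alpha> i, \<alpha>(i := 0))) (h x) = x"
      using insert.hyps by (auto simp: h_def multi_indices_def fun_eq_iff)
    show "h ` (UNIV \<times> ?M) \<subseteq> multi_indices (insert i J)"
      by (auto simp: h_def multi_indices_def)
    show "(\<lambda>\<alpha>. (\<alpha> i, \<alpha>(i := 0))) ` multi_indices (insert i J) \<subseteq> UNIV \<times> ?M"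
      by (auto simp: multi_indices_def)
  qed (auto simp: h_def)
  have a': "null_family (UNIV \<times> ?M) a'"
    unfolding null_family_def
  proof (intro allI impI)
    fix \<epsilon> :: real assume e: "\<epsilon> > 0"
    let ?S = "{x \<in> UNIV \<times> ?M. \<epsilon> \<le> vabs (a' x)}"
    have "h ` ?S \<subseteq> {\<alpha> \<in> multi_indices (insert i J). \<epsilon> \<le> vabs (a \<alpha>)}"
      using bij_betw_imp_surj_on[OF bij] by (auto simp: a'_def)
    then have "finite (h ` ?S)"
      using null_familyD[OF insert.prems(1) e] by (rule finite_subset)
    moreover have "inj_on h ?S"
      using bij_betw_imp_inj_on[OF bij] by (rule inj_on_subset) auto
    ultimately show "finite ?S" by (simp add: finite_image_iff)
  qed
  have coeff: "a' (k, \<beta>) = 0" if "\<beta> \<in> ?M" for k \<beta>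
  proof (rule insert.IH[of "\<lambda>\<beta>. a' (k, \<beta>)"])
    show "null_family ?M (\<lambda>\<beta>. a' (k, \<beta>))" by (rule null_family_fiber[OF a']) simp
    fix z :: "'j \<Rightarrow> 'k" assume z: "z \<in> Zp_points J"
    define B where "B = (\<lambda>(k, \<beta>). a' (k, \<beta>) * mpower J z \<beta>)"
    have vz: "vabs (mpower J z \<beta>) \<le> 1" for \<beta>
      using z by (intro vabs_mpower_le) (auto simp: Zp_points_def vabs_Zp)
    have B: "null_family (UNIV \<times> ?M) B"
      by (rule null_family_le[OF a']) (auto simp: B_def vabs_mult vz mult_left_le)
    have zero: "infsum (\<lambda>\<beta>. B (k, \<beta>)) ?M = 0" for k
    proof (rule power_series_zero[where g = "\<lambda>k. infsum (\<lambda>\<beta>. B (k, \<beta>)) ?M"])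
      show "null_family UNIV (\<lambda>k. infsum (\<lambda>\<beta>. B (k, \<beta>)) ?M)" by (rule null_family_infsum[OF B])
      fix t :: 'k assume t: "t \<in> Zp"
      define D where "D = (\<lambda>(k, \<beta>). B (k, \<beta>) * t ^ k)"
      have vt: "vabs (t ^ k) \<le> 1" for k
        using vabs_Zp[OF t] by (simp add: vabs_power power_le_one)
      have D: "null_family (UNIV \<times> ?M) D"
        by (rule null_family_le[OF B]) (auto simp: D_def vabs_mult vt mult_left_le)
      have zt: "z(i := t) \<in> Zp_points (insert i J)" using z t by (auto simp: Zp_points_def)
      have Dh: "a (h x) * mpower (insert i J) (z(i := t)) (h x) = D x" for x
      proof -
        obtain k \<beta> where x: "x = (k, \<beta>)" by fastforce
        have "mpower (insert i J) (z(i := t)) (h x) = t ^ k * mpower J z \<beta>"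
        proof -
          have "(\<Prod>j\<in>J. (z(i := t)) j ^ (\<beta>(i := k)) j) = (\<Prod>j\<in>J. z j ^ \<beta> j)"
            using insert.hyps by (intro prod.cong) auto
          then show ?thesis unfolding mpower_def x h_def using insert.hyps by simp
        qed
        then show ?thesis by (simp add: x D_def B_def a'_def)
      qed
      have "((\<lambda>x. a (h x) * mpower (insert i J) (z(i := t)) (h x)) has_sum 0) (UNIV \<times> ?M)"
        using insert.prems(2)[OF zt] by (subst has_sum_reindex_bij_betw[OF bij])
      then have "(D has_sum 0) (UNIV \<times> ?M)" by (simp add: Dh)
      then have "infsum D (UNIV \<times> ?M) = 0" by (rule infsumI)
      then have "((\<lambda>k. infsum (\<lambda>\<beta>. D (k, \<beta>)) ?M) has_sum 0) UNIV"
        using null_family_fubini[OF D] by simp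
      moreover have "infsum (\<lambda>\<beta>. D (k, \<beta>)) ?M = infsum (\<lambda>\<beta>. B (k, \<beta>)) ?M * t ^ k" for k
        unfolding D_def
        using has_sum_cmult_left[OF null_family_has_sum[OF null_family_fiber[OF B]], of k "t ^ k"]
        by (simp add: infsumI)
      ultimately show "((\<lambda>k. infsum (\<lambda>\<beta>. B (k, \<beta>)) ?M * t ^ k) has_sum 0) UNIV" by simp
    qed
    show "((\<lambda>\<beta>. a' (k, \<beta>) * mpower J z \<beta>) has_sum 0) ?M"
      using null_family_has_sum[OF null_family_fiber[OF B], of k] zero[of k] by (simp add: B_def)
  qed (use that in auto)
  have "\<alpha> \<in> h ` (UNIV \<times> ?M)" using insert.prems(3) bij_betw_imp_surj_on[OF bij] by simp
  then obtain k \<beta> where "\<beta> \<in> ?M" "\<alpha> = h (k, \<beta>)" by auto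
  then show ?case using coeff[of \<beta> k] by (simp add: a'_def)
qed

text \<open>Values on \<open>X\<close> determine the coefficients because, by \<open>onto\<close>,
  the coordinates of \<open>X\<close> exhaust the Z_p-points.\<close>

lemma tate_expansion_unique:
  fixes a b :: "('j \<Rightarrow> nat) \<Rightarrow> 'k"
  assumes "finite J" "tate_expansion J X crd f a" "tate_expansion J X crd f b"
    and onto: "\<And>z. z \<in> Zp_points J \<Longrightarrow> \<exists>x\<in>X. \<forall>j\<in>J. crd x j = z j"
  shows "a = b"
proof
  fix \<alpha>
  show "a \<alpha> = b \<alpha>"
  proof (cases "\<alpha> \<in> multi_indices J")
    case True
    have "a \<alpha> - b \<alpha> = 0"
    proof (rule multi_power_series_zero[OF assms(1) _ _ True])
      show "null_family (multi_indices J) (\<lambda>\<alpha>. a \<alpha> - b \<alpha>)"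
        using assms(2,3) unfolding tate_expansion_def tends_to_0_vabs by (intro null_family_diff) auto
      fix z :: "'j \<Rightarrow> 'k" assume "z \<in> Zp_points J"
      then obtain x where x: "x \<in> X" "\<forall>j\<in>J. crd x j = z j" using onto by blast
      have m: "mpower J (crd x) \<alpha> = mpower J z \<alpha>" for \<alpha> using x by (intro mpower_cong) auto
      have 1: "((\<lambda>\<alpha>. a \<alpha> * mpower J z \<alpha>) has_sum f x) (multi_indices J)"
        and 2: "((\<lambda>\<alpha>. b \<alpha> * mpower J z \<alpha>) has_sum f x) (multi_indices J)"
        using assms(2,3) x(1) unfolding tate_expansion_def m[symmetric] by auto
      have "((\<lambda>\<alpha>. a \<alpha> * mpower J z \<alpha> + - (b \<alpha> * mpower J z \<alpha>)) has_sum f x + - f x) (multi_indices J)"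
        by (intro has_sum_add 1 iffD2[OF has_sum_uminus]) (simp add: 2)
      then show "((\<lambda>\<alpha>. (a \<alpha> - b \<alpha>) * mpower J z \<alpha>) has_sum 0) (multi_indices J)"
        by (simp add: left_diff_distrib)
    qed
    then show ?thesis by simp
  qed (use assms(2,3) in \<open>auto simp: tate_expansion_def\<close>)
qed

end

section \<open>The unit ball of a Tate algebra, as functions on a set with coordinates\<close>

locale tate_space = padic_base p ty
  for p :: nat and ty :: "'k::nonarch_field itself" +
  fixes I :: "'i set" and X :: "'x set" and crd :: "'x \<Rightarrow> 'i \<Rightarrow> 'k"
  assumes finite_I: "finite I" and crd_Zp: "\<And>x i. x \<in> X \<Longrightarrow> i \<in> I \<Longrightarrow> crd x i \<in> Zp"
begin

text \<open>The unit ball for the Gauss norm. Keeping \<open>X\<close> and \<open>crd\<close>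
  abstract lets the same results serve for the coordinates of G, for those of U_w, and for both
  together.\<close>

definition tate_ball :: "('x \<Rightarrow> 'k) set" where
  "tate_ball = {r. \<exists>a. tate_expansion I X crd r a \<and> (\<forall>\<alpha>. vabs (a \<alpha>) \<le> 1)}"

lemma vabs_mono_le: "x \<in> X \<Longrightarrow> vabs (mpower I (crd x) \<alpha>) \<le> 1"
  by (intro vabs_mpower_le vabs_Zp crd_Zp)

lemma tate_expansion_cong:
  "(\<And>x. x \<in> X \<Longrightarrow> f x = g x) \<Longrightarrow> tate_expansion I X crd f a \<longleftrightarrow> tate_expansion I X crd g a"
  unfolding tate_expansion_def by auto

lemma tate_ball_cong:
  "r \<in> tate_ball \<Longrightarrow> (\<And>x. x \<in> X \<Longrightarrow> r x = s x) \<Longrightarrow> s \<in> tate_ball"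
  unfolding tate_ball_def using tate_expansion_cong[of r s] by auto

text \<open>Interchange of two summations. The second conclusion, with \<open>C\<close> arbitrary,
  yields membership in the unit ball by way of the next two lemmas, and later bounds the norms of
  the tails of the orbit series.\<close>

lemma tate_expansion_double_sum:
  assumes A: "null_family (K \<times> multi_indices I) (\<lambda>(k, \<alpha>). A k \<alpha>)"
    and r: "\<And>k x. k \<in> K \<Longrightarrow> x \<in> X \<Longrightarrow>
      ((\<lambda>\<alpha>. A k \<alpha> * mpower I (crd x) \<alpha>) has_sum r k x) (multi_indices I)"
    and f: "\<And>x. x \<in> X \<Longrightarrow> ((\<lambda>k. r k x) has_sum f x) K"
  obtains b where "tate_expansion I X crd f b"
    "\<And>C \<alpha>. C \<ge> 0 \<Longrightarrow> (\<And>k \<alpha>. k \<in> K \<Longrightarrow> \<alpha> \<in> multi_indices I \<Longrightarrow> vabs (A k \<alpha>) \<le> C) \<Longrightarrow> vabs (b \<alpha>) \<le> C"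
proof -
  let ?M = "multi_indices I"
  define b where "b \<alpha> = (if \<alpha> \<in> ?M then infsum (\<lambda>k. A k \<alpha>) K else 0)" for \<alpha>
  have A': "null_family (?M \<times> K) (\<lambda>(\<alpha>, k). A k \<alpha>)" using null_family_swap[OF A] by simp
  have bsum: "((\<lambda>k. A k \<alpha>) has_sum b \<alpha>) K" if "\<alpha> \<in> ?M" for \<alpha>
    unfolding b_def using null_family_has_sum[OF null_family_fiber[OF A' that]] that by simp
  have "null_family ?M (\<lambda>\<alpha>. infsum (\<lambda>k. A k \<alpha>) K)" using null_family_infsum[OF A'] by simp
  then have null: "null_family ?M b" by (rule null_family_le) (simp add: b_def)
  have "((\<lambda>\<alpha>. b \<alpha> * mpower I (crd x) \<alpha>) has_sum f x) ?M" if x: "x \<in> X" for x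
  proof -
    define B where "B = (\<lambda>(k, \<alpha>). A k \<alpha> * mpower I (crd x) \<alpha>)"
    have B: "null_family (K \<times> ?M) B"
      by (rule null_family_le[OF A]) (auto simp: B_def vabs_mult vabs_mono_le[OF x] mult_left_le)
    have "((\<lambda>k. infsum (\<lambda>\<alpha>. B (k, \<alpha>)) ?M) has_sum infsum B (K \<times> ?M)) K"
      by (rule null_family_fubini[OF B])
    moreover have "infsum (\<lambda>\<alpha>. B (k, \<alpha>)) ?M = r k x" if "k \<in> K" for k
      unfolding B_def using r[OF that x] by (simp add: infsumI)
    ultimately have "((\<lambda>k. r k x) has_sum infsum B (K \<times> ?M)) K"
      by (simp cong: has_sum_cong)
    then have fx: "f x = infsum B (K \<times> ?M)" using f[OF x] has_sum_unique by blast
    have "((\<lambda>\<alpha>. infsum (\<lambda>k. B (k, \<alpha>)) K) has_sum f x) ?M"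
      unfolding fx by (rule null_family_fubini_swap[OF B])
    moreover have "infsum (\<lambda>k. B (k, \<alpha>)) K = b \<alpha> * mpower I (crd x) \<alpha>" if "\<alpha> \<in> ?M" for \<alpha>
      unfolding B_def using has_sum_cmult_left[OF bsum[OF that]] by (simp add: infsumI)
    ultimately show ?thesis by (simp cong: has_sum_cong)
  qed
  moreover have b_out: "b \<alpha> = 0" if "\<alpha> \<notin> ?M" for \<alpha> using that by (simp add: b_def)
  ultimately have "tate_expansion I X crd f b"
    unfolding tate_expansion_def tends_to_0_vabs using null b_out by blast
  moreover have "vabs (b \<alpha>) \<le> C"
    if C: "C \<ge> 0" "\<And>k \<alpha>. k \<in> K \<Longrightarrow> \<alpha> \<in> ?M \<Longrightarrow> vabs (A k \<alpha>) \<le> C" for C \<alpha>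
  proof (cases "\<alpha> \<in> ?M")
    case True
    then show ?thesis using C by (intro has_sum_vabs_le[OF bsum[OF True]]) auto
  qed (use C in \<open>simp add: b_def\<close>)
  ultimately show thesis by (rule that)
qed

text \<open>Null coefficients of any size are allowed here, and the \<open>r k\<close> need not
  converge at a common rate.\<close>

lemma tate_expansion_null_sum:
  assumes c: "null_family K c" and r: "\<And>k. k \<in> K \<Longrightarrow> r k \<in> tate_ball"
    and f: "\<And>x. x \<in> X \<Longrightarrow> ((\<lambda>k. c k * r k x) has_sum f x) K"
  obtains b where "tate_expansion I X crd f b"
    "\<And>C \<alpha>. C \<ge> 0 \<Longrightarrow> (\<And>k. k \<in> K \<Longrightarrow> vabs (c k) \<le> C) \<Longrightarrow> vabs (b \<alpha>) \<le> C"
proof -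
  have "\<forall>k\<in>K. \<exists>a. tate_expansion I X crd (r k) a \<and> (\<forall>\<alpha>. vabs (a \<alpha>) \<le> 1)"
    using r by (auto simp: tate_ball_def)
  then obtain a where a: "\<And>k. k \<in> K \<Longrightarrow> tate_expansion I X crd (r k) (a k)"
      "\<And>k \<alpha>. k \<in> K \<Longrightarrow> vabs (a k \<alpha>) \<le> 1"
    by metis
  have "null_family (K \<times> multi_indices I) (\<lambda>(k, \<alpha>). c k * a k \<alpha>)"
    using a by (intro null_family_mult[OF c]) (auto simp: tate_expansion_def tends_to_0_vabs)
  moreover have "((\<lambda>\<alpha>. c k * a k \<alpha> * mpower I (crd x) \<alpha>) has_sum c k * r k x) (multi_indices I)"
    if "k \<in> K" "x \<in> X" for k x
    unfolding mult.assoc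
    using a(1)[OF that(1)] that(2) by (intro has_sum_cmult_right) (auto simp: tate_expansion_def)
  ultimately obtain b where b: "tate_expansion I X crd f b"
    "\<And>C \<alpha>. C \<ge> 0 \<Longrightarrow> (\<And>k \<alpha>. k \<in> K \<Longrightarrow> \<alpha> \<in> multi_indices I \<Longrightarrow> vabs (c k * a k \<alpha>) \<le> C) \<Longrightarrow> vabs (b \<alpha>) \<le> C"
    using tate_expansion_double_sum[where r = "\<lambda>k x. c k * r k x" and f = f, OF _ _ f] by blast
  show thesis
  proof (rule that[OF b(1)])
    fix C :: real and \<alpha> assume C: "C \<ge> 0" "\<And>k. k \<in> K \<Longrightarrow> vabs (c k) \<le> C"
    have "vabs (c k * a k \<beta>) \<le> C" if "k \<in> K" for k \<beta>
      using mult_left_le[OF a(2)[OF that, of \<beta>], of "vabs (c k)"] C(2)[OF that]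
      by (simp add: vabs_mult)
    then show "vabs (b \<alpha>) \<le> C" using b(2)[OF C(1)] by blast
  qed
qed

lemma tate_ball_null_sum:
  assumes "null_family K c" "\<And>k. k \<in> K \<Longrightarrow> r k \<in> tate_ball"
    and "\<And>x. x \<in> X \<Longrightarrow> ((\<lambda>k. c k * r k x) has_sum f x) K"
    and "\<And>k. k \<in> K \<Longrightarrow> vabs (c k) \<le> 1"
  shows "f \<in> tate_ball"
proof -
  obtain b where "tate_expansion I X crd f b"
    "\<And>C \<alpha>. C \<ge> 0 \<Longrightarrow> (\<And>k. k \<in> K \<Longrightarrow> vabs (c k) \<le> C) \<Longrightarrow> vabs (b \<alpha>) \<le> C"
    using tate_expansion_null_sum[OF assms(1-3)] by blast
  then show ?thesis unfolding tate_ball_def using assms(4) by (intro CollectI exI[of _ b]) auto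
qed

lemma tate_ball_const:
  assumes "vabs c \<le> 1" shows "(\<lambda>_. c) \<in> tate_ball"
proof -
  define a where "a = (\<lambda>\<alpha>::'i \<Rightarrow> nat. if \<alpha> = (\<lambda>_. 0) then c else 0)"
  have "null_family (multi_indices I) a"
    unfolding null_family_def
  proof (intro allI impI)
    fix \<epsilon> :: real assume "\<epsilon> > 0"
    then have "{\<alpha> \<in> multi_indices I. \<epsilon> \<le> vabs (a \<alpha>)} \<subseteq> {\<lambda>_. 0}"
      by (auto simp: a_def split: if_splits)
    then show "finite {\<alpha> \<in> multi_indices I. \<epsilon> \<le> vabs (a \<alpha>)}" by (rule finite_subset) simp
  qed
  moreover have "((\<lambda>\<alpha>. a \<alpha> * mpower I (crd x) \<alpha>) has_sum c) (multi_indices I)" for x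
    by (subst has_sum_cong_neutral[where T = "{\<lambda>_. 0}" and g = "\<lambda>_. c"])
       (auto simp: a_def has_sum_finite_iff)
  ultimately have "tate_expansion I X crd (\<lambda>_. c) a"
    unfolding tate_expansion_def tends_to_0_vabs by (auto simp: a_def)
  then show ?thesis unfolding tate_ball_def using assms
    by (intro CollectI exI[of _ a]) (auto simp: a_def)
qed

lemma tate_ball_monomial_mult:
  assumes r: "r \<in> tate_ball" and \<beta>: "\<beta> \<in> multi_indices I"
  shows "(\<lambda>x. mpower I (crd x) \<beta> * r x) \<in> tate_ball"
proof -
  let ?M = "multi_indices I"
  obtain a where a: "tate_expansion I X crd r a" "\<And>\<alpha>. vabs (a \<alpha>) \<le> 1"
    using r by (auto simp: tate_ball_def)
  define h where "h \<alpha> = (\<lambda>i. \<alpha> i + \<beta> i)" for \<alpha> :: "'i \<Rightarrow> nat"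
  \<comment> \<open>Truncated subtraction is exact here, since it is applied only to shifted
    exponents.\<close>
  define a' where "a' \<gamma> = (if \<gamma> \<in> h ` ?M then a (\<lambda>i. \<gamma> i - \<beta> i) else 0)" for \<gamma>
  have hM: "h ` ?M \<subseteq> ?M" using \<beta> by (auto simp: h_def multi_indices_def)
  have a'h: "a' (h \<alpha>) = a \<alpha>" if "\<alpha> \<in> ?M" for \<alpha> using that by (auto simp: a'_def h_def)
  have inj: "inj_on h ?M" by (rule inj_onI) (auto simp: h_def fun_eq_iff)
  have "null_family ?M a'"
    unfolding null_family_def
  proof (intro allI impI)
    fix \<epsilon> :: real assume e: "\<epsilon> > 0"
    have "\<gamma> \<in> h ` {\<alpha> \<in> ?M. \<epsilon> \<le> vabs (a \<alpha>)}" if g: "\<gamma> \<in> ?M" "\<epsilon> \<le> vabs (a' \<gamma>)" for \<gamma>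
    proof -
      have "\<gamma> \<in> h ` ?M" using g e by (auto simp: a'_def split: if_splits)
      then obtain \<alpha> where "\<alpha> \<in> ?M" "\<gamma> = h \<alpha>" by blast
      then show ?thesis using g a'h by auto
    qed
    then have "{\<gamma> \<in> ?M. \<epsilon> \<le> vabs (a' \<gamma>)} \<subseteq> h ` {\<alpha> \<in> ?M. \<epsilon> \<le> vabs (a \<alpha>)}" by blast
    moreover have "finite {\<alpha> \<in> ?M. \<epsilon> \<le> vabs (a \<alpha>)}"
      using a(1) e by (intro null_familyD) (auto simp: tate_expansion_def tends_to_0_vabs)
    ultimately show "finite {\<gamma> \<in> ?M. \<epsilon> \<le> vabs (a' \<gamma>)}" by (meson finite_imageI finite_subset)
  qed
  moreover have "((\<lambda>\<gamma>. a' \<gamma> * mpower I (crd x) \<gamma>) has_sum mpower I (crd x) \<beta> * r x) ?M"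
    if x: "x \<in> X" for x
  proof -
    have "((\<lambda>\<alpha>. mpower I (crd x) \<beta> * (a \<alpha> * mpower I (crd x) \<alpha>)) has_sum mpower I (crd x) \<beta> * r x) ?M"
      using a(1) x by (intro has_sum_cmult_right) (auto simp: tate_expansion_def)
    moreover have "mpower I (crd x) \<beta> * (a \<alpha> * mpower I (crd x) \<alpha>) = a' (h \<alpha>) * mpower I (crd x) (h \<alpha>)"
      if "\<alpha> \<in> ?M" for \<alpha>
      using a'h[OF that] by (simp add: h_def mpower_add)
    ultimately have "(((\<lambda>\<gamma>. a' \<gamma> * mpower I (crd x) \<gamma>) \<circ> h) has_sum mpower I (crd x) \<beta> * r x) ?M"
      by (simp cong: has_sum_cong)
    then have "((\<lambda>\<gamma>. a' \<gamma> * mpower I (crd x) \<gamma>) has_sum mpower I (crd x) \<beta> * r x) (h ` ?M)"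
      by (subst has_sum_reindex[OF inj])
    then show ?thesis
      by (subst has_sum_cong_neutral[where T = "h ` ?M" and g = "\<lambda>\<gamma>. a' \<gamma> * mpower I (crd x) \<gamma>"])
         (use hM in \<open>auto simp: a'_def\<close>)
  qed
  moreover have "a' \<gamma> = 0" if "\<gamma> \<notin> ?M" for \<gamma> using that hM by (auto simp: a'_def)
  ultimately have "tate_expansion I X crd (\<lambda>x. mpower I (crd x) \<beta> * r x) a'"
    unfolding tate_expansion_def tends_to_0_vabs by blast
  then show ?thesis unfolding tate_ball_def using a(2)
    by (intro CollectI exI[of _ a']) (auto simp: a'_def)
qed

lemma tate_ball_crd:
  assumes "i \<in> I" shows "(\<lambda>x. crd x i) \<in> tate_ball"
proof -
  let ?b = "\<lambda>j. if j = i then 1 else 0 :: nat"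
  have "?b \<in> multi_indices I" using assms by (auto simp: multi_indices_def)
  from tate_ball_monomial_mult[OF tate_ball_const[of 1] this]
  have "(\<lambda>x. mpower I (crd x) ?b) \<in> tate_ball" by simp
  then show ?thesis
  proof (rule tate_ball_cong)
    fix x
    have "mpower I (crd x) ?b = (\<Prod>j\<in>I. if j = i then crd x j else 1)"
      unfolding mpower_def by (intro prod.cong) auto
    then show "mpower I (crd x) ?b = crd x i" using finite_I assms by simp
  qed
qed

text \<open>Products, inverses, logarithms and exponentials are all sums \<open>\<Sum>\<^sub>k c\<^sub>k r\<^sub>k\<close> with \<open>c\<close> a null family and
  \<open>r\<^sub>k\<close> already known to lie in the ball; for products the \<open>r\<^sub>k\<close> are monomial multiples of one factor.\<close>

lemma tate_ball_mult:
  assumes r: "r \<in> tate_ball" and s: "s \<in> tate_ball"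
  shows "(\<lambda>x. r x * s x) \<in> tate_ball"
proof -
  obtain b where b: "tate_expansion I X crd s b" "\<And>\<alpha>. vabs (b \<alpha>) \<le> 1"
    using s by (auto simp: tate_ball_def)
  show ?thesis
  proof (rule tate_ball_null_sum[where K = "multi_indices I" and c = b
        and r = "\<lambda>\<beta> x. mpower I (crd x) \<beta> * r x"])
    fix x assume "x \<in> X"
    then have "((\<lambda>\<beta>. r x * (b \<beta> * mpower I (crd x) \<beta>)) has_sum r x * s x) (multi_indices I)"
      using b(1) by (intro has_sum_cmult_right) (auto simp: tate_expansion_def)
    then show "((\<lambda>\<beta>. b \<beta> * (mpower I (crd x) \<beta> * r x)) has_sum r x * s x) (multi_indices I)"
      by (simp add: mult_ac)
  qed (use b tate_ball_monomial_mult[OF r] in \<open>auto simp: tate_expansion_def tends_to_0_vabs\<close>)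
qed

lemma tate_ball_add:
  assumes "r \<in> tate_ball" "s \<in> tate_ball"
  shows "(\<lambda>x. r x + s x) \<in> tate_ball"
proof (rule tate_ball_null_sum[where K = "UNIV :: bool set" and c = "\<lambda>_. 1"
        and r = "\<lambda>k x. if k then r x else s x"])
  fix k show "(\<lambda>x. if k then r x else s x) \<in> tate_ball" using assms by (cases k) auto
qed (auto simp: null_family_finite has_sum_finite_iff UNIV_bool add.commute)

lemma tate_ball_power: "r \<in> tate_ball \<Longrightarrow> (\<lambda>x. r x ^ k) \<in> tate_ball"
  by (induction k) (auto intro: tate_ball_mult tate_ball_const)

lemma tate_ball_prod:
  "(\<And>i. i \<in> S \<Longrightarrow> r i \<in> tate_ball) \<Longrightarrow> (\<lambda>x. \<Prod>i\<in>S. r i x) \<in> tate_ball"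
  by (induction S rule: infinite_finite_induct) (auto intro: tate_ball_mult tate_ball_const)

lemma tate_ball_vabs_le:
  assumes "r \<in> tate_ball" "x \<in> X" shows "vabs (r x) \<le> 1"
proof -
  obtain a where a: "tate_expansion I X crd r a" "\<And>\<alpha>. vabs (a \<alpha>) \<le> 1"
    using assms by (auto simp: tate_ball_def)
  have "((\<lambda>\<alpha>. a \<alpha> * mpower I (crd x) \<alpha>) has_sum r x) (multi_indices I)"
    using a(1) assms(2) by (auto simp: tate_expansion_def)
  then show ?thesis
    by (rule has_sum_vabs_le)
       (auto simp: vabs_mult intro!: mult_le_one a(2) vabs_mono_le[OF assms(2)])
qed

text \<open>The geometric series in r with coefficients (-p)^k, a null family because |p| <
  1.\<close>

lemma tate_ball_inverse:
  assumes r: "r \<in> tate_ball"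
  shows "(\<lambda>x. 1 / (1 + of_nat p * r x)) \<in> tate_ball"
proof -
  have vp: "vabs (- of_nat p :: 'k) = 1 / real p" using vabs_p by simp
  have null: "null_family UNIV (\<lambda>k. (- of_nat p :: 'k) ^ k)"
    using p_ge_2 by (intro null_family_of_tendsto) (simp add: vabs_power vabs_p LIMSEQ_power_zero)
  show ?thesis
  proof (rule tate_ball_null_sum[where K = "UNIV :: nat set" and c = "\<lambda>k. (- of_nat p) ^ k"
        and r = "\<lambda>k x. r x ^ k", OF null])
    fix x assume x: "x \<in> X"
    define y where "y = - of_nat p * r x"
    define S where "S = infsum (\<lambda>k. y ^ k) UNIV"
    have yk: "y ^ k = (- of_nat p) ^ k * r x ^ k" for k unfolding y_def by (rule power_mult_distrib)
    have "null_family UNIV (\<lambda>k. y ^ k)"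
    proof (rule null_family_le[OF null])
      fix k :: nat
      show "vabs (y ^ k) \<le> vabs ((- of_nat p :: 'k) ^ k)"
        unfolding yk vabs_mult using tate_ball_vabs_le[OF tate_ball_power[OF r] x, of k]
        by (intro mult_left_le) auto
    qed
    then have S: "((\<lambda>k. y ^ k) has_sum S) UNIV" unfolding S_def by (rule null_family_has_sum)
    \<comment> \<open>Shifting the index identifies the sum through S = 1 + y S.\<close>
    have "((\<lambda>k. y * y ^ k) has_sum y * S) UNIV" by (rule has_sum_cmult_right[OF S])
    then have "(((\<lambda>k. y ^ k) \<circ> Suc) has_sum y * S) UNIV" by (simp add: o_def)
    then have "((\<lambda>k. y ^ k) has_sum y * S) (range Suc)" by (subst has_sum_reindex) auto
    moreover have "((\<lambda>k. y ^ k) has_sum 1) {0}" by (simp add: has_sum_finite_iff)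
    ultimately have "((\<lambda>k. y ^ k) has_sum (1 + y * S)) ({0} \<union> range Suc)"
      by (intro has_sum_Un_disjoint) auto
    then have "((\<lambda>k. y ^ k) has_sum (1 + y * S)) UNIV" by (simp add: UNIV_nat_eq[symmetric])
    then have "S = 1 + y * S" using S has_sum_unique by blast
    then have eq: "S * (1 - y) = 1" by (simp add: algebra_simps)
    then have "1 - y \<noteq> 0" by auto
    then have "S = 1 / (1 - y)" using eq by (simp add: field_simps)
    then show "((\<lambda>k. (- of_nat p) ^ k * r x ^ k) has_sum 1 / (1 + of_nat p * r x)) UNIV"
      using S unfolding yk by (simp add: y_def)
  next
    fix k :: nat
    show "vabs ((- of_nat p :: 'k) ^ k) \<le> 1" unfolding vabs_power vp using p_ge_2 by (intro power_le_one) auto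
  qed (use tate_ball_power[OF r] in auto)
qed

text \<open>One factor p is taken out of log(1 + p r), which leaves \<open>l k\<close> = (-1)^k p^k
  / (k + 1) as the coefficient of r^(k+1). As |k + 1| \<ge> 1/(k + 1), these are still bounded by 1
  and tend to 0.\<close>

lemma tate_ball_log:
  assumes r: "r \<in> tate_ball"
  obtains L where "L \<in> tate_ball" "\<And>x. x \<in> X \<Longrightarrow> padic_log (1 + of_nat p * r x) = of_nat p * L x"
proof -
  define l :: "nat \<Rightarrow> 'k" where "l k = (- 1) ^ k * of_nat p ^ k / of_nat (Suc k)" for k
  have l_le: "vabs (l k) \<le> real (Suc k) * (1 / real p) ^ k" for k
  proof -
    have "vabs (l k) = (1 / real p) ^ k / vabs (of_nat (Suc k) :: 'k)"
      by (simp add: l_def vabs_divide vabs_mult vabs_power vabs_p del: of_nat_Suc)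
    also have "\<dots> \<le> (1 / real p) ^ k / (1 / real (Suc k))"
      using vabs_of_nat_ge[of "Suc k"] by (intro divide_left_mono) (auto simp del: of_nat_Suc)
    finally show ?thesis by (simp add: mult.commute)
  qed
  have l_le_1: "vabs (l k) \<le> 1" for k
  proof -
    have "Suc k \<le> 2 ^ k" by (induction k) auto
    also have "(2::nat) ^ k \<le> p ^ k" using p_ge_2 by (intro power_mono) auto
    finally have "real (Suc k) \<le> real p ^ k" by (metis of_nat_le_iff of_nat_power)
    then have "real (Suc k) * (1 / real p) ^ k \<le> 1"
      using p_ge_2 by (simp add: power_one_over divide_simps)
    then show ?thesis using l_le[of k] by linarith
  qed
  have lim: "(\<lambda>k. real (Suc k) * (1 / real p) ^ k) \<longlonglongrightarrow> 0"
  proof -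
    have x: "norm (1 / real p) < 1" using p_ge_2 by simp
    have "(\<lambda>k. real k * (1 / real p) ^ k + (1 / real p) ^ k) \<longlonglongrightarrow> 0 + 0"
      using x by (intro tendsto_add powser_times_n_limit_0 LIMSEQ_power_zero) auto
    then show ?thesis by (simp add: algebra_simps)
  qed
  have null: "null_family UNIV l"
    by (rule null_family_of_tendsto, rule tendsto_sandwich[OF _ _ tendsto_const lim])
       (use l_le in \<open>auto intro!: always_eventually\<close>)
  define L where "L x = infsum (\<lambda>k. l k * r x ^ Suc k) UNIV" for x
  have sum: "((\<lambda>k. l k * r x ^ Suc k) has_sum L x) UNIV" if x: "x \<in> X" for x
    unfolding L_def
  proof (rule null_family_has_sum, rule null_family_le[OF null])
    fix k
    show "vabs (l k * r x ^ Suc k) \<le> vabs (l k)"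
      unfolding vabs_mult[of "l k"] using tate_ball_vabs_le[OF tate_ball_power[OF r] x]
      by (intro mult_left_le vabs_nonneg)
  qed
  have "L \<in> tate_ball"
    by (rule tate_ball_null_sum[OF null tate_ball_power[OF r] sum l_le_1])
  moreover have "padic_log (1 + of_nat p * r x) = of_nat p * L x" if x: "x \<in> X" for x
  proof -
    have "(\<lambda>k. of_nat p * (l k * r x ^ Suc k)) sums (of_nat p * L x)"
      by (intro has_sum_imp_sums has_sum_cmult_right sum x)
    moreover have "of_nat p * (l k * r x ^ Suc k)
        = (- 1) ^ k * (1 + of_nat p * r x - 1) ^ Suc k / of_nat (Suc k)" for k
      by (simp add: l_def power_mult_distrib mult_ac del: of_nat_Suc)
    ultimately show ?thesis unfolding padic_log_def by (simp only: sums_unique[symmetric])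
  qed
  ultimately show thesis by (rule that)
qed

text \<open>With log(1 + p r) = p L, this is the sum of (c p)^k / k! times L^k. By
  \<open>vabs_fact_ge\<close> the coefficients are at most q^k, where q = |c p| /
  \<open>exp_radius\<close> < 1.\<close>

lemma tate_ball_exp_log:
  assumes r: "r \<in> tate_ball" and c: "vabs (c * of_nat p) < exp_radius"
  shows "(\<lambda>x. padic_exp (c * padic_log (1 + of_nat p * r x))) \<in> tate_ball"
proof -
  obtain L where L: "L \<in> tate_ball" "\<And>x. x \<in> X \<Longrightarrow> padic_log (1 + of_nat p * r x) = of_nat p * L x"
    using tate_ball_log[OF r] by blast
  define e :: "nat \<Rightarrow> 'k" where "e k = (c * of_nat p) ^ k / fact k" for k
  define q where "q = vabs (c * of_nat p) / exp_radius"
  have q: "0 \<le> q" "q < 1" using c exp_radius by (auto simp: q_def)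
  have e_le: "vabs (e k) \<le> q ^ k" for k
  proof -
    have "vabs (e k) = vabs (c * of_nat p) ^ k / vabs (fact k :: 'k)"
      by (simp add: e_def vabs_divide vabs_power)
    also have "\<dots> \<le> vabs (c * of_nat p) ^ k / exp_radius ^ k"
      using vabs_fact_ge[of k] exp_radius by (intro divide_left_mono) auto
    finally show ?thesis by (simp add: q_def power_divide)
  qed
  have null: "null_family UNIV e"
    by (rule null_family_of_tendsto,
        rule tendsto_sandwich[OF _ _ tendsto_const LIMSEQ_power_zero[of q]])
       (use e_le q in \<open>auto intro!: always_eventually\<close>)
  have e_le_1: "vabs (e k) \<le> 1" for k
    using e_le[of k] q power_le_one[of q k] by linarith
  have sum: "((\<lambda>k. e k * L x ^ k) has_sum padic_exp (c * padic_log (1 + of_nat p * r x))) UNIV"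
    if x: "x \<in> X" for x
  proof -
    have "null_family UNIV (\<lambda>k. e k * L x ^ k)"
    proof (rule null_family_le[OF null])
      fix k
      show "vabs (e k * L x ^ k) \<le> vabs (e k)"
        unfolding vabs_mult using tate_ball_vabs_le[OF tate_ball_power[OF L(1)] x] by (intro mult_left_le) auto
    qed
    then have s: "((\<lambda>k. e k * L x ^ k) has_sum infsum (\<lambda>k. e k * L x ^ k) UNIV) UNIV"
      by (rule null_family_has_sum)
    have "e k * L x ^ k = (c * padic_log (1 + of_nat p * r x)) ^ k / fact k" for k
      by (simp add: L(2)[OF x] e_def power_mult_distrib mult_ac)
    then have "padic_exp (c * padic_log (1 + of_nat p * r x)) = (\<Sum>k. e k * L x ^ k)"
      by (simp add: padic_exp_def)
    also have "\<dots> = infsum (\<lambda>k. e k * L x ^ k) UNIV"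
      using has_sum_imp_sums[OF s] by (simp add: sums_iff)
    finally show ?thesis using s by simp
  qed
  show ?thesis
    by (rule tate_ball_null_sum[OF null tate_ball_power[OF L(1)] sum e_le_1])
qed

end

section \<open>Pro-p matrices over algebras of functions\<close>

lemma mat_mult_index:
  assumes "M \<in> carrier_mat n n" "N \<in> carrier_mat n n" "i < n" "j < n"
  shows "(M * N) $$ (i,j) = (\<Sum>k<n. M $$ (i,k) * N $$ (k,j))"
  using assms by (auto simp: scalar_prod_def atLeast0LessThan intro!: sum.cong)

lemma minv_eqI:
  fixes M N :: "'k::nonarch_field mat"
  assumes M: "M \<in> carrier_mat n n" and N: "N \<in> carrier_mat n n"
    and MN: "M * N = 1\<^sub>m n" and NM: "N * M = 1\<^sub>m n"
  shows "minv M = N"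
proof -
  have "M \<in> Units (ring_mat TYPE('k) n ())"
    unfolding Units_def using assms by (auto simp: ring_mat_simps)
  then obtain B where B: "mat_inverse M = Some B"
    using mat_inverse(1)[OF M, of "()"] by (cases "mat_inverse M") auto
  have B': "B * M = 1\<^sub>m n" "B \<in> carrier_mat n n" using mat_inverse(2)[OF M B] by auto
  have "B = B * (M * N)" using B' by (simp add: MN)
  also have "\<dots> = (B * M) * N" using B'(2) M N by simp
  also have "\<dots> = N" using B'(1) N by simp
  finally show ?thesis using B by simp
qed

text \<open>Cramer's rule: the entries of the inverse arise by ring operations and one division by
  the determinant, which is how they will be seen to lie in the same algebra of functions.\<close>

lemma minv_det:
  fixes M :: "'k::nonarch_field mat"
  assumes M: "M \<in> carrier_mat n n" and d: "det M \<noteq> 0"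
  shows "minv M \<in> carrier_mat n n" "M * minv M = 1\<^sub>m n" "minv M * M = 1\<^sub>m n"
    "\<And>i j. i < n \<Longrightarrow> j < n \<Longrightarrow> minv M $$ (i,j) = cofactor M j i / det M"
proof -
  define N where "N = (1 / det M) \<cdot>\<^sub>m adj_mat M"
  have N: "N \<in> carrier_mat n n" using adj_mat(1)[OF M] by (simp add: N_def)
  have sm: "(1 / det M) \<cdot>\<^sub>m (det M \<cdot>\<^sub>m 1\<^sub>m n) = 1\<^sub>m n" using d by (intro eq_matI) auto
  have 1: "M * N = 1\<^sub>m n" unfolding N_def using adj_mat[OF M] M sm by (simp add: mult_smult_distrib)
  have 2: "N * M = 1\<^sub>m n" unfolding N_def using adj_mat[OF M] M sm by (simp add: mult_smult_assoc_mat)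
  have eq: "minv M = N" by (rule minv_eqI[OF M N 1 2])
  show "minv M \<in> carrier_mat n n" "M * minv M = 1\<^sub>m n" "minv M * M = 1\<^sub>m n"
    unfolding eq using N 1 2 by auto
  show "minv M $$ (i,j) = cofactor M j i / det M" if "i < n" "j < n" for i j
    unfolding eq N_def adj_mat_def using that M by simp
qed

lemma signof_Zp: "(signof \<pi> :: 'k::nonarch_field) \<in> Zp"
  by (simp add: sign_def Zp_uminus)

text \<open>\<open>schur \<sigma> m k\<close> is the matrix \<open>m\<close> after elimination with the pivots
  \<open>(\<sigma> 0, \<sigma> 0), \<dots>, (\<sigma> (k - 1), \<sigma> (k - 1))\<close>, whose rows and columns are then zero.\<close>

primrec schur :: "(nat \<Rightarrow> nat) \<Rightarrow> (nat \<Rightarrow> nat \<Rightarrow> 'k::field) \<Rightarrow> nat \<Rightarrow> nat \<Rightarrow> nat \<Rightarrow> 'k" where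
  "schur \<sigma> m 0 = m"
| "schur \<sigma> m (Suc k) = (\<lambda>a b. schur \<sigma> m k a b -
     schur \<sigma> m k a (\<sigma> k) * schur \<sigma> m k (\<sigma> k) b / schur \<sigma> m k (\<sigma> k) (\<sigma> k))"

text \<open>Each step clears the row and the column of its pivot. Later corrections at a cleared
  position contain a factor that is itself cleared, so the zeros persist.\<close>

lemma schur_eliminated:
  assumes "\<And>j. j < k \<Longrightarrow> schur \<sigma> m j (\<sigma> j) (\<sigma> j) \<noteq> 0" "j < k"
  shows "schur \<sigma> m k a (\<sigma> j) = 0 \<and> schur \<sigma> m k (\<sigma> j) b = 0"
  using assms
proof (induction k arbitrary: a b)
  case (Suc k)
  show ?case
  proof (cases "j = k")
    case True
    then show ?thesis using Suc.prems(1)[of k] by simp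
  next
    case False
    then have "j < k" using Suc.prems by simp
    then show ?thesis using Suc.IH Suc.prems by auto
  qed
qed auto

text \<open>Every elimination step removes a matrix of rank one. The sum of these becomes the LU
  decomposition once nothing is left over.\<close>

lemma schur_telescope:
  "m a b = schur \<sigma> m n a b +
    (\<Sum>k<n. schur \<sigma> m k a (\<sigma> k) * schur \<sigma> m k (\<sigma> k) b / schur \<sigma> m k (\<sigma> k) (\<sigma> k))"
  by (induction n) auto

text \<open>\<open>inv_into UNIV \<sigma> c\<close> is the step at which \<open>c\<close> is the
  pivot. For nonzero pivots, the division puts 1 on the diagonal here and leaves the pivots on the
  diagonal of \<open>lu_upper\<close>. Triangularity of the two factors refers to the order \<sigma>
  0, \<sigma> 1, ... of the indices.\<close>

definition lu_lower :: "(nat \<Rightarrow> nat) \<Rightarrow> nat \<Rightarrow> 'k::field mat \<Rightarrow> 'k mat" where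
  "lu_lower \<sigma> n M = mat n n (\<lambda>(a,c). let s = schur \<sigma> (\<lambda>i j. M $$ (i,j)) (inv_into UNIV \<sigma> c) in s a c / s c c)"

definition lu_upper :: "(nat \<Rightarrow> nat) \<Rightarrow> nat \<Rightarrow> 'k::field mat \<Rightarrow> 'k mat" where
  "lu_upper \<sigma> n M = mat n n (\<lambda>(c,b). schur \<sigma> (\<lambda>i j. M $$ (i,j)) (inv_into UNIV \<sigma> c) c b)"

lemma lu_lower_carrier [simp]: "lu_lower \<sigma> n M \<in> carrier_mat n n"
  and lu_upper_carrier [simp]: "lu_upper \<sigma> n M \<in> carrier_mat n n"
  by (auto simp: lu_lower_def lu_upper_def)

text \<open>These closure properties are all that the matrix arguments use. The locale is applied to
  power series, and also to all Z_p-valued functions on a one-point set, which turns statements on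
  families into statements on single matrices.\<close>

locale zp_algebra = padic_base p ty
  for p :: nat and ty :: "'k::nonarch_field itself" +
  fixes X :: "'x set" and A :: "('x \<Rightarrow> 'k) set"
  assumes A_Zp: "\<And>r x. r \<in> A \<Longrightarrow> x \<in> X \<Longrightarrow> r x \<in> Zp"
    and A_const: "\<And>c. c \<in> Zp \<Longrightarrow> (\<lambda>_. c) \<in> A"
    and A_add: "\<And>r s. r \<in> A \<Longrightarrow> s \<in> A \<Longrightarrow> (\<lambda>x. r x + s x) \<in> A"
    and A_mult: "\<And>r s. r \<in> A \<Longrightarrow> s \<in> A \<Longrightarrow> (\<lambda>x. r x * s x) \<in> A"
    and A_inverse: "\<And>r. r \<in> A \<Longrightarrow> (\<lambda>x. 1 / (1 + of_nat p * r x)) \<in> A"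
    and A_cong: "\<And>r s. r \<in> A \<Longrightarrow> (\<And>x. x \<in> X \<Longrightarrow> r x = s x) \<Longrightarrow> s \<in> A"
begin

lemma A_uminus: "r \<in> A \<Longrightarrow> (\<lambda>x. - r x) \<in> A"
  using A_mult[OF A_const[of "-1"], of r] Zp_uminus[OF Zp_1] by simp

lemma A_diff: "r \<in> A \<Longrightarrow> s \<in> A \<Longrightarrow> (\<lambda>x. r x - s x) \<in> A"
  using A_add[OF _ A_uminus, of r s] by simp

lemma A_sum: "(\<And>i. i \<in> S \<Longrightarrow> r i \<in> A) \<Longrightarrow> (\<lambda>x. \<Sum>i\<in>S. r i x) \<in> A"
  by (induction S rule: infinite_finite_induct) (auto intro: A_add A_const)

lemma A_prod: "(\<And>i. i \<in> S \<Longrightarrow> r i \<in> A) \<Longrightarrow> (\<lambda>x. \<Prod>i\<in>S. r i x) \<in> A"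
  by (induction S rule: infinite_finite_induct) (auto intro: A_mult A_const)

definition pA :: "('x \<Rightarrow> 'k) set" where
  "pA = {r. (\<lambda>x. r x / of_nat p) \<in> A}"

lemma pA_cong: "r \<in> pA \<Longrightarrow> (\<And>x. x \<in> X \<Longrightarrow> r x = s x) \<Longrightarrow> s \<in> pA"
  unfolding pA_def using A_cong[of "\<lambda>x. r x / of_nat p" "\<lambda>x. s x / of_nat p"] by auto

lemma pA_add: "r \<in> pA \<Longrightarrow> s \<in> pA \<Longrightarrow> (\<lambda>x. r x + s x) \<in> pA"
  unfolding pA_def using A_add[of "\<lambda>x. r x / of_nat p" "\<lambda>x. s x / of_nat p"]
  by (simp add: add_divide_distrib)

lemma pA_uminus: "r \<in> pA \<Longrightarrow> (\<lambda>x. - r x) \<in> pA"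
  unfolding pA_def using A_uminus[of "\<lambda>x. r x / of_nat p"] by simp

lemma pA_diff: "r \<in> pA \<Longrightarrow> s \<in> pA \<Longrightarrow> (\<lambda>x. r x - s x) \<in> pA"
  using pA_add[OF _ pA_uminus, of r s] by simp

lemma pA_mult_left: "r \<in> A \<Longrightarrow> s \<in> pA \<Longrightarrow> (\<lambda>x. r x * s x) \<in> pA"
  unfolding pA_def using A_mult[of r "\<lambda>x. s x / of_nat p"] by simp

lemma pA_mult_right: "r \<in> pA \<Longrightarrow> s \<in> A \<Longrightarrow> (\<lambda>x. r x * s x) \<in> pA"
  using pA_mult_left[of s r] by (simp add: mult.commute)

lemma pA_const_0: "(\<lambda>_. 0) \<in> pA"
  unfolding pA_def by (simp add: A_const)

lemma pA_sum: "(\<And>i. i \<in> S \<Longrightarrow> r i \<in> pA) \<Longrightarrow> (\<lambda>x. \<Sum>i\<in>S. r i x) \<in> pA"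
  by (induction S rule: infinite_finite_induct) (auto intro: pA_add pA_const_0)

lemma pA_p_mult: "r \<in> A \<Longrightarrow> (\<lambda>x. of_nat p * r x) \<in> pA"
  unfolding pA_def by simp

lemma pA_imp_A: "r \<in> pA \<Longrightarrow> r \<in> A"
  unfolding pA_def using A_mult[OF A_const[of "of_nat p"], of "\<lambda>x. r x / of_nat p"] by simp

lemma pA_pZp: "r \<in> pA \<Longrightarrow> x \<in> X \<Longrightarrow> r x \<in> pZp p"
  unfolding pA_def pZp_iff using A_Zp by auto

lemma one_plus_pA_vabs:
  assumes "(\<lambda>x. d x - 1) \<in> pA" "x \<in> X" shows "vabs (d x) = 1"
proof -
  have "(d x - 1) / of_nat p \<in> Zp" using assms A_Zp by (auto simp: pA_def)
  then have "vabs (d x - 1) * real p \<le> 1" using vabs_Zp by (fastforce simp: vabs_divide vabs_p)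
  then have "vabs (d x - 1) < vabs (1::'k)"
    using p_ge_2 mult_left_mono[of 2 "real p" "vabs (d x - 1)"] by simp
  then show ?thesis using vabs_eq_if_close by fastforce
qed

lemma one_plus_pA_nonzero: "(\<lambda>x. d x - 1) \<in> pA \<Longrightarrow> x \<in> X \<Longrightarrow> d x \<noteq> 0"
  using one_plus_pA_vabs by fastforce

lemma A_one_plus_pA: "(\<lambda>x. d x - 1) \<in> pA \<Longrightarrow> d \<in> A"
  using A_add[OF pA_imp_A A_const[of 1], of "\<lambda>x. d x - 1"] by simp

lemma A_inverse_unit:
  assumes "(\<lambda>x. d x - 1) \<in> pA" shows "(\<lambda>x. 1 / d x) \<in> A"
  using A_inverse[of "\<lambda>x. (d x - 1) / of_nat p"] assms by (simp add: pA_def)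

lemma A_divide_unit: "r \<in> A \<Longrightarrow> (\<lambda>x. d x - 1) \<in> pA \<Longrightarrow> (\<lambda>x. r x / d x) \<in> A"
  using A_mult[OF _ A_inverse_unit, of r d] by simp

lemma pA_divide_unit: "r \<in> pA \<Longrightarrow> (\<lambda>x. d x - 1) \<in> pA \<Longrightarrow> (\<lambda>x. r x / d x) \<in> pA"
  using pA_mult_right[OF _ A_inverse_unit, of r d] by simp

lemma one_plus_pA_inverse:
  assumes "(\<lambda>x. d x - 1) \<in> pA" shows "(\<lambda>x. 1 / d x - 1) \<in> pA"
  by (rule pA_cong[OF pA_divide_unit[OF pA_uminus[OF assms] assms]])
     (simp add: one_plus_pA_nonzero[OF assms] field_simps)

lemma one_plus_pA_mult:
  assumes "(\<lambda>x. d x - 1) \<in> pA" "(\<lambda>x. e x - 1) \<in> pA"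
  shows "(\<lambda>x. d x * e x - 1) \<in> pA"
  using pA_add[OF pA_mult_right[OF assms(1) A_one_plus_pA[OF assms(2)]] assms(2)]
  by (simp add: left_diff_distrib)

lemma one_plus_pA_prod:
  "(\<And>i. i \<in> S \<Longrightarrow> (\<lambda>x. d i x - 1) \<in> pA) \<Longrightarrow> (\<lambda>x. (\<Prod>i\<in>S. d i x) - 1) \<in> pA"
  by (induction S rule: infinite_finite_induct) (auto intro: pA_const_0 one_plus_pA_mult)

definition pro_p_family :: "nat \<Rightarrow> ('x \<Rightarrow> 'k mat) \<Rightarrow> bool" where
  "pro_p_family n g \<longleftrightarrow> (\<forall>x\<in>X. g x \<in> carrier_mat n n) \<and>
     (\<forall>i<n. \<forall>j<n. (\<lambda>x. g x $$ (i,j)) \<in> A) \<and>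
     (\<forall>i j. i < j \<and> j < n \<longrightarrow> (\<lambda>x. g x $$ (i,j)) \<in> pA) \<and>
     (\<forall>i<n. (\<lambda>x. g x $$ (i,i) - 1) \<in> pA)"

lemma pro_p_familyI:
  assumes "\<And>x. x \<in> X \<Longrightarrow> g x \<in> carrier_mat n n"
    and "\<And>i j. j < i \<Longrightarrow> i < n \<Longrightarrow> (\<lambda>x. g x $$ (i,j)) \<in> A"
    and "\<And>i j. i < j \<Longrightarrow> j < n \<Longrightarrow> (\<lambda>x. g x $$ (i,j)) \<in> pA"
    and "\<And>i. i < n \<Longrightarrow> (\<lambda>x. g x $$ (i,i) - 1) \<in> pA"
  shows "pro_p_family n g"
proof -
  have "(\<lambda>x. g x $$ (i,j)) \<in> A" if "i < n" "j < n" for i j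
    using assms that pA_imp_A A_one_plus_pA by (cases i j rule: linorder_cases) auto
  then show ?thesis unfolding pro_p_family_def using assms by auto
qed

lemma pro_p_familyD:
  assumes "pro_p_family n g"
  shows "\<And>x. x \<in> X \<Longrightarrow> g x \<in> carrier_mat n n"
    and "\<And>i j. i < n \<Longrightarrow> j < n \<Longrightarrow> (\<lambda>x. g x $$ (i,j)) \<in> A"
    and "\<And>i j. i < j \<Longrightarrow> j < n \<Longrightarrow> (\<lambda>x. g x $$ (i,j)) \<in> pA"
    and "\<And>i. i < n \<Longrightarrow> (\<lambda>x. g x $$ (i,i) - 1) \<in> pA"
  using assms unfolding pro_p_family_def by auto

lemma pro_p_family_mult:
  assumes g: "pro_p_family n g" and h: "pro_p_family n h"
  shows "pro_p_family n (\<lambda>x. g x * h x)"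
proof (rule pro_p_familyI)
  note gD = pro_p_familyD[OF g] and hD = pro_p_familyD[OF h]
  have idx: "(\<Sum>k<n. g x $$ (i,k) * h x $$ (k,j)) = (g x * h x) $$ (i,j)"
    if "x \<in> X" "i < n" "j < n" for x i j
    using mat_mult_index[of "g x" n "h x" i j] gD(1) hD(1) that by simp
  show "g x * h x \<in> carrier_mat n n" if "x \<in> X" for x
    using gD(1)[OF that] hD(1)[OF that] by simp
  show "(\<lambda>x. (g x * h x) $$ (i,j)) \<in> A" if ij: "j < i" "i < n" for i j
    by (rule A_cong[of "\<lambda>x. \<Sum>k<n. g x $$ (i,k) * h x $$ (k,j)"])
       (use ij in \<open>auto intro!: A_sum A_mult gD(2) hD(2) idx\<close>)
  \<comment> \<open>For i < j every k satisfies i < k or k < j, and for i = j every k other than i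
    does. So each product concerned has a factor above the diagonal.\<close>
  have off: "(\<lambda>x. g x $$ (i,k) * h x $$ (k,j)) \<in> pA" if "i < n" "j < n" "k < n" "i < k \<or> k < j" for i j k
    using that gD hD by (auto intro: pA_mult_left pA_mult_right)
  show "(\<lambda>x. (g x * h x) $$ (i,j)) \<in> pA" if ij: "i < j" "j < n" for i j
    by (rule pA_cong[of "\<lambda>x. \<Sum>k<n. g x $$ (i,k) * h x $$ (k,j)"])
       (use ij in \<open>auto intro!: pA_sum off idx\<close>)
  show "(\<lambda>x. (g x * h x) $$ (i,i) - 1) \<in> pA" if i: "i < n" for i
  proof (rule pA_cong)
    show "(\<lambda>x. (g x $$ (i,i) * h x $$ (i,i) - 1) + (\<Sum>k\<in>{..<n} - {i}. g x $$ (i,k) * h x $$ (k,i))) \<in> pA"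
      using i by (intro pA_add pA_sum off one_plus_pA_mult gD(4) hD(4)) auto
    fix x assume x: "x \<in> X"
    show "(g x $$ (i,i) * h x $$ (i,i) - 1) + (\<Sum>k\<in>{..<n} - {i}. g x $$ (i,k) * h x $$ (k,i))
        = (g x * h x) $$ (i,i) - 1"
      unfolding idx[OF x i i, symmetric] using i by (simp add: sum.remove[of "{..<n}" i])
  qed
qed

lemma A_det:
  assumes "\<And>x. x \<in> X \<Longrightarrow> M x \<in> carrier_mat m m"
    and "\<And>i j. i < m \<Longrightarrow> j < m \<Longrightarrow> (\<lambda>x. M x $$ (i,j)) \<in> A"
  shows "(\<lambda>x. det (M x)) \<in> A"
proof (rule A_cong)
  show "(\<lambda>x. \<Sum>\<pi> | \<pi> permutes {0..<m}. signof \<pi> * (\<Prod>i = 0..<m. M x $$ (i, \<pi> i))) \<in> A"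
  proof (intro A_sum A_mult A_prod A_const signof_Zp)
    fix \<pi> i assume "\<pi> \<in> {\<pi>. \<pi> permutes {0..<m}}" "i \<in> {0..<m}"
    then show "(\<lambda>x. M x $$ (i, \<pi> i)) \<in> A"
      using permutes_in_image[of \<pi> "{0..<m}" i] assms(2) by auto
  qed
qed (simp add: det_def'[OF assms(1)])

text \<open>A permutation other than the identity moves some i to a larger index, so its term in the
  Leibniz formula has a factor above the diagonal. The diagonal entries are arbitrary elements of
  \<open>A\<close>, so that the Iwahori group is covered too.\<close>

lemma det_diag_pA:
  assumes carrier: "\<And>x. x \<in> X \<Longrightarrow> g x \<in> carrier_mat n n"
    and entries: "\<And>i j. i < n \<Longrightarrow> j < n \<Longrightarrow> (\<lambda>x. g x $$ (i,j)) \<in> A"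
    and upper: "\<And>i j. i < j \<Longrightarrow> j < n \<Longrightarrow> (\<lambda>x. g x $$ (i,j)) \<in> pA"
  shows "(\<lambda>x. det (g x) - (\<Prod>i = 0..<n. g x $$ (i,i))) \<in> pA"
proof (rule pA_cong)
  let ?P = "{\<pi>. \<pi> permutes {0..<n}}"
  let ?t = "\<lambda>\<pi> x. signof \<pi> * (\<Prod>i = 0..<n. g x $$ (i, \<pi> i))"
  have trm: "(\<lambda>x. ?t \<pi> x) \<in> pA" if \<pi>: "\<pi> \<in> ?P - {id}" for \<pi>
  proof -
    obtain i where i: "i \<in> {0..<n}" "i < \<pi> i"
      using permutes_natset_le[of \<pi> "{0..<n}"] \<pi> by (metis DiffE mem_Collect_eq not_le singletonI)
    have im: "\<pi> j < n" if "j < n" for j using permutes_in_image[of \<pi> "{0..<n}" j] \<pi> that by auto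
    have "(\<lambda>x. signof \<pi> * (g x $$ (i, \<pi> i) * (\<Prod>j\<in>{0..<n} - {i}. g x $$ (j, \<pi> j)))) \<in> pA"
      using i im by (intro pA_mult_left pA_mult_right A_prod A_const signof_Zp entries upper) auto
    then show ?thesis using i by (simp add: prod.remove[of "{0..<n}" i])
  qed
  show "(\<lambda>x. \<Sum>\<pi>\<in>?P - {id}. ?t \<pi> x) \<in> pA" by (intro pA_sum trm)
  fix x assume x: "x \<in> X"
  have "det (g x) = ?t id x + (\<Sum>\<pi>\<in>?P - {id}. ?t \<pi> x)"
    unfolding det_def'[OF carrier[OF x]]
    by (rule sum.remove) (auto simp: finite_permutations permutes_id)
  then show "(\<Sum>\<pi>\<in>?P - {id}. ?t \<pi> x) = det (g x) - (\<Prod>i = 0..<n. g x $$ (i,i))"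
    by (simp add: sign_id)
qed

lemma pro_p_family_det:
  assumes g: "pro_p_family n g"
  shows "(\<lambda>x. det (g x) - 1) \<in> pA"
proof -
  note gD = pro_p_familyD[OF g]
  have "(\<lambda>x. (\<Prod>i = 0..<n. g x $$ (i,i)) - 1) \<in> pA" by (intro one_plus_pA_prod gD(4)) auto
  from pA_add[OF det_diag_pA[OF gD(1-3)] this] show ?thesis by simp
qed

lemma pro_p_family_minv_props:
  assumes g: "pro_p_family n g" and x: "x \<in> X"
  shows "minv (g x) \<in> carrier_mat n n" "g x * minv (g x) = 1\<^sub>m n" "minv (g x) * g x = 1\<^sub>m n"
  using minv_det[OF pro_p_familyD(1)[OF g x] one_plus_pA_nonzero[OF pro_p_family_det[OF g] x]] by auto

text \<open>Membership of the entries in \<open>A\<close> is Cramer's rule with a determinant in 1 +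
  pA. The shape follows from g g^-1 = 1 by induction on the row i: the terms with k < i lie in pA by
  induction, those with k > i because the entry (i, k) of g does.\<close>

lemma pro_p_family_minv:
  assumes g: "pro_p_family n g"
  shows "pro_p_family n (\<lambda>x. minv (g x))"
proof -
  note gD = pro_p_familyD[OF g] and minvD = pro_p_family_minv_props[OF g]
  have entry: "(\<lambda>x. minv (g x) $$ (i,j)) \<in> A" if ij: "i < n" "j < n" for i j
  proof (rule A_cong)
    have "(\<lambda>x. det (mat_delete (g x) j i)) \<in> A"
    proof (rule A_det[where m = "n - 1"])
      show "mat_delete (g x) j i \<in> carrier_mat (n - 1) (n - 1)" if "x \<in> X" for x
        using gD(1)[OF that] by (rule mat_delete_carrier)
      fix a b assume ab: "a < n - 1" "b < n - 1"
      show "(\<lambda>x. mat_delete (g x) j i $$ (a,b)) \<in> A"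
      proof (rule A_cong)
        show "(\<lambda>x. g x $$ (if a < j then a else Suc a, if b < i then b else Suc b)) \<in> A"
          using ab by (intro gD(2)) auto
        fix x assume "x \<in> X"
        from gD(1)[OF this] have "dim_row (g x) = n" "dim_col (g x) = n" by auto
        then show "g x $$ (if a < j then a else Suc a, if b < i then b else Suc b)
            = mat_delete (g x) j i $$ (a,b)"
          using ab by (simp add: mat_delete_def)
      qed
    qed
    then show "(\<lambda>x. (- 1) ^ (j + i) * det (mat_delete (g x) j i) / det (g x)) \<in> A"
      by (intro A_divide_unit A_mult A_const pro_p_family_det[OF g] Zp_power Zp_uminus Zp_1)
    fix x assume x: "x \<in> X"
    show "(- 1) ^ (j + i) * det (mat_delete (g x) j i) / det (g x) = minv (g x) $$ (i,j)"
      using minv_det(4)[OF gD(1)[OF x] one_plus_pA_nonzero[OF pro_p_family_det[OF g] x] ij]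
      by (simp add: cofactor_def)
  qed
  have shape: "(\<lambda>x. minv (g x) $$ (i,j) - (if i = j then 1 else 0)) \<in> pA" if "i \<le> j" "j < n" for i j
    using that
  proof (induction i arbitrary: j rule: less_induct)
    case (less i)
    have i: "i < n" using less.prems by simp
    have off: "(\<lambda>x. g x $$ (i,k) * minv (g x) $$ (k,j)) \<in> pA" if "k \<in> {..<n} - {i}" for k
    proof (cases "k < i")
      case True
      then have "(\<lambda>x. minv (g x) $$ (k,j)) \<in> pA" using less.IH[of k j] less.prems by simp
      then show ?thesis using that i by (intro pA_mult_left gD(2)) auto
    next
      case False
      then show ?thesis using that less.prems by (intro pA_mult_right gD(3) entry) auto
    qed
    show ?case
    proof (rule pA_cong)
      show "(\<lambda>x. - ((g x $$ (i,i) - 1) * minv (g x) $$ (i,j))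
              - (\<Sum>k\<in>{..<n} - {i}. g x $$ (i,k) * minv (g x) $$ (k,j))) \<in> pA"
        using i less.prems by (intro pA_diff pA_uminus pA_sum off pA_mult_right gD(4) entry)
      fix x assume x: "x \<in> X"
      have "(g x * minv (g x)) $$ (i,j) = (if i = j then 1 else 0)"
        using minvD(2)[OF x] i less.prems by simp
      then have "g x $$ (i,i) * minv (g x) $$ (i,j)
          + (\<Sum>k\<in>{..<n} - {i}. g x $$ (i,k) * minv (g x) $$ (k,j)) = (if i = j then 1 else 0)"
        unfolding mat_mult_index[OF gD(1)[OF x] minvD(1)[OF x] i less.prems(2)]
        using i by (simp add: sum.remove[of "{..<n}" i])
      then show "- ((g x $$ (i,i) - 1) * minv (g x) $$ (i,j))
              - (\<Sum>k\<in>{..<n} - {i}. g x $$ (i,k) * minv (g x) $$ (k,j))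
          = minv (g x) $$ (i,j) - (if i = j then 1 else 0)"
        by (simp add: algebra_simps)
    qed
  qed
  show ?thesis
  proof (rule pro_p_familyI)
    show "(\<lambda>x. minv (g x) $$ (i,j)) \<in> pA" if "i < j" "j < n" for i j
      using shape[of i j] that by simp
    show "(\<lambda>x. minv (g x) $$ (i,i) - 1) \<in> pA" if "i < n" for i
      using shape[of i i] that by simp
  qed (use minvD entry in auto)
qed

lemma pro_p_family_imp_pro_p_Iwahori:
  assumes g: "pro_p_family n g" and x: "x \<in> X"
  shows "g x \<in> pro_p_Iwahori p n"
proof -
  note gD = pro_p_familyD[OF g] and hD = pro_p_familyD[OF pro_p_family_minv[OF g]]
  have "g x \<in> Mat_Zp n" "minv (g x) \<in> Mat_Zp n"
    unfolding Mat_Zp_def using gD(1,2) hD(1,2) A_Zp x by blast+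
  then have "g x \<in> GL_Zp n" unfolding GL_Zp_def using pro_p_family_minv_props[OF g x] by blast
  then show ?thesis unfolding pro_p_Iwahori_def using pA_pZp[OF _ x] gD(3,4) by blast
qed

lemma pro_p_family_const:
  assumes g: "g \<in> pro_p_Iwahori p n"
  shows "pro_p_family n (\<lambda>_. g)"
  using assms unfolding pro_p_Iwahori_def GL_Zp_def Mat_Zp_def
  by (intro pro_p_familyI) (auto simp: pZp_iff pA_def intro!: A_const)

text \<open>A step with pivot c changes the entry (a, b) by the product of the entries (a, c) and
  (c, b) divided by the pivot. If a < b, or if a = b differs from c, then a < c or c < b, so the
  change lies in pA and the pro-p shape survives. The diagonal clause leaves out the pivots already
  used, whose rows have become zero.\<close>

lemma schur_family:
  assumes g: "pro_p_family n g" and \<sigma>: "\<sigma> permutes {..<n}" and k: "k \<le> n"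
  shows "(a < n \<longrightarrow> b < n \<longrightarrow> (\<lambda>x. schur \<sigma> (\<lambda>i j. g x $$ (i,j)) k a b) \<in> A) \<and>
    (a < b \<longrightarrow> b < n \<longrightarrow> (\<lambda>x. schur \<sigma> (\<lambda>i j. g x $$ (i,j)) k a b) \<in> pA) \<and>
    (a < n \<longrightarrow> (\<forall>j<k. a \<noteq> \<sigma> j) \<longrightarrow> (\<lambda>x. schur \<sigma> (\<lambda>i j. g x $$ (i,j)) k a a - 1) \<in> pA)"
  using k
proof (induction k arbitrary: a b)
  case 0
  then show ?case using pro_p_familyD[OF g] by simp
next
  case (Suc k)
  let ?s = "\<lambda>a b x. schur \<sigma> (\<lambda>i j. g x $$ (i,j)) k a b"
  let ?c = "\<sigma> k"
  have IH: "\<And>a b. a < n \<Longrightarrow> b < n \<Longrightarrow> ?s a b \<in> A" "\<And>a b. a < b \<Longrightarrow> b < n \<Longrightarrow> ?s a b \<in> pA"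
      "\<And>a. a < n \<Longrightarrow> (\<forall>j<k. a \<noteq> \<sigma> j) \<Longrightarrow> (\<lambda>x. ?s a a x - 1) \<in> pA"
    using Suc.IH Suc.prems by auto
  have c: "?c < n" using permutes_in_image[OF \<sigma>, of k] Suc.prems by simp
  have "\<forall>j<k. ?c \<noteq> \<sigma> j" using permutes_inj[OF \<sigma>] by (auto dest!: injD)
  then have piv: "(\<lambda>x. ?s ?c ?c x - 1) \<in> pA" using IH(3) c by blast
  have corr: "(\<lambda>x. ?s a ?c x * ?s ?c b x / ?s ?c ?c x) \<in> pA"
    if "a < n" "b < n" "a < ?c \<or> ?c < b" for a b
    using that c IH(1,2) by (auto intro!: pA_divide_unit[OF _ piv] intro: pA_mult_left pA_mult_right)
  show ?case
  proof (intro conjI impI)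
    assume "a < n" "b < n"
    then show "(\<lambda>x. schur \<sigma> (\<lambda>i j. g x $$ (i,j)) (Suc k) a b) \<in> A"
      using c by (auto intro!: A_diff A_divide_unit[OF _ piv] A_mult IH(1))
  next
    assume "a < b" "b < n"
    then show "(\<lambda>x. schur \<sigma> (\<lambda>i j. g x $$ (i,j)) (Suc k) a b) \<in> pA"
      unfolding schur.simps by (intro pA_diff IH(2) corr) auto
  next
    assume a: "a < n" "\<forall>j<Suc k. a \<noteq> \<sigma> j"
    have "(\<lambda>x. (?s a a x - 1) - ?s a ?c x * ?s ?c a x / ?s ?c ?c x) \<in> pA"
      using a by (intro pA_diff IH(3) corr) auto
    then show "(\<lambda>x. schur \<sigma> (\<lambda>i j. g x $$ (i,j)) (Suc k) a a - 1) \<in> pA"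
      by (simp add: algebra_simps)
  qed
qed

lemma schur_pivot:
  assumes g: "pro_p_family n g" and \<sigma>: "\<sigma> permutes {..<n}" and k: "k < n"
  shows "(\<lambda>x. schur \<sigma> (\<lambda>i j. g x $$ (i,j)) k (\<sigma> k) (\<sigma> k) - 1) \<in> pA"
proof -
  have "\<sigma> k < n" "\<forall>j<k. \<sigma> k \<noteq> \<sigma> j"
    using permutes_in_image[OF \<sigma>, of k] k permutes_inj[OF \<sigma>] by (auto dest!: injD)
  then show ?thesis using schur_family[OF g \<sigma>, of k "\<sigma> k"] k by simp
qed

lemma lu_family:
  assumes g: "pro_p_family n g" and \<sigma>: "\<sigma> permutes {..<n}"
  shows "pro_p_family n (\<lambda>x. lu_lower \<sigma> n (g x))" (is ?L)
    and "pro_p_family n (\<lambda>x. lu_upper \<sigma> n (g x))" (is ?U)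
proof -
  let ?s = "\<lambda>k a b x. schur \<sigma> (\<lambda>i j. g x $$ (i,j)) k a b"
  have inv_lt: "inv_into UNIV \<sigma> c < n" if "c < n" for c
    using permutes_in_image[OF permutes_inv[OF \<sigma>], of c] that by simp
  have si: "\<sigma> (inv_into UNIV \<sigma> c) = c" for c using permutes_inverses(1)[OF \<sigma>] .
  have piv: "(\<lambda>x. ?s (inv_into UNIV \<sigma> c) c c x - 1) \<in> pA" if "c < n" for c
    using schur_pivot[OF g \<sigma> inv_lt[OF that]] by (simp add: si)
  note fam = schur_family[OF g \<sigma> less_imp_le[OF inv_lt]]
  have L: "lu_lower \<sigma> n (g x) $$ (a,c) = ?s (inv_into UNIV \<sigma> c) a c x / ?s (inv_into UNIV \<sigma> c) c c x" if "a < n" "c < n" for a c x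
    using that by (simp add: lu_lower_def Let_def)
  have U: "lu_upper \<sigma> n (g x) $$ (c,b) = ?s (inv_into UNIV \<sigma> c) c b x" if "b < n" "c < n" for b c x
    using that by (simp add: lu_upper_def)
  show ?L
  proof (rule pro_p_familyI)
    show "(\<lambda>x. lu_lower \<sigma> n (g x) $$ (i,j)) \<in> A" if "j < i" "i < n" for i j
      using that piv[of j] fam[of j i j] by (simp add: L A_divide_unit)
    show "(\<lambda>x. lu_lower \<sigma> n (g x) $$ (i,j)) \<in> pA" if "i < j" "j < n" for i j
      using that piv[of j] fam[of j i j] by (simp add: L pA_divide_unit)
    show "(\<lambda>x. lu_lower \<sigma> n (g x) $$ (i,i) - 1) \<in> pA" if "i < n" for i
      by (rule pA_cong[OF pA_const_0]) (simp add: L that one_plus_pA_nonzero[OF piv[OF that]])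
  qed simp
  show ?U
  proof (rule pro_p_familyI)
    show "(\<lambda>x. lu_upper \<sigma> n (g x) $$ (i,j)) \<in> A" if "j < i" "i < n" for i j
      using that fam[of i i j] by (simp add: U)
    show "(\<lambda>x. lu_upper \<sigma> n (g x) $$ (i,j)) \<in> pA" if "i < j" "j < n" for i j
      using that fam[of i i j] by (simp add: U)
    show "(\<lambda>x. lu_upper \<sigma> n (g x) $$ (i,i) - 1) \<in> pA" if "i < n" for i
      using that piv[of i] by (simp add: U)
  qed simp
qed

text \<open>After n steps every index has been a pivot, so nothing is left over and the telescoping
  sum is the matrix product. The zero patterns say that, for the two factors M, the matrix w^-1 M w
  is lower unipotent and upper triangular, respectively.\<close>

lemma lu_decomposition:
  assumes g: "pro_p_family n g" and \<sigma>: "\<sigma> permutes {..<n}" and x: "x \<in> X"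
  shows "g x = lu_lower \<sigma> n (g x) * lu_upper \<sigma> n (g x)"
    and "\<And>i. i < n \<Longrightarrow> lu_lower \<sigma> n (g x) $$ (\<sigma> i, \<sigma> i) = 1"
    and "\<And>i j. i < j \<Longrightarrow> j < n \<Longrightarrow> lu_lower \<sigma> n (g x) $$ (\<sigma> i, \<sigma> j) = 0"
    and "\<And>i j. j < i \<Longrightarrow> i < n \<Longrightarrow> lu_upper \<sigma> n (g x) $$ (\<sigma> i, \<sigma> j) = 0"
proof -
  let ?s = "schur \<sigma> (\<lambda>i j. g x $$ (i,j))"
  have lt: "\<sigma> k < n" if "k < n" for k using permutes_in_image[OF \<sigma>, of k] that by simp
  have invs: "inv_into UNIV \<sigma> (\<sigma> c) = c" for c using permutes_inverses(2)[OF \<sigma>] .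
  have piv: "?s k (\<sigma> k) (\<sigma> k) \<noteq> 0" if "k < n" for k
    using one_plus_pA_nonzero[OF schur_pivot[OF g \<sigma> that] x] .
  have elim: "?s k a (\<sigma> j) = 0" "?s k (\<sigma> j) b = 0" if "j < k" "k \<le> n" for j k a b
    using schur_eliminated[of k \<sigma> "\<lambda>i j. g x $$ (i,j)" j a b] piv that by auto
  have L: "lu_lower \<sigma> n (g x) $$ (a, \<sigma> k) = ?s k a (\<sigma> k) / ?s k (\<sigma> k) (\<sigma> k)" if "a < n" "k < n" for a k
    using that lt by (simp add: lu_lower_def Let_def invs)
  have U: "lu_upper \<sigma> n (g x) $$ (\<sigma> k, b) = ?s k (\<sigma> k) b" if "b < n" "k < n" for b k
    using that lt by (simp add: lu_upper_def invs)
  show "lu_lower \<sigma> n (g x) $$ (\<sigma> i, \<sigma> i) = 1" if "i < n" for i using that lt piv by (simp add: L)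
  show "lu_lower \<sigma> n (g x) $$ (\<sigma> i, \<sigma> j) = 0" if "i < j" "j < n" for i j
    using that lt elim by (simp add: L)
  show "lu_upper \<sigma> n (g x) $$ (\<sigma> i, \<sigma> j) = 0" if "j < i" "i < n" for i j
    using that lt elim by (simp add: U)
  show "g x = lu_lower \<sigma> n (g x) * lu_upper \<sigma> n (g x)"
  proof (rule eq_matI)
    fix a b assume "a < dim_row (lu_lower \<sigma> n (g x) * lu_upper \<sigma> n (g x))"
      "b < dim_col (lu_lower \<sigma> n (g x) * lu_upper \<sigma> n (g x))"
    then have ab: "a < n" "b < n" by (auto simp: lu_lower_def lu_upper_def)
    have "a \<in> \<sigma> ` {..<n}" using ab permutes_image[OF \<sigma>] by simp
    then obtain i where "i < n" "a = \<sigma> i" by auto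
    then have "?s n a b = 0" using elim(2)[of i n b] by simp
    then have "g x $$ (a,b) = (\<Sum>k<n. ?s k a (\<sigma> k) * ?s k (\<sigma> k) b / ?s k (\<sigma> k) (\<sigma> k))"
      using schur_telescope[of "\<lambda>i j. g x $$ (i,j)" a b \<sigma> n] by simp
    also have "\<dots> = (\<Sum>k<n. lu_lower \<sigma> n (g x) $$ (a, \<sigma> k) * lu_upper \<sigma> n (g x) $$ (\<sigma> k, b))"
      using ab by (intro sum.cong) (auto simp: L U)
    also have "\<dots> = (\<Sum>c<n. lu_lower \<sigma> n (g x) $$ (a, c) * lu_upper \<sigma> n (g x) $$ (c, b))"
      by (rule sum.permute[OF \<sigma>, symmetric, unfolded o_def])
    also have "\<dots> = (lu_lower \<sigma> n (g x) * lu_upper \<sigma> n (g x)) $$ (a,b)"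
      using ab by (intro mat_mult_index[symmetric]) auto
    finally show "g x $$ (a,b) = (lu_lower \<sigma> n (g x) * lu_upper \<sigma> n (g x)) $$ (a,b)" .
  qed (use pro_p_familyD(1)[OF g x] in \<open>auto simp: lu_lower_def lu_upper_def\<close>)
qed

end

section \<open>The groups attached to a permutation matrix\<close>

definition perm_mat :: "nat \<Rightarrow> (nat \<Rightarrow> nat) \<Rightarrow> 'k::nonarch_field mat" where
  "perm_mat n \<sigma> = mat n n (\<lambda>(i,j). if i = \<sigma> j then 1 else 0)"

lemma perm_mat_carrier [simp]: "perm_mat n \<sigma> \<in> carrier_mat n n"
  by (simp add: perm_mat_def)

lemma minv_perm_mat:
  assumes \<sigma>: "\<sigma> permutes {..<n}"
  shows "minv (perm_mat n \<sigma> :: 'k::nonarch_field mat) = mat n n (\<lambda>(i,j). if j = \<sigma> i then 1 else 0)"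
      (is "minv ?w = ?w'")
    and "perm_mat n \<sigma> * minv (perm_mat n \<sigma>) = (1\<^sub>m n :: 'k mat)"
    and "minv (perm_mat n \<sigma>) * perm_mat n \<sigma> = (1\<^sub>m n :: 'k mat)"
    and "minv (perm_mat n \<sigma> :: 'k mat) \<in> carrier_mat n n"
proof -
  have lt: "\<sigma> k < n" if "k < n" for k using permutes_in_image[OF \<sigma>, of k] that by simp
  have w': "?w' \<in> carrier_mat n n" by simp
  have 1: "?w * ?w' = 1\<^sub>m n"
  proof (rule eq_matI)
    fix i j assume "i < dim_row (1\<^sub>m n :: 'k mat)" "j < dim_col (1\<^sub>m n :: 'k mat)"
    then have ij: "i < n" "j < n" by auto
    have "(?w * ?w') $$ (i,j) = (\<Sum>k<n. (if i = \<sigma> k then 1 else 0) * (if j = \<sigma> k then 1 else 0))"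
      using mat_mult_index[OF perm_mat_carrier w' ij] ij by (simp add: perm_mat_def)
    also have "\<dots> = (\<Sum>k<n. (if i = k then 1 else 0) * (if j = k then 1 else 0))"
      using sum.permute[OF \<sigma>, of "\<lambda>k. (if i = k then 1 else 0) * (if j = k then 1 else 0) :: 'k"]
      by (simp add: o_def)
    also have "\<dots> = (\<Sum>k<n. if k = i then (if i = j then 1 else 0) else 0)"
      by (intro sum.cong) auto
    finally show "(?w * ?w') $$ (i,j) = 1\<^sub>m n $$ (i,j)" using ij by simp
  qed (auto simp: perm_mat_def)
  have 2: "?w' * ?w = 1\<^sub>m n"
  proof (rule eq_matI)
    fix i j assume "i < dim_row (1\<^sub>m n :: 'k mat)" "j < dim_col (1\<^sub>m n :: 'k mat)"
    then have ij: "i < n" "j < n" by auto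
    have "(?w' * ?w) $$ (i,j) = (\<Sum>k<n. (if k = \<sigma> i then 1 else 0) * (if k = \<sigma> j then 1 else 0))"
      using mat_mult_index[OF w' perm_mat_carrier ij, of \<sigma>] ij by (simp add: perm_mat_def)
    also have "\<dots> = (\<Sum>k<n. if k = \<sigma> i then (if \<sigma> i = \<sigma> j then 1 else 0) else 0)"
      by (intro sum.cong) auto
    also have "\<dots> = 1\<^sub>m n $$ (i,j)" using ij lt permutes_inj[OF \<sigma>] by (simp add: inj_eq)
    finally show "(?w' * ?w) $$ (i,j) = 1\<^sub>m n $$ (i,j)" .
  qed (auto simp: perm_mat_def)
  show eq: "minv ?w = ?w'" by (rule minv_eqI[OF perm_mat_carrier w' 1 2])
  show "?w * minv ?w = 1\<^sub>m n" "minv ?w * ?w = 1\<^sub>m n" "minv ?w \<in> carrier_mat n n"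
    unfolding eq using 1 2 w' by auto
qed

lemma perm_conj_index:
  fixes M :: "'k::nonarch_field mat"
  assumes \<sigma>: "\<sigma> permutes {..<n}" and M: "M \<in> carrier_mat n n" and ij: "i < n" "j < n"
  shows "(minv (perm_mat n \<sigma>) * M * perm_mat n \<sigma>) $$ (i,j) = M $$ (\<sigma> i, \<sigma> j)"
proof -
  let ?w = "perm_mat n \<sigma> :: 'k mat"
  note w = minv_perm_mat[OF \<sigma>, where 'k = 'k]
  have lt: "\<sigma> k < n" if "k < n" for k using permutes_in_image[OF \<sigma>, of k] that by simp
  have left: "(minv ?w * M) $$ (i,b) = M $$ (\<sigma> i, b)" if "b < n" for b
  proof -
    have "(minv ?w * M) $$ (i,b) = (\<Sum>k<n. (if k = \<sigma> i then M $$ (k,b) else 0))"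
      unfolding mat_mult_index[OF w(4) M ij(1) that] unfolding w(1)
      using ij by (intro sum.cong) auto
    then show ?thesis using lt ij by simp
  qed
  have widx: "?w $$ (k,j) = (if k = \<sigma> j then 1 else 0)" if "k < n" for k
    using that ij by (simp add: perm_mat_def)
  have "(minv ?w * M * ?w) $$ (i,j) = (\<Sum>k<n. (if k = \<sigma> j then M $$ (\<sigma> i, k) else 0))"
    unfolding mat_mult_index[OF mult_carrier_mat[OF w(4) M] perm_mat_carrier ij]
    using ij by (intro sum.cong) (auto simp: left widx)
  then show ?thesis using lt ij by simp
qed

lemma perm_conj_cancel:
  fixes M :: "'k::nonarch_field mat"
  assumes \<sigma>: "\<sigma> permutes {..<n}" and M: "M \<in> carrier_mat n n"
  shows "minv (perm_mat n \<sigma>) * (perm_mat n \<sigma> * M * minv (perm_mat n \<sigma>)) * perm_mat n \<sigma> = M"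
    and "perm_mat n \<sigma> * (minv (perm_mat n \<sigma>) * M * perm_mat n \<sigma>) * minv (perm_mat n \<sigma>) = M"
proof -
  let ?w = "perm_mat n \<sigma> :: 'k mat"
  note w = minv_perm_mat[OF \<sigma>, where 'k = 'k]
  have "minv ?w * (?w * M * minv ?w) * ?w = (minv ?w * ?w) * M * (minv ?w * ?w)"
    using w(4) M by (simp add: assoc_mult_mat[of _ n n _ n _ n] mult_carrier_mat[of _ n n _ n])
  then show "minv ?w * (?w * M * minv ?w) * ?w = M" using M w by simp
  have "?w * (minv ?w * M * ?w) * minv ?w = (?w * minv ?w) * M * (?w * minv ?w)"
    using w(4) M by (simp add: assoc_mult_mat[of _ n n _ n _ n] mult_carrier_mat[of _ n n _ n])
  then show "?w * (minv ?w * M * ?w) * minv ?w = M" using M w by simp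
qed

lemma GL_Zp_carrier: "g \<in> GL_Zp n \<Longrightarrow> g \<in> carrier_mat n n"
  by (auto simp: GL_Zp_def Mat_Zp_def)

lemma Iwahori_carrier: "g \<in> Iwahori p n \<Longrightarrow> g \<in> carrier_mat n n"
  by (auto simp: Iwahori_def GL_Zp_carrier)

lemma Mat_Zp_mult: "g \<in> Mat_Zp n \<Longrightarrow> h \<in> Mat_Zp n \<Longrightarrow> g * h \<in> Mat_Zp n"
  unfolding Mat_Zp_def by (auto simp: mat_mult_index simp del: index_mult_mat(1) intro!: Zp_sum Zp_mult)

lemma GL_Zp_mult:
  assumes "g \<in> GL_Zp n" "h \<in> GL_Zp n" shows "g * h \<in> GL_Zp n"
proof -
  obtain g' h' where inv: "g' \<in> Mat_Zp n" "g * g' = 1\<^sub>m n" "g' * g = 1\<^sub>m n"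
      "h' \<in> Mat_Zp n" "h * h' = 1\<^sub>m n" "h' * h = 1\<^sub>m n" and gh: "g \<in> Mat_Zp n" "h \<in> Mat_Zp n"
    using assms by (auto simp: GL_Zp_def)
  have c: "g \<in> carrier_mat n n" "h \<in> carrier_mat n n" "g' \<in> carrier_mat n n" "h' \<in> carrier_mat n n"
    using gh inv by (auto simp: Mat_Zp_def)
  have "g * h * (h' * g') = g * (h * h') * g'"
    using c by (simp add: assoc_mult_mat[of _ n n _ n _ n] mult_carrier_mat[of _ n n _ n])
  moreover have "h' * g' * (g * h) = h' * (g' * g) * h"
    using c by (simp add: assoc_mult_mat[of _ n n _ n _ n] mult_carrier_mat[of _ n n _ n])
  ultimately have "g * h * (h' * g') = 1\<^sub>m n" "h' * g' * (g * h) = 1\<^sub>m n"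
    using c inv by simp_all
  then show ?thesis unfolding GL_Zp_def using Mat_Zp_mult gh inv by blast
qed

lemma perm_conj_GL_Zp:
  assumes \<sigma>: "\<sigma> permutes {..<n}" and b: "b \<in> GL_Zp n"
  shows "minv (perm_mat n \<sigma>) * b * perm_mat n \<sigma> \<in> GL_Zp n"
proof -
  have "(perm_mat n \<sigma> :: 'a mat) \<in> Mat_Zp n" by (auto simp: Mat_Zp_def perm_mat_def)
  moreover have "(minv (perm_mat n \<sigma>) :: 'a mat) \<in> Mat_Zp n"
    unfolding minv_perm_mat(1)[OF \<sigma>] by (auto simp: Mat_Zp_def)
  ultimately have "(perm_mat n \<sigma> :: 'a mat) \<in> GL_Zp n" "(minv (perm_mat n \<sigma>) :: 'a mat) \<in> GL_Zp n"
    unfolding GL_Zp_def using minv_perm_mat(2,3)[OF \<sigma>, where 'k = 'a] by auto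
  then show ?thesis using b by (intro GL_Zp_mult)
qed

text \<open>Conjugation by w renames indices, which allows the LU factors to be recognised by their
  entries alone.\<close>

lemma Uw_iff:
  assumes \<sigma>: "\<sigma> permutes {..<n}"
  shows "u \<in> Uw p n (perm_mat n \<sigma>) \<longleftrightarrow> u \<in> Iwahori p n \<and> (\<forall>i<n. u $$ (\<sigma> i, \<sigma> i) = 1) \<and>
    (\<forall>i j. i < j \<and> j < n \<longrightarrow> u $$ (\<sigma> i, \<sigma> j) = 0)" (is "?L \<longleftrightarrow> ?R")
proof
  let ?w = "perm_mat n \<sigma>"
  assume ?L
  then obtain h where u: "u \<in> Iwahori p n" and h: "h \<in> lower_unipotent n" "u = ?w * h * minv ?w"
    by (auto simp: Uw_def conj_set_def)
  have hc: "h \<in> carrier_mat n n" using h by (auto simp: lower_unipotent_def Mat_Zp_def)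
  have "u $$ (\<sigma> i, \<sigma> j) = h $$ (i,j)" if "i < n" "j < n" for i j
    using perm_conj_index[OF \<sigma> Iwahori_carrier[OF u] that] perm_conj_cancel(1)[OF \<sigma> hc] h(2) by simp
  then show ?R using u h(1) by (auto simp: lower_unipotent_def)
next
  let ?w = "perm_mat n \<sigma>"
  assume R: ?R
  then have uc: "u \<in> carrier_mat n n" by (auto intro: Iwahori_carrier)
  define h where "h = minv ?w * u * ?w"
  have idx: "h $$ (i,j) = u $$ (\<sigma> i, \<sigma> j)" if "i < n" "j < n" for i j
    unfolding h_def by (rule perm_conj_index[OF \<sigma> uc that])
  have "h \<in> GL_Zp n" unfolding h_def using R by (intro perm_conj_GL_Zp[OF \<sigma>]) (auto simp: Iwahori_def)
  then have "h \<in> lower_unipotent n" using R by (auto simp: lower_unipotent_def GL_Zp_def idx)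
  moreover have "u = ?w * h * minv ?w" unfolding h_def using perm_conj_cancel(2)[OF \<sigma> uc] by simp
  ultimately show ?L using R by (auto simp: Uw_def conj_set_def)
qed

lemma Pw_I:
  assumes \<sigma>: "\<sigma> permutes {..<n}" and b: "b \<in> Iwahori p n"
    and zero: "\<And>i j. j < i \<Longrightarrow> i < n \<Longrightarrow> b $$ (\<sigma> i, \<sigma> j) = 0"
  shows "b \<in> Pw p n (perm_mat n \<sigma>)"
proof -
  let ?w = "perm_mat n \<sigma>"
  have bc: "b \<in> carrier_mat n n" using b by (rule Iwahori_carrier)
  define h where "h = minv ?w * b * ?w"
  have h: "h \<in> GL_Zp n" unfolding h_def using b by (intro perm_conj_GL_Zp[OF \<sigma>]) (auto simp: Iwahori_def)
  have "h $$ (i,j) = 0" if "j < i" "i < n" for i j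
    unfolding h_def using perm_conj_index[OF \<sigma> bc, of i j] zero that by simp
  then have "h \<in> upper_borel n" using h GL_Zp_carrier[OF h] by (auto simp: upper_borel_def upper_triangular_def)
  moreover have "b = ?w * h * minv ?w" unfolding h_def using perm_conj_cancel(2)[OF \<sigma> bc] by simp
  ultimately show ?thesis using b by (auto simp: Pw_def conj_set_def)
qed

lemma Pw_Iwahori: "b \<in> Pw p n w \<Longrightarrow> b \<in> Iwahori p n"
  and Uw_Iwahori: "u \<in> Uw p n w \<Longrightarrow> u \<in> Iwahori p n"
  by (auto simp: Pw_def Uw_def)

lemma Uw_pos_iff:
  assumes \<sigma>: "\<sigma> permutes {..<n}"
  shows "(a,b) \<in> Uw_pos n (perm_mat n \<sigma> :: 'k::nonarch_field mat) \<longleftrightarrow> (\<exists>i j. j < i \<and> i < n \<and> a = \<sigma> i \<and> b = \<sigma> j)"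
proof -
  have lt: "\<sigma> k < n" if "k < n" for k using permutes_in_image[OF \<sigma>, of k] that by simp
  have idx: "(perm_mat n \<sigma> :: 'k mat) $$ (a,i) = 1 \<longleftrightarrow> a = \<sigma> i" if "a < n" "i < n" for a i
    using that by (simp add: perm_mat_def)
  have "a < n \<and> b < n \<and> j < i \<and> i < n \<and> (perm_mat n \<sigma> :: 'k mat) $$ (a,i) = 1 \<and>
      (perm_mat n \<sigma> :: 'k mat) $$ (b,j) = 1 \<longleftrightarrow> j < i \<and> i < n \<and> a = \<sigma> i \<and> b = \<sigma> j" for i j
    using idx[of a i] idx[of b j] lt[of i] lt[of j] by auto
  then show ?thesis unfolding Uw_pos_def by blast
qed

lemma Uw_pos_bounds:
  assumes \<sigma>: "\<sigma> permutes {..<n}" and ab: "(a,b) \<in> Uw_pos n (perm_mat n \<sigma> :: 'k::nonarch_field mat)"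
  shows "a < n" "b < n" "a \<noteq> b"
  using ab Uw_pos_iff[OF \<sigma>, of a b, where 'k = 'k] permutes_inj[OF \<sigma>]
  by (auto simp: Uw_pos_def dest: injD)

lemma finite_Uw_pos: "finite (Uw_pos n w)"
  by (rule finite_subset[of _ "{..<n} \<times> {..<n}"]) (auto simp: Uw_pos_def)

text \<open>In the order \<sigma> the matrix b is upper triangular with nonzero diagonal. So is its
  inverse, with the reciprocals on the diagonal, and the character sees nothing else.\<close>

lemma char_w_minv:
  assumes \<sigma>: "\<sigma> permutes {..<n}" and b: "b \<in> carrier_mat n n"
    and inv: "minv b \<in> carrier_mat n n" "minv b * b = 1\<^sub>m n"
    and zero: "\<And>i j. j < i \<Longrightarrow> i < n \<Longrightarrow> b $$ (\<sigma> i, \<sigma> j) = 0"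
    and diag: "\<And>i. i < n \<Longrightarrow> b $$ (\<sigma> i, \<sigma> i) \<noteq> 0"
  shows "char_w n \<chi> (perm_mat n \<sigma>) (minv b) = (\<Prod>i<n. \<chi> i (1 / b $$ (\<sigma> i, \<sigma> i)))"
proof -
  let ?B = "\<lambda>i j. minv b $$ (\<sigma> i, \<sigma> j)"
  have lt: "\<sigma> k < n" if "k < n" for k using permutes_in_image[OF \<sigma>, of k] that by simp
  \<comment> \<open>The sum stops at \<open>j\<close> because the column \<sigma> j of b vanishes at
    \<sigma> l for l > j; this lets the equations be solved column by column.\<close>
  have prod: "(\<Sum>l<Suc j. ?B i l * b $$ (\<sigma> l, \<sigma> j)) = (if i = j then 1 else 0)" if ij: "i < n" "j < n" for i j
  proof -
    have "(\<Sum>l<Suc j. ?B i l * b $$ (\<sigma> l, \<sigma> j)) = (\<Sum>l<n. ?B i l * b $$ (\<sigma> l, \<sigma> j))"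
      using ij zero by (intro sum.mono_neutral_left) auto
    also have "\<dots> = (\<Sum>l<n. minv b $$ (\<sigma> i, l) * b $$ (l, \<sigma> j))"
      by (rule sum.permute[OF \<sigma>, symmetric, unfolded o_def])
    also have "\<dots> = (minv b * b) $$ (\<sigma> i, \<sigma> j)"
      using inv b ij lt by (intro mat_mult_index[symmetric]) auto
    also have "\<dots> = (if i = j then 1 else 0)"
      unfolding inv(2) using ij lt permutes_inj[OF \<sigma>] by (simp add: inj_eq)
    finally show ?thesis .
  qed
  have low: "?B i j = 0" if "j < i" "i < n" for i j
    using that
  proof (induction j rule: less_induct)
    case (less j)
    have "(\<Sum>l<j. ?B i l * b $$ (\<sigma> l, \<sigma> j)) = 0"
      using less by (intro sum.neutral) auto
    then show ?case using prod[of i j] less.prems diag[of j] by simp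
  qed
  have "?B i i = 1 / b $$ (\<sigma> i, \<sigma> i)" if "i < n" for i
  proof -
    have "(\<Sum>l<i. ?B i l * b $$ (\<sigma> l, \<sigma> i)) = 0"
      using low that by (intro sum.neutral) auto
    then show ?thesis using prod[OF that that] diag[OF that] by (simp add: field_simps)
  qed
  then show ?thesis
    unfolding char_w_def by (intro prod.cong) (auto simp: perm_conj_index[OF \<sigma> inv(1)])
qed

section \<open>Elements of the Iwahori group\<close>

context padic_base
begin

lemma pZp_add: "(x::'k) \<in> pZp p \<Longrightarrow> y \<in> pZp p \<Longrightarrow> x + y \<in> pZp p"
  unfolding pZp_iff by (simp add: add_divide_distrib Zp_add)

lemma pZp_0: "(0::'k) \<in> pZp p"
  by (simp add: pZp_iff)

lemma pZp_sum: "(\<And>i. i \<in> S \<Longrightarrow> (f i :: 'k) \<in> pZp p) \<Longrightarrow> (\<Sum>i\<in>S. f i) \<in> pZp p"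
  by (induction S rule: infinite_finite_induct) (auto intro: pZp_add simp: pZp_0)

lemma pZp_mult: "(x::'k) \<in> Zp \<Longrightarrow> y \<in> pZp p \<Longrightarrow> x * y \<in> pZp p" "(x::'k) \<in> pZp p \<Longrightarrow> y \<in> Zp \<Longrightarrow> x * y \<in> pZp p"
  unfolding pZp_iff using Zp_mult[of x "y / of_nat p"] Zp_mult[of "x / of_nat p" y] by auto

lemma Iwahori_mult:
  assumes "(g :: 'k mat) \<in> Iwahori p n" "h \<in> Iwahori p n"
  shows "g * h \<in> Iwahori p n"
proof -
  have gh: "g \<in> GL_Zp n" "h \<in> GL_Zp n"
    and up: "\<And>i j. i < j \<Longrightarrow> j < n \<Longrightarrow> g $$ (i,j) \<in> pZp p" "\<And>i j. i < j \<Longrightarrow> j < n \<Longrightarrow> h $$ (i,j) \<in> pZp p"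
    using assms by (auto simp: Iwahori_def)
  have ent: "g $$ (i,j) \<in> Zp" "h $$ (i,j) \<in> Zp" if "i < n" "j < n" for i j
    using gh that by (auto simp: GL_Zp_def Mat_Zp_def)
  have "(g * h) $$ (i,j) \<in> pZp p" if ij: "i < j" "j < n" for i j
  proof -
    have "g $$ (i,k) * h $$ (k,j) \<in> pZp p" if k: "k < n" for k
    proof (cases "i < k")
      case True
      then show ?thesis using k ij by (intro pZp_mult(2) up(1) ent(2))
    next
      case False
      then show ?thesis using k ij by (intro pZp_mult(1) up(2) ent(1)) auto
    qed
    then show ?thesis
      using mat_mult_index[OF GL_Zp_carrier[OF gh(1)] GL_Zp_carrier[OF gh(2)], of i j] ij
        pZp_sum[of "{..<n}" "\<lambda>k. g $$ (i,k) * h $$ (k,j)"]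
      by (simp del: index_mult_mat(1))
  qed
  then show ?thesis using GL_Zp_mult[OF gh] by (auto simp: Iwahori_def)
qed

lemma pro_p_Iwahori_subset: "g \<in> pro_p_Iwahori p n \<Longrightarrow> g \<in> Iwahori p n"
  by (auto simp: pro_p_Iwahori_def Iwahori_def)

lemma zp_algebra_all:
  fixes X :: "'x set"
  shows "zp_algebra p X {r. \<forall>x\<in>X. (r x :: 'k) \<in> Zp}"
proof unfold_locales
  fix r :: "'x \<Rightarrow> 'k" assume r: "r \<in> {r. \<forall>x\<in>X. r x \<in> Zp}"
  have "vabs (1 + of_nat p * r x) = 1" if "x \<in> X" for x
  proof -
    have "vabs (r x) < real p" using r that vabs_Zp[of "r x"] p_ge_2 by auto
    then have "vabs ((1 + of_nat p * r x) - 1) < vabs (1::'k)"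
      using p_ge_2 by (simp add: vabs_mult vabs_p)
    then show ?thesis using vabs_eq_if_close by fastforce
  qed
  then show "(\<lambda>x. 1 / (1 + of_nat p * r x)) \<in> {r. \<forall>x\<in>X. r x \<in> Zp}"
    using r by (auto intro!: Zp_divide Zp_add Zp_mult)
qed (auto intro: Zp_add Zp_mult)

text \<open>The determinant is a unit and differs from the product of the diagonal entries by an
  element of pZ_p. So this product has absolute value 1, while none of its factors exceeds
  1.\<close>

lemma Iwahori_diag_unit:
  assumes g: "(g :: 'k mat) \<in> Iwahori p n" and i: "i < n"
  shows "vabs (g $$ (i,i)) = 1"
proof -
  interpret Z: zp_algebra p ty "UNIV :: unit set" "{r. \<forall>x\<in>UNIV. r x \<in> Zp}" by (rule zp_algebra_all)
  obtain g' where g': "g' \<in> Mat_Zp n" "g * g' = 1\<^sub>m n" and gM: "g \<in> Mat_Zp n"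
    using g by (auto simp: Iwahori_def GL_Zp_def)
  have c: "g \<in> carrier_mat n n" "g' \<in> carrier_mat n n" using gM g' by (auto simp: Mat_Zp_def)
  have dZ: "det M \<in> Zp" if "M \<in> Mat_Zp n" for M :: "'k mat"
    using Z.A_det[of "\<lambda>_. M" n] that by (auto simp: Mat_Zp_def)
  have "det g * det g' = 1" using det_mult[OF c] g'(2) by simp
  then have "vabs (det g) * vabs (det g') = 1" by (metis vabs_mult vabs_one)
  moreover have "vabs (det g) \<le> 1" "vabs (det g') \<le> 1" using dZ gM g'(1) vabs_Zp by auto
  ultimately have det1: "vabs (det g) = 1"
    by (smt (verit) mult_left_le vabs_nonneg)
  have "(\<lambda>_. g $$ (i,j)) \<in> Z.pA" if "i < j" "j < n" for i j
    unfolding Z.pA_def using g that by (auto simp: Iwahori_def pZp_iff)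
  then have "(\<lambda>_. det g - (\<Prod>i = 0..<n. g $$ (i,i))) \<in> Z.pA"
    using gM c by (intro Z.det_diag_pA) (auto simp: Mat_Zp_def)
  then have "det g - (\<Prod>i = 0..<n. g $$ (i,i)) \<in> pZp p" using Z.pA_pZp by blast
  then obtain y where y: "y \<in> Zp" "det g - (\<Prod>i = 0..<n. g $$ (i,i)) = of_nat p * y" by (auto simp: pZp_def)
  have "vabs (det g - (\<Prod>i = 0..<n. g $$ (i,i))) < 1"
    unfolding y(2) using vabs_Zp[OF y(1)] p_ge_2 by (simp add: vabs_mult vabs_p)
  then have "vabs ((\<Prod>i = 0..<n. g $$ (i,i)) - det g) < vabs (det g)"
    unfolding det1 by (metis minus_diff_eq vabs_minus)
  then have "vabs (\<Prod>i = 0..<n. g $$ (i,i)) = 1" using det1 vabs_eq_if_close by metis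
  then have 1: "vabs (g $$ (i,i)) * (\<Prod>j\<in>{0..<n} - {i}. vabs (g $$ (j,j))) = 1"
    using i by (simp add: vabs_mult vabs_prod prod.remove[of "{0..<n}" i])
  have le: "vabs (g $$ (j,j)) \<le> 1" if "j < n" for j using gM that vabs_Zp by (auto simp: Mat_Zp_def)
  have "(\<Prod>j\<in>{0..<n} - {i}. vabs (g $$ (j,j))) \<le> 1" using le by (intro prod_le_1) auto
  then have "vabs (g $$ (i,i)) \<ge> 1"
    using 1 mult_left_le[of "\<Prod>j\<in>{0..<n} - {i}. vabs (g $$ (j,j))" "vabs (g $$ (i,i))"] by simp
  then show ?thesis using le[OF i] by simp
qed

text \<open>Dividing the columns by the diagonal entries of g splits off a diagonal matrix in P_w^+
  and leaves g with diagonal 1. The second claim concerns a general \<open>M\<close> because it is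
  also applied to all points of a neighbourhood of g, with the same diagonal factor.\<close>

lemma diag_factor:
  assumes g: "(g :: 'k mat) \<in> Iwahori p n" and \<sigma>: "\<sigma> permutes {..<n}"
  shows "mat_diag n (\<lambda>i. g $$ (i,i)) \<in> Pw p n (perm_mat n \<sigma>)"
    and "M \<in> carrier_mat n n \<Longrightarrow>
      M = mat n n (\<lambda>(i,j). M $$ (i,j) / g $$ (j,j)) * mat_diag n (\<lambda>i. g $$ (i,i))"
proof -
  note unit = Iwahori_diag_unit[OF g]
  have gZ: "g $$ (i,i) \<in> Zp" if "i < n" for i using g that by (auto simp: Iwahori_def GL_Zp_def Mat_Zp_def)
  have nz: "g $$ (i,i) \<noteq> 0" if "i < n" for i using unit[OF that] by auto
  let ?D = "mat_diag n (\<lambda>i. g $$ (i,i))"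
  have "?D * mat_diag n (\<lambda>i. 1 / g $$ (i,i)) = 1\<^sub>m n" "mat_diag n (\<lambda>i. 1 / g $$ (i,i)) * ?D = 1\<^sub>m n"
    unfolding mat_diag_diag using nz by (auto simp: mat_diag_def intro!: eq_matI)
  moreover have "?D \<in> Mat_Zp n" "mat_diag n (\<lambda>i. 1 / g $$ (i,i)) \<in> Mat_Zp n"
    using gZ unit by (auto simp: Mat_Zp_def mat_diag_def intro: Zp_divide)
  ultimately have "?D \<in> GL_Zp n" unfolding GL_Zp_def by blast
  then have "?D \<in> Iwahori p n" by (auto simp: Iwahori_def mat_diag_def pZp_iff)
  then show "?D \<in> Pw p n (perm_mat n \<sigma>)"
  proof (rule Pw_I[OF \<sigma>])
    fix i j assume ij: "j < i" "i < n"
    have "\<sigma> i \<noteq> \<sigma> j" using ij permutes_inj[OF \<sigma>] by (auto dest: injD)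
    then show "?D $$ (\<sigma> i, \<sigma> j) = 0"
      using ij permutes_in_image[OF \<sigma>, of i] permutes_in_image[OF \<sigma>, of j] by (simp add: mat_diag_def)
  qed
  assume M: "M \<in> carrier_mat n n"
  show "M = mat n n (\<lambda>(i,j). M $$ (i,j) / g $$ (j,j)) * ?D"
    by (subst mat_diag_mult_right[of _ n n]) (use M nz in \<open>auto intro!: eq_matI\<close>)
qed

end

section \<open>Generic elements of G and of U_w as pro-p families\<close>

context zp_algebra
begin

lemma pro_p_family_one: "pro_p_family n (\<lambda>_. 1\<^sub>m n)"
  by (rule pro_p_familyI) (auto simp: A_const pA_const_0)

lemma pro_p_family_elementary_product:
  assumes "\<And>i j. (i,j) \<in> set ps \<Longrightarrow> i < n \<and> j < n \<and> i \<noteq> j \<and> (\<lambda>x. y x (i,j)) \<in> A \<and> (i < j \<longrightarrow> (\<lambda>x. y x (i,j)) \<in> pA)"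
  shows "pro_p_family n (\<lambda>x. elementary_product n (y x) ps)"
  using assms
proof (induction ps)
  case Nil
  then show ?case by (simp add: elementary_product_def pro_p_family_one)
next
  case (Cons ij ps)
  obtain k l where kl: "ij = (k,l)" by fastforce
  have y: "k < n" "l < n" "k \<noteq> l" "(\<lambda>x. y x (k,l)) \<in> A" "k < l \<Longrightarrow> (\<lambda>x. y x (k,l)) \<in> pA"
    using Cons.prems[of k l] kl by auto
  have "pro_p_family n (\<lambda>x. addrow_mat n (y x (k,l)) k l)"
  proof (rule pro_p_familyI)
    show "(\<lambda>x. addrow_mat n (y x (k,l)) k l $$ (i,j)) \<in> A" if "j < i" "i < n" for i j
      using that y by (cases "k = i \<and> l = j") (auto simp: A_const)
    show "(\<lambda>x. addrow_mat n (y x (k,l)) k l $$ (i,j)) \<in> pA" if "i < j" "j < n" for i j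
      using that y by (cases "k = i \<and> l = j") (auto simp: pA_const_0)
    show "(\<lambda>x. addrow_mat n (y x (k,l)) k l $$ (i,i) - 1) \<in> pA" if "i < n" for i
      using that y by (cases "k = i") (auto simp: pA_const_0)
  qed simp
  moreover have "pro_p_family n (\<lambda>x. elementary_product n (y x) ps)"
    using Cons.prems by (intro Cons.IH) auto
  ultimately show ?case
    using pro_p_family_mult by (fastforce simp: elementary_product_def kl)
qed

lemma pro_p_family_G_point:
  assumes z: "\<And>ij. ij \<in> all_pos n \<Longrightarrow> (\<lambda>x. z x ij) \<in> A"
    and "set lo = {(i,j). j < i \<and> i < n}" "set up = {(i,j). i < j \<and> j < n}"
  shows "pro_p_family n (\<lambda>x. G_point p n lo up (z x))"
  unfolding G_point_def
proof (intro pro_p_family_mult)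
  show "pro_p_family n (\<lambda>x. elementary_product n (z x) lo)"
    using assms by (intro pro_p_family_elementary_product) (auto simp: all_pos_def)
  show "pro_p_family n (\<lambda>x. elementary_product n (\<lambda>ij. of_nat p * z x ij) up)"
  proof (rule pro_p_family_elementary_product)
    fix i j assume "(i,j) \<in> set up"
    then have ij: "i < j" "j < n" using assms(3) by auto
    then have "(\<lambda>x. of_nat p * z x (i,j)) \<in> pA" using z by (intro pA_p_mult) (auto simp: all_pos_def)
    then show "i < n \<and> j < n \<and> i \<noteq> j \<and> (\<lambda>x. of_nat p * z x (i,j)) \<in> A \<and>
        (i < j \<longrightarrow> (\<lambda>x. of_nat p * z x (i,j)) \<in> pA)"
      using ij pA_imp_A by auto
  qed
  show "pro_p_family n (\<lambda>x. mat_diag n (\<lambda>i. 1 + of_nat p * z x (i,i)))"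
    using z by (intro pro_p_familyI) (auto simp: mat_diag_def A_const pA_const_0 all_pos_def intro!: pA_p_mult)
qed

text \<open>An entry off the diagonal either is a coordinate, up to the factor p above the diagonal,
  or vanishes identically on \<open>X\<close>; the diagonal entries are 1.\<close>

lemma pro_p_family_Uw:
  assumes \<sigma>: "\<sigma> permutes {..<n}"
    and u: "\<And>x. x \<in> X \<Longrightarrow> u x \<in> Uw p n (perm_mat n \<sigma>)"
    and crd: "\<And>ij. ij \<in> Uw_pos n (perm_mat n \<sigma> :: 'k mat) \<Longrightarrow> (\<lambda>x. Uw_crd p (u x) ij) \<in> A"
  shows "pro_p_family n u"
proof -
  have uD: "\<And>i. i < n \<Longrightarrow> u x $$ (\<sigma> i, \<sigma> i) = 1" "\<And>i j. i < j \<Longrightarrow> j < n \<Longrightarrow> u x $$ (\<sigma> i, \<sigma> j) = 0"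
    if "x \<in> X" for x using u[OF that] unfolding Uw_iff[OF \<sigma>] by auto
  have onto: "\<exists>i<n. a = \<sigma> i" if "a < n" for a
  proof -
    have "a \<in> \<sigma> ` {..<n}" using that permutes_image[OF \<sigma>] by simp
    then show ?thesis by auto
  qed
  have off: "(a,b) \<in> Uw_pos n (perm_mat n \<sigma> :: 'k mat) \<or> (\<forall>x\<in>X. u x $$ (a,b) = 0)"
    if ab: "a < n" "b < n" "a \<noteq> b" for a b
  proof -
    obtain i j where ij: "i < n" "j < n" "a = \<sigma> i" "b = \<sigma> j"
      using onto[OF ab(1)] onto[OF ab(2)] by auto
    then have "i \<noteq> j" using ab by auto
    then consider "i < j" | "j < i" by linarith
    then show ?thesis
    proof cases
      case 1
      then show ?thesis using ij uD(2) by auto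
    next
      case 2
      then show ?thesis using ij Uw_pos_iff[OF \<sigma>, of a b, where 'k = 'k] by blast
    qed
  qed
  show ?thesis
  proof (rule pro_p_familyI)
    show "u x \<in> carrier_mat n n" if "x \<in> X" for x
      using u[OF that] by (intro Iwahori_carrier Uw_Iwahori)
    show "(\<lambda>x. u x $$ (i,j)) \<in> A" if "j < i" "i < n" for i j
    proof (cases "(i,j) \<in> Uw_pos n (perm_mat n \<sigma> :: 'k mat)")
      case True
      then show ?thesis using crd[OF True] that by (simp add: Uw_crd_def)
    next
      case False
      then have "\<forall>x\<in>X. u x $$ (i,j) = 0" using off[of i j] that by auto
      then show ?thesis by (intro A_cong[OF A_const[OF Zp_0]]) auto
    qed
    show "(\<lambda>x. u x $$ (i,j)) \<in> pA" if "i < j" "j < n" for i j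
    proof (cases "(i,j) \<in> Uw_pos n (perm_mat n \<sigma> :: 'k mat)")
      case True
      then show ?thesis using crd[OF True] that by (simp add: Uw_crd_def pA_def)
    next
      case False
      then have "\<forall>x\<in>X. u x $$ (i,j) = 0" using off[of i j] that by auto
      then show ?thesis by (intro pA_cong[OF pA_const_0]) auto
    qed
    show "(\<lambda>x. u x $$ (i,i) - 1) \<in> pA" if "i < n" for i
      by (rule pA_cong[OF pA_const_0]) (use onto[OF that] uD(1) in auto)
  qed
qed

lemma pro_p_family_Uw_crd:
  assumes g: "pro_p_family n g" and "ij \<in> Uw_pos n (w :: 'k mat)" "fst ij \<noteq> snd ij"
  shows "(\<lambda>x. Uw_crd p (g x) ij) \<in> A"
proof -
  obtain i j where ij: "ij = (i,j)" by fastforce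
  then have "i < n" "j < n" "i \<noteq> j" using assms(2,3) by (auto simp: Uw_pos_def)
  then show ?thesis
    using pro_p_familyD(2,3)[OF g, of i j] by (cases "i < j") (auto simp: ij Uw_crd_def pA_def)
qed

end

section \<open>Analyticity of the translation action\<close>

context tate_space
begin

text \<open>Coefficients in K bounded by 1 only give values in the ring of integers of K. The groups
  and the formula for \<open>\<chi> i\<close> on 1 + pZ_p require values in Z_p, so this is imposed
  on the values.\<close>

definition tate_Zp :: "('x \<Rightarrow> 'k) set" where
  "tate_Zp = {r \<in> tate_ball. \<forall>x\<in>X. r x \<in> Zp}"

lemma zp_algebra_tate_Zp: "zp_algebra p X tate_Zp"
proof unfold_locales
  fix r assume r: "r \<in> tate_Zp"
  interpret Z: zp_algebra p ty X "{r. \<forall>x\<in>X. r x \<in> Zp}" by (rule zp_algebra_all)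
  show "(\<lambda>x. 1 / (1 + of_nat p * r x)) \<in> tate_Zp"
    using r tate_ball_inverse[of r] Z.A_inverse[of r] by (auto simp: tate_Zp_def)
next
  fix r s assume "r \<in> tate_Zp" "\<And>x. x \<in> X \<Longrightarrow> r x = s x"
  then show "s \<in> tate_Zp" using tate_ball_cong[of r s] by (auto simp: tate_Zp_def)
qed (auto simp: tate_Zp_def vabs_Zp intro: tate_ball_const tate_ball_add tate_ball_mult Zp_add Zp_mult)

sublocale zp_algebra p ty X tate_Zp
  by (rule zp_algebra_tate_Zp)

lemma tate_Zp_crd: "i \<in> I \<Longrightarrow> (\<lambda>x. crd x i) \<in> tate_Zp"
  using tate_ball_crd crd_Zp by (auto simp: tate_Zp_def)

lemma tate_expansion_cmult:
  assumes "tate_expansion I X crd f a"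
  shows "tate_expansion I X crd (\<lambda>x. c * f x) (\<lambda>\<alpha>. c * a \<alpha>)"
proof -
  have "null_family (multi_indices I) (\<lambda>\<alpha>. c * a \<alpha>)"
  proof (cases "c = 0")
    case False
    have "null_family (multi_indices I) a" using assms by (auto simp: tate_expansion_def tends_to_0_vabs)
    moreover have "\<epsilon> \<le> vabs (c * a \<alpha>) \<longleftrightarrow> \<epsilon> / vabs c \<le> vabs (a \<alpha>)" for \<epsilon> \<alpha>
      using False by (simp add: vabs_mult field_simps)
    ultimately show ?thesis using False by (simp add: null_family_def)
  qed (simp add: null_family_def)
  then show ?thesis
    using assms unfolding tate_expansion_def tends_to_0_vabs
    by (auto simp: mult.assoc intro!: has_sum_cmult_right)
qed

end

section \<open>Equivariant functions along pro-p families\<close>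

definition equivariant :: "nat \<Rightarrow> nat \<Rightarrow> (nat \<Rightarrow> 'k \<Rightarrow> 'k) \<Rightarrow> 'k mat \<Rightarrow> ('k::nonarch_field mat \<Rightarrow> 'k) \<Rightarrow> bool" where
  "equivariant p n \<chi> w f \<longleftrightarrow>
     (\<forall>g\<in>Iwahori p n. \<forall>b\<in>Pw p n w. f (g * b) = char_w n \<chi> w (minv b) * f g)"

locale analytic_character = padic_base p ty
  for p :: nat and ty :: "'k::nonarch_field itself" +
  fixes n :: nat and \<sigma> :: "nat \<Rightarrow> nat" and c :: "nat \<Rightarrow> 'k" and \<chi> :: "nat \<Rightarrow> 'k \<Rightarrow> 'k"
  assumes \<sigma>: "\<sigma> permutes {..<n}"
    and chi: "\<And>i u. i < n \<Longrightarrow> u \<in> Zp \<Longrightarrow>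
      \<chi> i (1 + of_nat p * u) = padic_exp (c i * padic_log (1 + of_nat p * u))"
    and c_small: "\<And>i. i < n \<Longrightarrow> vabs (c i * of_nat p) < exp_radius"

text \<open>The coefficients \<open>a\<close> of f may be larger than 1. They therefore serve as the
  null family, and \<open>T x\<close> times a monomial in the coordinates of \<open>L x\<close> as
  the element of the unit ball.\<close>

lemma (in tate_space) analytic_along_family:
  assumes char: "analytic_character p n \<sigma> c \<chi>"
    and g: "pro_p_family n g"
    and eqv: "equivariant p n \<chi> (perm_mat n \<sigma>) f"
    and exp: "Uw_expansion p n (perm_mat n \<sigma>) f a"
  obtains b where "tate_expansion I X crd (\<lambda>x. f (g x)) b"
proof -
  interpret C: analytic_character p ty n \<sigma> c \<chi> by (rule char)
  let ?w = "perm_mat n \<sigma> :: 'k mat"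
  let ?J = "Uw_pos n ?w"
  define L where "L x = lu_lower \<sigma> n (g x)" for x
  define R where "R x = lu_upper \<sigma> n (g x)" for x
  have famL: "pro_p_family n L" and famR: "pro_p_family n R"
    unfolding L_def R_def using lu_family[OF g C.\<sigma>] by auto
  have lt: "\<sigma> k < n" if "k < n" for k using permutes_in_image[OF C.\<sigma>, of k] that by simp
  have LU: "L x \<in> Uw p n ?w" if x: "x \<in> X" for x
    unfolding Uw_iff[OF C.\<sigma>]
    using pro_p_Iwahori_subset[OF pro_p_family_imp_pro_p_Iwahori[OF famL x]] lu_decomposition[OF g C.\<sigma> x]
    by (auto simp: L_def)
  have RP: "R x \<in> Pw p n ?w" if x: "x \<in> X" for x
    using pro_p_Iwahori_subset[OF pro_p_family_imp_pro_p_Iwahori[OF famR x]] lu_decomposition(4)[OF g C.\<sigma> x]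
    by (intro Pw_I[OF C.\<sigma>]) (auto simp: R_def)
  have diag: "(\<lambda>x. R x $$ (\<sigma> i, \<sigma> i) - 1) \<in> pA" if "i < n" for i
    using pro_p_familyD(4)[OF famR lt[OF that]] .
  \<comment> \<open>Chosen so that the reciprocal of the diagonal entry is 1 + p s, the form in
    which both the formula for \<chi> and \<open>tate_ball_exp_log\<close> apply.\<close>
  define s where "s i x = (1 / R x $$ (\<sigma> i, \<sigma> i) - 1) / of_nat p" for i x
  have s: "s i \<in> tate_Zp" if "i < n" for i
    using one_plus_pA_inverse[OF diag[OF that]] by (simp add: pA_def s_def[abs_def])
  define T where "T x = (\<Prod>i<n. padic_exp (c i * padic_log (1 + of_nat p * s i x)))" for x
  have T: "T \<in> tate_ball"
    unfolding T_def using s C.c_small by (intro tate_ball_prod tate_ball_exp_log) (auto simp: tate_Zp_def)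
  have charT: "char_w n \<chi> ?w (minv (R x)) = T x" if x: "x \<in> X" for x
  proof -
    have "char_w n \<chi> ?w (minv (R x)) = (\<Prod>i<n. \<chi> i (1 / R x $$ (\<sigma> i, \<sigma> i)))"
      using pro_p_familyD(1)[OF famR x] pro_p_family_minv_props[OF famR x] lu_decomposition(4)[OF g C.\<sigma> x]
        one_plus_pA_nonzero[OF diag x]
      by (intro char_w_minv[OF C.\<sigma>]) (auto simp: R_def)
    also have "\<dots> = T x"
      unfolding T_def
    proof (rule prod.cong)
      fix i assume "i \<in> {..<n}"
      then have "s i x \<in> Zp" using s x A_Zp by auto
      moreover have "1 / R x $$ (\<sigma> i, \<sigma> i) = 1 + of_nat p * s i x" by (simp add: s_def)
      ultimately show "\<chi> i (1 / R x $$ (\<sigma> i, \<sigma> i)) = padic_exp (c i * padic_log (1 + of_nat p * s i x))"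
        using C.chi[of i "s i x"] \<open>i \<in> {..<n}\<close> by simp
    qed simp
    finally show ?thesis .
  qed
  have mono: "(\<lambda>x. T x * mpower ?J (Uw_crd p (L x)) \<alpha>) \<in> tate_ball" for \<alpha>
    unfolding mpower_def
  proof (intro tate_ball_mult T tate_ball_prod tate_ball_power)
    fix ij assume ij: "ij \<in> ?J"
    then have "fst ij \<noteq> snd ij" using Uw_pos_bounds(3)[OF C.\<sigma>, of "fst ij" "snd ij", where 'k = 'k] by simp
    then show "(\<lambda>x. Uw_crd p (L x) ij) \<in> tate_ball"
      using pro_p_family_Uw_crd[OF famL ij] by (simp add: tate_Zp_def)
  qed
  have null: "null_family (multi_indices ?J) a"
    using exp by (auto simp: Uw_expansion_def tate_expansion_def tends_to_0_vabs)
  have sum: "((\<lambda>\<alpha>. a \<alpha> * (T x * mpower ?J (Uw_crd p (L x)) \<alpha>)) has_sum f (g x)) (multi_indices ?J)"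
    if x: "x \<in> X" for x
  proof -
    have "f (g x) = f (L x * R x)" unfolding L_def R_def using lu_decomposition(1)[OF g C.\<sigma> x] by simp
    also have "\<dots> = T x * f (L x)"
      using eqv Uw_Iwahori[OF LU[OF x]] RP[OF x] charT[OF x] by (auto simp: equivariant_def)
    finally have "f (g x) = T x * f (L x)" .
    moreover have "((\<lambda>\<alpha>. T x * (a \<alpha> * mpower ?J (Uw_crd p (L x)) \<alpha>)) has_sum T x * f (L x)) (multi_indices ?J)"
      using exp LU[OF x] by (intro has_sum_cmult_right) (auto simp: Uw_expansion_def tate_expansion_def)
    ultimately show ?thesis by (simp add: mult.left_commute)
  qed
  obtain b where "tate_expansion I X crd (\<lambda>x. f (g x)) b"
    by (rule tate_expansion_null_sum[OF null mono sum])
  then show thesis by (rule that)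
qed

section \<open>The induced representation and its orbit maps\<close>

context analytic_character
begin

abbreviation w :: "'k mat" where "w \<equiv> perm_mat n \<sigma>"

lemma Uw_crd_Zp:
  assumes u: "u \<in> Uw p n w" and ij: "ij \<in> Uw_pos n w"
  shows "Uw_crd p u ij \<in> Zp"
proof -
  obtain a b where ab: "ij = (a,b)" by fastforce
  have "a < n" "b < n" using ij by (auto simp: ab Uw_pos_def)
  then show ?thesis using Uw_Iwahori[OF u]
    by (auto simp: ab Uw_crd_def Iwahori_def GL_Zp_def Mat_Zp_def pZp_iff)
qed

lemma tate_space_Uw: "tate_space p (Uw_pos n w) (Uw p n w) (Uw_crd p)"
  by unfold_locales (auto simp: finite_Uw_pos Uw_crd_Zp)

lemma finite_all_pos: "finite (all_pos n)"
  by (simp add: all_pos_def)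

lemma tate_space_Zp_points: "tate_space p (all_pos n) (Zp_points (all_pos n)) (\<lambda>z::nat \<times> nat \<Rightarrow> 'k. z)"
  by unfold_locales (auto simp: finite_all_pos Zp_points_def)

text \<open>Near g one has g + p z = h(z) D, with D the diagonal part of g and h(z) a pro-p family
  in z. So f(g + p z) is a constant times f(h(z)), which is a power series in z.\<close>

lemma equivariant_locally_analytic:
  assumes eqv: "equivariant p n \<chi> w f" and exp: "Uw_expansion p n w f a"
  shows "locally_analytic_on_Iwahori p n f"
  unfolding locally_analytic_on_Iwahori_def
proof
  interpret S: tate_space p ty "all_pos n" "Zp_points (all_pos n)" "\<lambda>z::nat \<times> nat \<Rightarrow> 'k. z"
    by (rule tate_space_Zp_points)
  fix g :: "'k mat" assume g: "g \<in> Iwahori p n"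
  \<comment> \<open>The exponent 1 works at every g: a perturbation by p z keeps the diagonal of g,
    divided by itself, in 1 + pZ_p.\<close>
  define N where "N z = g + mat n n (\<lambda>ij. of_nat p ^ 1 * z ij)" for z :: "nat \<times> nat \<Rightarrow> 'k"
  define D where "D = mat_diag n (\<lambda>i. g $$ (i,i))"
  define h where "h z = mat n n (\<lambda>(i,j). N z $$ (i,j) / g $$ (j,j))" for z
  have D: "D \<in> Pw p n w" unfolding D_def by (rule diag_factor(1)[OF g \<sigma>])
  have gc: "g \<in> carrier_mat n n" using g by (rule Iwahori_carrier)
  have N: "N z = h z * D" for z
    unfolding h_def D_def by (rule diag_factor(2)[OF g \<sigma>]) (simp add: N_def)
  have gZ: "g $$ (i,j) \<in> Zp" if "i < n" "j < n" for i j
    using g that by (auto simp: Iwahori_def GL_Zp_def Mat_Zp_def)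
  have gp: "g $$ (i,j) / of_nat p \<in> Zp" if "i < j" "j < n" for i j
    using g that by (auto simp: Iwahori_def pZp_iff)
  note unit = Iwahori_diag_unit[OF g]
  have hidx: "h z $$ (i,j) = (g $$ (i,j) + of_nat p * z (i,j)) / g $$ (j,j)" if "i < n" "j < n" for i j z
    using that gc by (simp add: h_def N_def)
  have zA: "(\<lambda>z. z (i,j)) \<in> S.tate_Zp" if "i < n" "j < n" for i j
    using S.tate_Zp_crd[of "(i,j)"] that by (simp add: all_pos_def)
  have recip: "1 / g $$ (j,j) \<in> Zp" if "j < n" for j using that gZ unit by (intro Zp_divide) auto
  have fam: "S.pro_p_family n h"
  proof (rule S.pro_p_familyI)
    show "h z \<in> carrier_mat n n" for z by (simp add: h_def)
    show "(\<lambda>z. h z $$ (i,j)) \<in> S.tate_Zp" if "j < i" "i < n" for i j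
    proof -
      have "(\<lambda>z. (g $$ (i,j) + of_nat p * z (i,j)) * (1 / g $$ (j,j))) \<in> S.tate_Zp"
        using that by (intro S.A_mult S.A_add S.A_const zA gZ recip Zp_of_nat) auto
      then show ?thesis using that by (simp add: hidx)
    qed
    show "(\<lambda>z. h z $$ (i,j)) \<in> S.pA" if "i < j" "j < n" for i j
    proof -
      have "(\<lambda>z. (g $$ (i,j) / of_nat p + z (i,j)) * (1 / g $$ (j,j))) \<in> S.tate_Zp"
        using that by (intro S.A_mult S.A_add S.A_const zA gp recip) auto
      then show ?thesis using that by (simp add: hidx S.pA_def add_divide_distrib mult.commute)
    qed
    show "(\<lambda>z. h z $$ (i,i) - 1) \<in> S.pA" if i: "i < n" for i
    proof -
      have nz: "g $$ (i,i) \<noteq> 0" using unit[OF i] by auto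
      have "(\<lambda>z. z (i,i) * (1 / g $$ (i,i))) \<in> S.tate_Zp"
        using i by (intro S.A_mult S.A_const zA recip)
      then show ?thesis using i nz by (simp add: hidx S.pA_def add_divide_distrib)
    qed
  qed
  obtain b where "tate_expansion (all_pos n) (Zp_points (all_pos n)) (\<lambda>z. z) (\<lambda>z. f (h z)) b"
    using S.analytic_along_family[OF analytic_character_axioms fam eqv exp] .
  from S.tate_expansion_cmult[OF this, of "char_w n \<chi> w (minv D)"]
  have "tate_expansion (all_pos n) (Zp_points (all_pos n)) (\<lambda>z. z) (\<lambda>z. f (N z))
      (\<lambda>\<alpha>. char_w n \<chi> w (minv D) * b \<alpha>)"
  proof (subst S.tate_expansion_cong)
    fix z :: "nat \<times> nat \<Rightarrow> 'k" assume "z \<in> Zp_points (all_pos n)"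
    then have "h z \<in> Iwahori p n"
      by (intro pro_p_Iwahori_subset S.pro_p_family_imp_pro_p_Iwahori[OF fam])
    then show "f (N z) = char_w n \<chi> w (minv D) * f (h z)"
      using eqv D unfolding N equivariant_def by blast
  qed
  moreover have "N z \<in> Iwahori p n" if "z \<in> Zp_points (all_pos n)" for z
    unfolding N using that
    by (intro Iwahori_mult Pw_Iwahori[OF D] pro_p_Iwahori_subset S.pro_p_family_imp_pro_p_Iwahori[OF fam])
  ultimately show "\<exists>m::nat. (let nbhd = (\<lambda>z. g + mat n n (\<lambda>ij. of_nat p ^ m * z ij)) in
         (\<forall>z\<in>Zp_points (all_pos n). nbhd z \<in> Iwahori p n) \<and>
         (\<exists>a. tate_expansion (all_pos n) (Zp_points (all_pos n)) (\<lambda>z. z) (\<lambda>z. f (nbhd z)) a))"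
    unfolding Let_def N_def by (intro exI[of _ 1]) blast
qed

lemma ind_iff: "f \<in> ind p n \<chi> w \<longleftrightarrow>
    (\<forall>g. g \<notin> Iwahori p n \<longrightarrow> f g = 0) \<and> equivariant p n \<chi> w f \<and> (\<exists>a. Uw_expansion p n w f a)"
  unfolding ind_def using equivariant_locally_analytic by (auto simp: equivariant_def)

lemma left_transl_ind:
  assumes h: "h \<in> pro_p_Iwahori p n" and f: "f \<in> ind p n \<chi> w"
  shows "left_transl p n h f \<in> ind p n \<chi> w"
proof -
  interpret S: tate_space p ty "Uw_pos n w" "Uw p n w" "Uw_crd p" by (rule tate_space_Uw)
  have eqv: "equivariant p n \<chi> w f" using f by (simp add: ind_iff)
  obtain a where exp: "Uw_expansion p n w f a" using f by (auto simp: ind_iff)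
  have hI: "minv h \<in> Iwahori p n"
  proof -
    interpret Z: zp_algebra p ty "UNIV :: unit set" "{r. \<forall>x\<in>UNIV. r x \<in> Zp}" by (rule zp_algebra_all)
    show ?thesis
      using Z.pro_p_family_imp_pro_p_Iwahori[OF Z.pro_p_family_minv[OF Z.pro_p_family_const[OF h]]]
      by (intro pro_p_Iwahori_subset) auto
  qed
  have "equivariant p n \<chi> w (left_transl p n h f)"
    unfolding equivariant_def
  proof (intro ballI)
    fix g b :: "'k mat" assume gb: "g \<in> Iwahori p n" "b \<in> Pw p n w"
    have "minv h * (g * b) = (minv h * g) * b"
      using Iwahori_carrier hI gb Pw_Iwahori by (intro assoc_mult_mat[symmetric]) blast+
    moreover have "f ((minv h * g) * b) = char_w n \<chi> w (minv b) * f (minv h * g)"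
      using eqv gb Iwahori_mult[OF hI gb(1)] by (simp add: equivariant_def)
    ultimately show "left_transl p n h f (g * b) = char_w n \<chi> w (minv b) * left_transl p n h f g"
      using gb Iwahori_mult[OF gb(1) Pw_Iwahori[OF gb(2)]] by (simp add: left_transl_def)
  qed
  moreover have "S.pro_p_family n (\<lambda>u. minv h * u)"
    by (intro S.pro_p_family_mult S.pro_p_family_minv S.pro_p_family_const h
        S.pro_p_family_Uw[OF \<sigma>] S.tate_Zp_crd)
  then obtain b where "tate_expansion (Uw_pos n w) (Uw p n w) (Uw_crd p) (\<lambda>u. f (minv h * u)) b"
    using S.analytic_along_family[OF analytic_character_axioms _ eqv exp] by blast
  then have "Uw_expansion p n w (left_transl p n h f) b"
    unfolding Uw_expansion_def
    by (subst S.tate_expansion_cong) (auto simp: left_transl_def Uw_Iwahori)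
  ultimately show ?thesis by (auto simp: ind_iff left_transl_def)
qed

text \<open>Surjectivity of the coordinates makes expansions on U_w unique, and thereby the
  \<open>THE\<close> in \<open>ind_norm\<close> meaningful.\<close>

lemma Uw_crd_onto:
  assumes z: "z \<in> Zp_points (Uw_pos n w)"
  shows "\<exists>u\<in>Uw p n w. \<forall>ij\<in>Uw_pos n w. Uw_crd p u ij = z ij"
proof -
  interpret Z: zp_algebra p ty "UNIV :: unit set" "{r. \<forall>x\<in>UNIV. r x \<in> Zp}" by (rule zp_algebra_all)
  define u where "u = mat n n (\<lambda>(a,b). if a = b then 1 else if (a,b) \<in> Uw_pos n w then
    (if a < b then of_nat p * z (a,b) else z (a,b)) else 0)"
  have zZ: "z ij \<in> Zp" if "ij \<in> Uw_pos n w" for ij using z that by (simp add: Zp_points_def)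
  \<comment> \<open>Read as a family over a one-point set, u is pro-p, which gives its invertibility
    over Z_p without computing an inverse.\<close>
  have "Z.pro_p_family n (\<lambda>_. u)"
  proof (rule Z.pro_p_familyI)
    show "(\<lambda>_. u $$ (i,j)) \<in> Z.pA" if "i < j" "j < n" for i j
      unfolding Z.pA_def using that zZ by (auto simp: u_def)
    show "(\<lambda>_. u $$ (i,i) - 1) \<in> Z.pA" if "i < n" for i
      unfolding Z.pA_def using that by (auto simp: u_def)
  qed (use zZ in \<open>auto simp: u_def\<close>)
  then have uI: "u \<in> Iwahori p n"
    using Z.pro_p_family_imp_pro_p_Iwahori[of n "\<lambda>_. u"] by (intro pro_p_Iwahori_subset) auto
  have lt: "\<sigma> k < n" if "k < n" for k using permutes_in_image[OF \<sigma>, of k] that by simp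
  have "u $$ (\<sigma> i, \<sigma> j) = 0" if ij: "i < j" "j < n" for i j
  proof -
    have "\<sigma> i \<noteq> \<sigma> j" using ij permutes_inj[OF \<sigma>] by (auto dest: injD)
    moreover have "(\<sigma> i, \<sigma> j) \<notin> Uw_pos n w"
      unfolding Uw_pos_iff[OF \<sigma>] using ij by (auto simp: inj_eq[OF permutes_inj[OF \<sigma>]])
    ultimately show ?thesis using lt ij by (simp add: u_def)
  qed
  then have "u \<in> Uw p n w" unfolding Uw_iff[OF \<sigma>] using uI lt by (auto simp: u_def)
  moreover have "Uw_crd p u ij = z ij" if ij: "ij \<in> Uw_pos n w" for ij
  proof -
    obtain a b where ab: "ij = (a,b)" by fastforce
    show ?thesis using Uw_pos_bounds[OF \<sigma>, of a b, where 'k = 'k] ij by (auto simp: ab Uw_crd_def u_def)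
  qed
  ultimately show ?thesis by blast
qed

lemma Uw_expansion_unique:
  "Uw_expansion p n w f a \<Longrightarrow> Uw_expansion p n w f b \<Longrightarrow> a = b"
  unfolding Uw_expansion_def using tate_expansion_unique[OF finite_Uw_pos _ _ Uw_crd_onto] by blast

text \<open>The bound \<open>C\<close> also serves the lower estimate: the supremum dominates the
  constant coefficient because the set is bounded above.\<close>

lemma ind_norm_bounds:
  assumes exp: "Uw_expansion p n w f a" and C: "\<And>\<alpha>. \<alpha> \<in> multi_indices (Uw_pos n w) \<Longrightarrow> vabs (a \<alpha>) \<le> C"
  shows "0 \<le> ind_norm p n w f" "ind_norm p n w f \<le> C"
proof -
  let ?M = "multi_indices (Uw_pos n w)"
  have "(THE a. Uw_expansion p n w f a) = a"
    using exp Uw_expansion_unique by blast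
  then have N: "ind_norm p n w f = (SUP \<alpha>\<in>?M. vabs (a \<alpha>))" by (simp add: ind_norm_def)
  show "ind_norm p n w f \<le> C"
    unfolding N using C zero_multi_index by (intro cSUP_least) blast+
  have "0 \<le> vabs (a (\<lambda>_. 0))" by simp
  also have "\<dots> \<le> ind_norm p n w f"
    unfolding N by (intro cSUP_upper bdd_aboveI2[of _ _ C] C) auto
  finally show "0 \<le> ind_norm p n w f" .
qed

text \<open>The coordinates of h and u are indexed by a disjoint union, so a joint multi-index is a
  pair. Nullity of \<open>A\<close> on pairs is stronger than nullity in \<alpha> for each u
  separately; it provides the uniformity that convergence in norm requires.\<close>

lemma orbit_expansion:
  assumes f: "f \<in> ind p n \<chi> w"
    and lo: "set lo = {(i,j). j < i \<and> i < n}" and up: "set up = {(i,j). i < j \<and> j < n}"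
  obtains A where "null_family (multi_indices (all_pos n) \<times> multi_indices (Uw_pos n w)) A"
    "\<And>z u. z \<in> Zp_points (all_pos n) \<Longrightarrow> u \<in> Uw p n w \<Longrightarrow>
      ((\<lambda>(\<alpha>, \<beta>). A (\<alpha>, \<beta>) * mpower (all_pos n) z \<alpha> * mpower (Uw_pos n w) (Uw_crd p u) \<beta>)
        has_sum f (minv (G_point p n lo up z) * u)) (multi_indices (all_pos n) \<times> multi_indices (Uw_pos n w))"
proof -
  let ?I = "all_pos n" and ?J = "Uw_pos n w"
  define X :: "((nat \<times> nat \<Rightarrow> 'k) \<times> 'k mat) set" where "X = Zp_points ?I \<times> Uw p n w"
  define crd where "crd x = case_sum (fst x) (Uw_crd p (snd x))" for x :: "(nat \<times> nat \<Rightarrow> 'k) \<times> 'k mat"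
  interpret S: tate_space p ty "?I <+> ?J" X crd
    by unfold_locales
       (auto simp: finite_all_pos finite_Uw_pos X_def crd_def Zp_points_def Uw_crd_Zp)
  have eqv: "equivariant p n \<chi> w f" using f by (simp add: ind_iff)
  obtain a where exp: "Uw_expansion p n w f a" using f by (auto simp: ind_iff)
  have z: "(\<lambda>x. fst x ij) \<in> S.tate_Zp" if "ij \<in> ?I" for ij
    using S.tate_Zp_crd[of "Inl ij"] that by (auto simp: crd_def)
  have v: "(\<lambda>x. Uw_crd p (snd x) ij) \<in> S.tate_Zp" if "ij \<in> ?J" for ij
    using S.tate_Zp_crd[of "Inr ij"] that by (auto simp: crd_def)
  have "S.pro_p_family n (\<lambda>x. minv (G_point p n lo up (fst x)) * snd x)"
    using z v by (intro S.pro_p_family_mult S.pro_p_family_minv S.pro_p_family_G_point lo up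
        S.pro_p_family_Uw[OF \<sigma>]) (auto simp: X_def)
  then obtain b where b: "tate_expansion (?I <+> ?J) X crd (\<lambda>x. f (minv (G_point p n lo up (fst x)) * snd x)) b"
    using S.analytic_along_family[OF analytic_character_axioms _ eqv exp] by blast
  define h :: "(nat \<times> nat \<Rightarrow> nat) \<times> (nat \<times> nat \<Rightarrow> nat) \<Rightarrow> (nat \<times> nat) + (nat \<times> nat) \<Rightarrow> nat"
    where "h = (\<lambda>(\<alpha>, \<beta>). case_sum \<alpha> \<beta>)"
  let ?P = "multi_indices ?I \<times> multi_indices ?J"
  have bij: "bij_betw h ?P (multi_indices (?I <+> ?J))"
  proof (rule bij_betw_byWitness[where f' = "\<lambda>\<gamma>. (\<gamma> \<circ> Inl, \<gamma> \<circ> Inr)"])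
    show "\<forall>\<gamma>\<in>multi_indices (?I <+> ?J). h (\<gamma> \<circ> Inl, \<gamma> \<circ> Inr) = \<gamma>"
      by (auto simp: h_def fun_eq_iff split: sum.split)
    have "h x i = 0" if "x \<in> ?P" "i \<notin> ?I <+> ?J" for x i
    proof (cases i)
      case (Inl a)
      then have "a \<notin> ?I" using that by auto
      then show ?thesis using that(1) Inl by (cases x) (simp add: h_def multi_indices_def del: split_paired_All)
    next
      case (Inr a)
      then have "a \<notin> ?J" using that by auto
      then show ?thesis using that(1) Inr by (cases x) (simp add: h_def multi_indices_def del: split_paired_All)
    qed
    then show "h ` ?P \<subseteq> multi_indices (?I <+> ?J)"
      unfolding multi_indices_def[of "?I <+> ?J"] by (intro image_subsetI CollectI allI impI)
    have "(\<gamma> \<circ> Inl, \<gamma> \<circ> Inr) \<in> ?P" if \<gamma>: "\<gamma> \<in> multi_indices (?I <+> ?J)" for \<gamma>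
    proof -
      have zero: "\<gamma> k = 0" if "k \<notin> ?I <+> ?J" for k using \<gamma> that unfolding multi_indices_def by blast
      have "\<gamma> (Inl i) = 0" if "i \<notin> ?I" for i by (rule zero) (use that in auto)
      moreover have "\<gamma> (Inr i) = 0" if "i \<notin> ?J" for i by (rule zero) (use that in auto)
      ultimately show ?thesis by (simp add: multi_indices_def)
    qed
    then show "(\<lambda>\<gamma>. (\<gamma> \<circ> Inl, \<gamma> \<circ> Inr)) ` multi_indices (?I <+> ?J) \<subseteq> ?P" by blast
  qed (auto simp: h_def fun_eq_iff)
  have mp: "mpower (?I <+> ?J) (crd x) (h (\<alpha>, \<beta>)) = mpower ?I (fst x) \<alpha> * mpower ?J (Uw_crd p (snd x)) \<beta>" for x \<alpha> \<beta>
    unfolding mpower_def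
    by (subst prod.Plus) (auto simp: finite_all_pos finite_Uw_pos h_def crd_def)
  show thesis
  proof (rule that[of "\<lambda>x. b (h x)"])
    have null: "null_family (multi_indices (?I <+> ?J)) b"
      using b by (auto simp: tate_expansion_def tends_to_0_vabs)
    show "null_family ?P (\<lambda>x. b (h x))"
      unfolding null_family_def
    proof (intro allI impI)
      fix \<epsilon> :: real assume e: "\<epsilon> > 0"
      let ?S = "{x \<in> ?P. \<epsilon> \<le> vabs (b (h x))}"
      have "h ` ?S \<subseteq> {\<gamma> \<in> multi_indices (?I <+> ?J). \<epsilon> \<le> vabs (b \<gamma>)}"
        using bij_betw_imp_surj_on[OF bij] by auto
      then have "finite (h ` ?S)"
        using null_familyD[OF null e] by (rule finite_subset)
      moreover have "inj_on h ?S"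
        using bij_betw_imp_inj_on[OF bij] by (rule inj_on_subset) auto
      ultimately show "finite ?S" by (simp add: finite_image_iff)
    qed
    fix z :: "nat \<times> nat \<Rightarrow> 'k" and u assume zu: "z \<in> Zp_points ?I" "u \<in> Uw p n w"
    then have "((\<lambda>\<gamma>. b \<gamma> * mpower (?I <+> ?J) (crd (z, u)) \<gamma>)
        has_sum f (minv (G_point p n lo up z) * u)) (multi_indices (?I <+> ?J))"
      using b by (auto simp: tate_expansion_def X_def)
    then have "((\<lambda>x. b (h x) * mpower (?I <+> ?J) (crd (z, u)) (h x))
        has_sum f (minv (G_point p n lo up z) * u)) ?P"
      by (subst has_sum_reindex_bij_betw[OF bij])
    then show "((\<lambda>(\<alpha>, \<beta>). b (h (\<alpha>, \<beta>)) * mpower ?I z \<alpha> * mpower ?J (Uw_crd p u) \<beta>)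
        has_sum f (minv (G_point p n lo up z) * u)) ?P"
      by (rule has_sum_cong[THEN iffD1, rotated]) (auto simp: mp mult.assoc)
  qed
qed

text \<open>Here g is any element of B, which makes the coefficients of the orbit map available
  outside U_w. Once its diagonal part is split off, \<open>analytic_along_family\<close> applies
  with a constant second factor.\<close>

lemma orbit_expansion_at_point:
  assumes f: "f \<in> ind p n \<chi> w" and g: "g \<in> Iwahori p n"
    and lo: "set lo = {(i,j). j < i \<and> i < n}" and up: "set up = {(i,j). i < j \<and> j < n}"
  shows "\<exists>b. tate_expansion (all_pos n) (Zp_points (all_pos n)) (\<lambda>z. z)
    (\<lambda>z. f (minv (G_point p n lo up z) * g)) b"
proof -
  interpret S: tate_space p ty "all_pos n" "Zp_points (all_pos n)" "\<lambda>z::nat \<times> nat \<Rightarrow> 'k. z"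
    by (rule tate_space_Zp_points)
  have eqv: "equivariant p n \<chi> w f" using f by (simp add: ind_iff)
  obtain a where exp: "Uw_expansion p n w f a" using f by (auto simp: ind_iff)
  define D where "D = mat_diag n (\<lambda>i. g $$ (i,i))"
  define h where "h = mat n n (\<lambda>(i,j). g $$ (i,j) / g $$ (j,j))"
  have D: "D \<in> Pw p n w" unfolding D_def by (rule diag_factor(1)[OF g \<sigma>])
  have ghD: "g = h * D" unfolding h_def D_def by (rule diag_factor(2)[OF g \<sigma> Iwahori_carrier[OF g]])
  have gZ: "g $$ (i,j) \<in> Zp" if "i < n" "j < n" for i j
    using g that by (auto simp: Iwahori_def GL_Zp_def Mat_Zp_def)
  have gp: "g $$ (i,j) / of_nat p \<in> Zp" if "i < j" "j < n" for i j
    using g that by (auto simp: Iwahori_def pZp_iff)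
  note unit = Iwahori_diag_unit[OF g]
  have hfam: "S.pro_p_family n (\<lambda>_. h)"
  proof (rule S.pro_p_familyI)
    show "(\<lambda>_. h $$ (i,j)) \<in> S.tate_Zp" if "j < i" "i < n" for i j
      using that gZ unit by (auto simp: h_def intro!: S.A_const Zp_divide)
    show "(\<lambda>_. h $$ (i,j)) \<in> S.pA" if "i < j" "j < n" for i j
      using that S.A_const[OF Zp_divide[OF gp[OF that] gZ unit], of j] by (simp add: h_def S.pA_def mult.commute)
    show "(\<lambda>_. h $$ (i,i) - 1) \<in> S.pA" if "i < n" for i
      using that unit[OF that] by (auto simp: h_def S.pA_const_0)
  qed (simp add: h_def)
  have Gfam: "S.pro_p_family n (\<lambda>z. minv (G_point p n lo up z))"
    by (intro S.pro_p_family_minv S.pro_p_family_G_point lo up S.tate_Zp_crd)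
  have fam: "S.pro_p_family n (\<lambda>z. minv (G_point p n lo up z) * h)"
    by (rule S.pro_p_family_mult[OF Gfam hfam])
  obtain b where "tate_expansion (all_pos n) (Zp_points (all_pos n)) (\<lambda>z. z)
      (\<lambda>z. f (minv (G_point p n lo up z) * h)) b"
    using S.analytic_along_family[OF analytic_character_axioms fam eqv exp] .
  from S.tate_expansion_cmult[OF this, of "char_w n \<chi> w (minv D)"]
  have "tate_expansion (all_pos n) (Zp_points (all_pos n)) (\<lambda>z. z)
      (\<lambda>z. f (minv (G_point p n lo up z) * g)) (\<lambda>\<alpha>. char_w n \<chi> w (minv D) * b \<alpha>)"
  proof (subst S.tate_expansion_cong)
    fix z :: "nat \<times> nat \<Rightarrow> 'k" assume z: "z \<in> Zp_points (all_pos n)"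
    have I: "minv (G_point p n lo up z) * h \<in> Iwahori p n"
      by (intro pro_p_Iwahori_subset S.pro_p_family_imp_pro_p_Iwahori[OF fam z])
    have "minv (G_point p n lo up z) * g = (minv (G_point p n lo up z) * h) * D"
      unfolding ghD using S.pro_p_familyD(1)[OF Gfam z] S.pro_p_familyD(1)[OF hfam z] Iwahori_carrier[OF Pw_Iwahori[OF D]]
      by (intro assoc_mult_mat[symmetric])
    then show "f (minv (G_point p n lo up z) * g) = char_w n \<chi> w (minv D) * f (minv (G_point p n lo up z) * h)"
      using eqv D I unfolding equivariant_def by simp
  qed
  then show ?thesis by blast
qed

text \<open>The value of \<open>F \<alpha>\<close> at g is the coefficient with index \<alpha> of
  the function sending z to f(G(z)^-1 g). Uniqueness is used twice: on U_w to match these values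
  with the joint expansion, and on B to pass equivariance from f to
  \<open>F \<alpha>\<close>.\<close>

lemma orbit_coefficients:
  assumes f: "f \<in> ind p n \<chi> w"
    and lo: "set lo = {(i,j). j < i \<and> i < n}" and up: "set up = {(i,j). i < j \<and> j < n}"
  obtains A F where "null_family (multi_indices (all_pos n) \<times> multi_indices (Uw_pos n w)) A"
    "\<forall>\<alpha>\<in>multi_indices (all_pos n). F \<alpha> \<in> ind p n \<chi> w"
    "\<forall>\<alpha>\<in>multi_indices (all_pos n).
      Uw_expansion p n w (F \<alpha>) (\<lambda>\<beta>. if \<beta> \<in> multi_indices (Uw_pos n w) then A (\<alpha>, \<beta>) else 0)"
    "\<forall>z\<in>Zp_points (all_pos n). \<forall>u\<in>Uw p n w.
      ((\<lambda>\<alpha>. F \<alpha> u * mpower (all_pos n) z \<alpha>) has_sum f (minv (G_point p n lo up z) * u)) (multi_indices (all_pos n))"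
proof -
  let ?I = "all_pos n" and ?J = "Uw_pos n w" and ?G = "G_point p n lo up"
  let ?MI = "multi_indices ?I" and ?MJ = "multi_indices ?J" and ?Z = "Zp_points (all_pos n) :: (nat \<times> nat \<Rightarrow> 'k) set"
  interpret S: tate_space p ty ?I ?Z "\<lambda>z. z" by (rule tate_space_Zp_points)
  have eqv: "equivariant p n \<chi> w f" using f by (simp add: ind_iff)
  obtain A where A: "null_family (?MI \<times> ?MJ) A"
    and Asum: "\<And>z u. z \<in> ?Z \<Longrightarrow> u \<in> Uw p n w \<Longrightarrow>
      ((\<lambda>(\<alpha>, \<beta>). A (\<alpha>, \<beta>) * mpower ?I z \<alpha> * mpower ?J (Uw_crd p u) \<beta>)
        has_sum f (minv (?G z) * u)) (?MI \<times> ?MJ)"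
    using orbit_expansion[OF f lo up] by blast
  obtain co where co: "\<And>g. g \<in> Iwahori p n \<Longrightarrow> tate_expansion ?I ?Z (\<lambda>z. z) (\<lambda>z. f (minv (?G z) * g)) (co g)"
    using orbit_expansion_at_point[OF f _ lo up] by metis
  have unique: "a = b"
    if "tate_expansion ?I ?Z (\<lambda>z. z) h a" "tate_expansion ?I ?Z (\<lambda>z. z) h b" for a b and h :: "_ \<Rightarrow> 'k"
    using tate_expansion_unique[OF finite_all_pos that] by blast
  define F where "F \<alpha> g = (if g \<in> Iwahori p n then co g \<alpha> else 0)" for \<alpha> g
  have vu: "vabs (mpower ?J (Uw_crd p u) \<beta>) \<le> 1" if "u \<in> Uw p n w" for u \<beta>
    using that by (intro vabs_mpower_le vabs_Zp Uw_crd_Zp)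
  have Au: "null_family (?MI \<times> ?MJ) (\<lambda>(\<alpha>, \<beta>). A (\<alpha>, \<beta>) * mpower ?J (Uw_crd p u) \<beta>)" if "u \<in> Uw p n w" for u
    by (rule null_family_le[OF A]) (auto simp: vabs_mult vu[OF that] mult_left_le)
  \<comment> \<open>Summing the joint expansion over \<beta> first gives a second expansion of the
    same function of z.\<close>
  have coU: "co u = (\<lambda>\<alpha>. if \<alpha> \<in> ?MI then infsum (\<lambda>\<beta>. A (\<alpha>, \<beta>) * mpower ?J (Uw_crd p u) \<beta>) ?MJ else 0)"
    (is "_ = ?c") if u: "u \<in> Uw p n w" for u
  proof (rule unique)
    show "tate_expansion ?I ?Z (\<lambda>z. z) (\<lambda>z. f (minv (?G z) * u)) (co u)"
      by (rule co[OF Uw_Iwahori[OF u]])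
    have "null_family ?MI (\<lambda>\<alpha>. infsum (\<lambda>\<beta>. A (\<alpha>, \<beta>) * mpower ?J (Uw_crd p u) \<beta>) ?MJ)"
      using null_family_infsum[OF Au[OF u]] by simp
    then have "null_family ?MI ?c" by (rule null_family_le) auto
    moreover have "((\<lambda>\<alpha>. ?c \<alpha> * mpower ?I z \<alpha>) has_sum f (minv (?G z) * u)) ?MI" if z: "z \<in> ?Z" for z
    proof (rule has_sum_SigmaD[OF Asum[OF z u]])
      fix \<alpha> assume \<alpha>: "\<alpha> \<in> ?MI"
      have "((\<lambda>\<beta>. A (\<alpha>, \<beta>) * mpower ?J (Uw_crd p u) \<beta>) has_sum ?c \<alpha>) ?MJ"
        using null_family_has_sum[OF null_family_fiber[OF Au[OF u] \<alpha>]] \<alpha> by simp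
      from has_sum_cmult_left[OF this, of "mpower ?I z \<alpha>"]
      show "((\<lambda>\<beta>. case (\<alpha>, \<beta>) of (\<alpha>, \<beta>) \<Rightarrow> A (\<alpha>, \<beta>) * mpower ?I z \<alpha> * mpower ?J (Uw_crd p u) \<beta>)
          has_sum ?c \<alpha> * mpower ?I z \<alpha>) ?MJ"
        by (simp add: mult_ac)
    qed
    ultimately show "tate_expansion ?I ?Z (\<lambda>z. z) (\<lambda>z. f (minv (?G z) * u)) ?c"
      unfolding tate_expansion_def tends_to_0_vabs by simp
  qed
  have Fexp: "Uw_expansion p n w (F \<alpha>) (\<lambda>\<beta>. if \<beta> \<in> ?MJ then A (\<alpha>, \<beta>) else 0)" if \<alpha>: "\<alpha> \<in> ?MI" for \<alpha>
  proof -
    have "null_family ?MJ (\<lambda>\<beta>. if \<beta> \<in> ?MJ then A (\<alpha>, \<beta>) else 0)"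
      by (rule null_family_le[OF null_family_fiber[OF A \<alpha>]]) auto
    moreover have "((\<lambda>\<beta>. (if \<beta> \<in> ?MJ then A (\<alpha>, \<beta>) else 0) * mpower ?J (Uw_crd p u) \<beta>) has_sum F \<alpha> u) ?MJ"
      if u: "u \<in> Uw p n w" for u
    proof -
      have "((\<lambda>\<beta>. A (\<alpha>, \<beta>) * mpower ?J (Uw_crd p u) \<beta>) has_sum F \<alpha> u) ?MJ"
        using null_family_has_sum[OF null_family_fiber[OF Au[OF u] \<alpha>]] \<alpha> coU[OF u] Uw_Iwahori[OF u]
        by (simp add: F_def)
      then show ?thesis by (rule has_sum_cong[THEN iffD1, rotated]) auto
    qed
    ultimately show ?thesis unfolding Uw_expansion_def tate_expansion_def tends_to_0_vabs by simp
  qed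
  have "equivariant p n \<chi> w (F \<alpha>)" for \<alpha>
    unfolding equivariant_def
  proof (intro ballI)
    fix g b :: "'k mat" assume gb: "g \<in> Iwahori p n" "b \<in> Pw p n w"
    have gbI: "g * b \<in> Iwahori p n" by (rule Iwahori_mult[OF gb(1) Pw_Iwahori[OF gb(2)]])
    \<comment> \<open>The character value times \<open>co g\<close> expands the same function of z
      as \<open>co (g * b)\<close>, so the two coefficient families agree.\<close>
    have "tate_expansion ?I ?Z (\<lambda>z. z) (\<lambda>z. f (minv (?G z) * (g * b))) (\<lambda>\<alpha>. char_w n \<chi> w (minv b) * co g \<alpha>)"
    proof (subst S.tate_expansion_cong)
      show "tate_expansion ?I ?Z (\<lambda>z. z) (\<lambda>z. char_w n \<chi> w (minv b) * f (minv (?G z) * g)) (\<lambda>\<alpha>. char_w n \<chi> w (minv b) * co g \<alpha>)"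
        by (rule S.tate_expansion_cmult[OF co[OF gb(1)]])
      fix z assume z: "z \<in> ?Z"
      have Gfam: "S.pro_p_family n (\<lambda>z. minv (?G z))"
        by (intro S.pro_p_family_minv S.pro_p_family_G_point lo up S.tate_Zp_crd)
      have GI: "minv (?G z) \<in> Iwahori p n"
        by (intro pro_p_Iwahori_subset S.pro_p_family_imp_pro_p_Iwahori[OF Gfam z])
      have "minv (?G z) * (g * b) = (minv (?G z) * g) * b"
        using Iwahori_carrier[OF GI] Iwahori_carrier[OF gb(1)] Iwahori_carrier[OF Pw_Iwahori[OF gb(2)]]
        by (intro assoc_mult_mat[symmetric])
      then show "f (minv (?G z) * (g * b)) = char_w n \<chi> w (minv b) * f (minv (?G z) * g)"
        using eqv gb Iwahori_mult[OF GI gb(1)] unfolding equivariant_def by simp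
    qed
    then have "co (g * b) = (\<lambda>\<alpha>. char_w n \<chi> w (minv b) * co g \<alpha>)" using co[OF gbI] unique by blast
    then show "F \<alpha> (g * b) = char_w n \<chi> w (minv b) * F \<alpha> g" using gb gbI by (simp add: F_def)
  qed
  then have Find: "F \<alpha> \<in> ind p n \<chi> w" if "\<alpha> \<in> ?MI" for \<alpha>
    using Fexp[OF that] by (auto simp: ind_iff F_def)
  have Fsum: "((\<lambda>\<alpha>. F \<alpha> u * mpower ?I z \<alpha>) has_sum f (minv (?G z) * u)) ?MI"
    if "z \<in> ?Z" "u \<in> Uw p n w" for z u
    using co[OF Uw_Iwahori[OF that(2)]] that Uw_Iwahori[OF that(2)] by (simp add: F_def tate_expansion_def)
  show thesis by (rule that[of A F]) (use A Find Fexp Fsum in blast)+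
qed

text \<open>Outside the finite set \<open>large \<epsilon>\<close> of rows all A(\<alpha>, \<beta>)
  are at most \<epsilon>, which bounds the norms of the \<open>F \<alpha>\<close>. For a finite T
  containing that set, the remainder is the sum over the rows outside T, so its norm is at most
  \<epsilon> as well.\<close>

lemma left_transl_globally_analytic:
  "globally_analytic_action p n (ind p n \<chi> w) (ind_norm p n w) (left_transl p n)"
  unfolding globally_analytic_action_def
proof (intro conjI allI impI ballI)
  fix h :: "'k mat" and f assume "h \<in> pro_p_Iwahori p n" "f \<in> ind p n \<chi> w"
  then show "left_transl p n h f \<in> ind p n \<chi> w" by (rule left_transl_ind)
next
  fix lo up :: "(nat \<times> nat) list" and f
  assume "distinct lo \<and> set lo = {(i,j). j < i \<and> i < n} \<and> distinct up \<and> set up = {(i,j). i < j \<and> j < n}"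
    and f: "f \<in> ind p n \<chi> w"
  then have lo: "set lo = {(i,j). j < i \<and> i < n}" and up: "set up = {(i,j). i < j \<and> j < n}" by auto
  let ?I = "all_pos n" and ?J = "Uw_pos n w" and ?G = "G_point p n lo up"
  let ?MI = "multi_indices ?I" and ?MJ = "multi_indices ?J" and ?Z = "Zp_points (all_pos n) :: (nat \<times> nat \<Rightarrow> 'k) set"
  interpret S: tate_space p ty ?J "Uw p n w" "Uw_crd p" by (rule tate_space_Uw)
  obtain A F where A: "null_family (?MI \<times> ?MJ) A"
    and Find: "\<forall>\<alpha>\<in>?MI. F \<alpha> \<in> ind p n \<chi> w"
    and Fexp': "\<forall>\<alpha>\<in>?MI. Uw_expansion p n w (F \<alpha>) (\<lambda>\<beta>. if \<beta> \<in> ?MJ then A (\<alpha>, \<beta>) else 0)"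
    and Fsum: "\<forall>z\<in>?Z. \<forall>u\<in>Uw p n w.
      ((\<lambda>\<alpha>. F \<alpha> u * mpower ?I z \<alpha>) has_sum f (minv (?G z) * u)) ?MI"
    using orbit_coefficients[OF f lo up] by blast
  note Fexp = bspec[OF Fexp']
  define large where "large \<epsilon> = fst ` {x \<in> ?MI \<times> ?MJ. \<epsilon> \<le> vabs (A x)}" for \<epsilon>
  have finite_large: "finite (large \<epsilon>)" if "\<epsilon> > 0" for \<epsilon>
    unfolding large_def using null_familyD[OF A that] by (rule finite_imageI)
  have small: "vabs (A (\<alpha>, \<beta>)) \<le> \<epsilon>" if "\<alpha> \<in> ?MI" "\<alpha> \<notin> large \<epsilon>" "\<beta> \<in> ?MJ" for \<alpha> \<beta> \<epsilon>
  proof (rule ccontr)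
    assume "\<not> vabs (A (\<alpha>, \<beta>)) \<le> \<epsilon>"
    then have "(\<alpha>, \<beta>) \<in> {x \<in> ?MI \<times> ?MJ. \<epsilon> \<le> vabs (A x)}" using that by simp
    then have "\<alpha> \<in> large \<epsilon>" unfolding large_def by (rule rev_image_eqI) simp
    then show False using that by simp
  qed
  show "\<exists>F. (\<forall>\<alpha>\<in>?MI. F \<alpha> \<in> ind p n \<chi> w) \<and>
          tends_to_0 ?I (\<lambda>\<alpha>. ind_norm p n w (F \<alpha>)) \<and>
          (\<forall>z\<in>?Z. ((\<lambda>S. ind_norm p n w (\<lambda>x. left_transl p n (?G z) f x - (\<Sum>\<alpha>\<in>S. mpower ?I z \<alpha> * F \<alpha> x)))
               \<longlongrightarrow> 0) (finite_subsets_at_top ?MI))"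
  proof (intro exI[of _ F] conjI ballI)
    show "F \<alpha> \<in> ind p n \<chi> w" if "\<alpha> \<in> ?MI" for \<alpha> using Find that by blast
    show "tends_to_0 ?I (\<lambda>\<alpha>. ind_norm p n w (F \<alpha>))"
      unfolding tends_to_0_def
    proof (intro allI impI)
      fix \<epsilon> :: real assume e: "\<epsilon> > 0"
      have "\<alpha> \<in> large (\<epsilon> / 2)" if \<alpha>: "\<alpha> \<in> ?MI" "\<epsilon> \<le> \<bar>ind_norm p n w (F \<alpha>)\<bar>" for \<alpha>
      proof (rule ccontr)
        assume no: "\<alpha> \<notin> large (\<epsilon> / 2)"
        have "0 \<le> ind_norm p n w (F \<alpha>)" "ind_norm p n w (F \<alpha>) \<le> \<epsilon> / 2"
          using ind_norm_bounds[OF Fexp[OF \<alpha>(1)], of "\<epsilon> / 2"] small[OF \<alpha>(1) no] by auto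
        then show False using \<alpha>(2) e by simp
      qed
      then have "{\<alpha> \<in> ?MI. \<epsilon> \<le> \<bar>ind_norm p n w (F \<alpha>)\<bar>} \<subseteq> large (\<epsilon> / 2)" by blast
      then show "finite {\<alpha> \<in> ?MI. \<epsilon> \<le> \<bar>ind_norm p n w (F \<alpha>)\<bar>}"
        using finite_large[of "\<epsilon> / 2"] e by (meson finite_subset half_gt_zero)
    qed
    fix z assume z: "z \<in> ?Z"
    define \<psi> where "\<psi> T = (\<lambda>x. left_transl p n (?G z) f x - (\<Sum>\<alpha>\<in>T. mpower ?I z \<alpha> * F \<alpha> x))" for T
    have vz: "vabs (mpower ?I z \<alpha>) \<le> 1" for \<alpha>
      using z by (intro vabs_mpower_le vabs_Zp) (auto simp: Zp_points_def)
    have bound: "0 \<le> ind_norm p n w (\<psi> T) \<and> ind_norm p n w (\<psi> T) \<le> \<epsilon>"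
      if e: "\<epsilon> > 0" and T: "finite T" "large \<epsilon> \<subseteq> T" "T \<subseteq> ?MI" for T \<epsilon>
    proof -
      define B where "B \<alpha> \<beta> = mpower ?I z \<alpha> * (if \<beta> \<in> ?MJ then A (\<alpha>, \<beta>) else 0)" for \<alpha> \<beta>
      have vB: "vabs (B \<alpha> \<beta>) \<le> vabs (A (\<alpha>, \<beta>))" for \<alpha> \<beta>
        unfolding B_def using vz[of \<alpha>] by (simp add: vabs_mult mult_left_le_one_le)
      have null: "null_family ((?MI - T) \<times> ?MJ) (\<lambda>(\<alpha>, \<beta>). B \<alpha> \<beta>)"
      proof (rule null_family_le)
        show "null_family ((?MI - T) \<times> ?MJ) A" by (rule null_family_subset[OF A]) auto
      qed (use vB in auto)
      have fiber: "((\<lambda>\<beta>. B \<alpha> \<beta> * mpower ?J (Uw_crd p u) \<beta>) has_sum mpower ?I z \<alpha> * F \<alpha> u) ?MJ"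
        if "\<alpha> \<in> ?MI - T" "u \<in> Uw p n w" for \<alpha> u
        unfolding B_def mult.assoc using Fexp[of \<alpha>] that
        by (intro has_sum_cmult_right) (auto simp: Uw_expansion_def tate_expansion_def)
      have total: "((\<lambda>\<alpha>. mpower ?I z \<alpha> * F \<alpha> u) has_sum \<psi> T u) (?MI - T)" if u: "u \<in> Uw p n w" for u
      proof -
        have "((\<lambda>\<alpha>. mpower ?I z \<alpha> * F \<alpha> u) has_sum left_transl p n (?G z) f u) ?MI"
          using bspec[OF bspec[OF Fsum z] u] Uw_Iwahori[OF u] by (simp add: left_transl_def mult.commute)
        then show ?thesis unfolding \<psi>_def using T by (intro has_sum_Diff) auto
      qed
      \<comment> \<open>The norm only depends on the expansion on U_w, so it suffices to expand the
        remainder there.\<close>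
      obtain b where b: "tate_expansion ?J (Uw p n w) (Uw_crd p) (\<psi> T) b"
        "\<And>C \<beta>. C \<ge> 0 \<Longrightarrow> (\<And>\<alpha> \<beta>. \<alpha> \<in> ?MI - T \<Longrightarrow> \<beta> \<in> ?MJ \<Longrightarrow> vabs (B \<alpha> \<beta>) \<le> C) \<Longrightarrow> vabs (b \<beta>) \<le> C"
        using S.tate_expansion_double_sum[OF null fiber total] by blast
      have "vabs (B \<alpha> \<beta>) \<le> \<epsilon>" if "\<alpha> \<in> ?MI - T" "\<beta> \<in> ?MJ" for \<alpha> \<beta>
      proof -
        have "vabs (A (\<alpha>, \<beta>)) \<le> \<epsilon>" using that T(2) by (intro small) auto
        then show ?thesis using vB[of \<alpha> \<beta>] by linarith
      qed
      then have "vabs (b \<beta>) \<le> \<epsilon>" for \<beta> using b(2)[of \<epsilon>] e by simp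
      then show ?thesis
        using ind_norm_bounds[of "\<psi> T" b \<epsilon>] b(1) by (simp add: Uw_expansion_def)
    qed
    have "((\<lambda>T. ind_norm p n w (\<psi> T)) \<longlongrightarrow> 0) (finite_subsets_at_top ?MI)"
    proof (rule tendstoI)
      fix \<epsilon> :: real assume e: "\<epsilon> > 0"
      \<comment> \<open>Half of \<epsilon> makes the bound strict.\<close>
      have "dist (ind_norm p n w (\<psi> T)) 0 < \<epsilon>" if "finite T" "large (\<epsilon> / 2) \<subseteq> T" "T \<subseteq> ?MI" for T
        using bound[of "\<epsilon> / 2" T] that e by (simp add: dist_real_def)
      moreover have "finite (large (\<epsilon> / 2))" "large (\<epsilon> / 2) \<subseteq> ?MI"
        using finite_large[of "\<epsilon> / 2"] e by (auto simp: large_def)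
      ultimately show "\<forall>\<^sub>F T in finite_subsets_at_top ?MI. dist (ind_norm p n w (\<psi> T)) 0 < \<epsilon>"
        unfolding eventually_finite_subsets_at_top by blast
    qed
    then show "((\<lambda>S. ind_norm p n w (\<lambda>x. left_transl p n (?G z) f x - (\<Sum>\<alpha>\<in>S. mpower ?I z \<alpha> * F \<alpha> x)))
               \<longlongrightarrow> 0) (finite_subsets_at_top ?MI)"
      unfolding \<psi>_def .
  qed
qed

end

theorem theoremA3:
  fixes p n :: nat
    and c :: "nat \<Rightarrow> 'k::nonarch_field"
    and \<chi> :: "nat \<Rightarrow> 'k \<Rightarrow> 'k"
    and w :: "'k mat"
  assumes "prime p"
    and "n \<ge> 2"
    and "finite_extension_Qp p TYPE('k)"
    and "p > n + 1"
    and "\<And>i. i < n \<Longrightarrow> is_character (\<chi> i)"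
    and "\<And>i u. i < n \<Longrightarrow> u \<in> Zp \<Longrightarrow>
           \<chi> i (1 + of_nat p * u) = padic_exp (c i * padic_log (1 + of_nat p * u))"
    and "\<And>i. i < n \<Longrightarrow>
           padic_val p (c i) > ereal (real (ramification_index TYPE('k)) / (real p - 1) - 1)"
    and "w \<in> perm_matrices n"
  shows "globally_analytic_action p n (ind p n \<chi> w) (ind_norm p n w) (left_transl p n)"
proof -
  interpret padic_base p "TYPE('k)"
    using assms(1,3) by unfold_locales (auto simp: finite_extension_Qp_def)
  obtain \<sigma> where perm: "\<sigma> permutes {..<n}" "w = perm_mat n \<sigma>"
    using assms(8) by (auto simp: perm_matrices_def perm_mat_def)
  \<comment> \<open>The valuation hypothesis becomes |c_i p| < \<open>exp_radius\<close>, by way of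
    e \<ge> 1.\<close>
  interpret analytic_character p "TYPE('k)" n \<sigma> c \<chi>
    using perm(1) assms(6) vabs_mult_p_less_exp_radius[OF assms(7) ramification_index_pos[OF assms(3)]]
    by unfold_locales auto
  show ?thesis unfolding perm(2) by (rule left_transl_globally_analytic)
qed

end
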